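(* There exist absolute constants $C,C'>0$ such that the following holds. Let $\mathbf{A}\in\mathbb{R}^{n\times n}$ be a nonzero positive semidefinite matrix, let $1\le k\le n$, and let $\epsilon\in(0,1)$. The low-rank approximation algorithm described in the context (with constants $C,C'$) returns matrices $\mathbf{X},\mathbf{Y}\in\mathbb{R}^{n\times k}$ satisfying $$\|\mathbf{A}-\mathbf{X}\mathbf{Y}^\top\|_{\mathrm F}^2\le\|\mathbf{A}-\mathbf{A}_k\|_{\mathrm F}^2+\epsilon\|\mathbf{A}\|_{\mathrm F}^2$$ with probability at least $2/3$. The algorithm queries $O(nk/\epsilon^2)$ entries of $\mathbf{A}$ and uses $O(n(k/\epsilon^2)^{\omega-1})$ arithmetic operations in expectation, where $\omega$ is the exponent of fast matrix multiplication and the implied constants are absolute.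
   Context: $\mathbf{A}_{i,*}$ and $\mathbf{A}_{*,i}$ denote the $i$th row (as a row vector) and $i$th column of $\mathbf{A}$; $\|\cdot\|$ is the Euclidean norm, $\|\cdot\|_{\mathrm F}$ the Frobenius norm; $\mathbf{A}_k$ is the best rank-$k$ approximation of $\mathbf{A}$ in Frobenius norm (truncated SVD). Sampling subroutine (on psd $\mathbf{A}\ne0$): read the diagonal and let $\mathcal{D}(i)=\mathbf{A}_{ii}/\operatorname{tr}(\mathbf{A})$; repeat: sample $I,J\sim\mathcal{D}$ independently and with probability $\mathbf{A}_{IJ}^2/(\mathbf{A}_{II}\mathbf{A}_{JJ})$ stop and return $I$. Its output has the length-squared distribution $\Pr[I=i]=\|\mathbf{A}_{*,i}\|^2/\|\mathbf{A}\|_{\mathrm F}^2$. Algorithm. (1) Set $s=\lceil Ck/\epsilon^2\rceil$ and $t=\lceil C'k/\epsilon\rceil$. (2) Run the sampling subroutine $s$ times independently to obtain $I_1,\dots,I_s$. (3) Read the full columns $\mathbf{A}_{*,I_1},\dots,\mathbf{A}_{*,I_s}$ and form $\mathbf{B}=[\mathbf{A}_{*,I_1}/\|\mathbf{A}_{*,I_1}\|\ \cdots\ \mathbf{A}_{*,I_s}/\|\mathbf{A}_{*,I_s}\|]\in\mathbb{R}^{n\times s}$. (4) Let $\mathbf{X}\in\mathbb{R}^{n\times k}$ have as (orthonormal) columns the top-$k$ left singular vectors of $\mathbf{B}$. (5) Sample $J_1,\dots,J_t$ i.i.d. from $\mathcal{S}(i)=\|\mathbf{X}_{i,*}\|^2/k$.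 (6) Query the full rows $\mathbf{A}_{J_1,*},\dots,\mathbf{A}_{J_t,*}$ and set $\mathbf{Y}=\frac1t\sum_{r=1}^t\frac{\mathbf{A}_{J_r,*}^\top\mathbf{X}_{J_r,*}}{\|\mathbf{X}_{J_r,*}\|^2/k}\in\mathbb{R}^{n\times k}$. (7) Return $\mathbf{X},\mathbf{Y}$. Cost model: entries of $\mathbf{A}$ are accessed one query at a time; after $O(n)$ preprocessing a sample from an explicit distribution on $\{1,\dots,n\}$ costs $O(1)$ arithmetic operations; computing the top-$k$ left singular vectors of an $n\times s$ matrix is counted as $O(ns^{\omega-1})$ arithmetic operations (fast-matrix-multiplication-based SVD). *)

theory Defs
  imports "HOL-Probability.SPMF" "Jordan_Normal_Form.DL_Rank"
begin

text \<open>Matrices have the type \<^typ>\<open>real mat\<close>; rows and columns are numbered from \<open>0\<close>.\<close>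

definition vec_nrm :: "real Matrix.vec \<Rightarrow> real" where
  "vec_nrm v = sqrt (\<Sum>i<dim_vec v. (vec_index v i)\<^sup>2)"

definition frob_norm :: "real mat \<Rightarrow> real" where
  "frob_norm A = sqrt (\<Sum>i<dim_row A. \<Sum>j<dim_col A. (A $$ (i, j))\<^sup>2)"

definition psd_mat :: "nat \<Rightarrow> real mat \<Rightarrow> bool" where
  "psd_mat n A \<longleftrightarrow> A \<in> carrier_mat n n \<and> transpose_mat A = A \<and>
     (\<forall>v \<in> carrier_vec n. 0 \<le> scalar_prod v (mult_mat_vec A v))"

text \<open>A best approximation by a matrix of rank at most \<open>k\<close> need not be unique; by the
  Eckart-Young theorem these are exactly the truncated singular value decompositions of \<open>A\<close>.\<close>

definition best_rank_approx :: "nat \<Rightarrow> real mat \<Rightarrow> real mat \<Rightarrow> bool" where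
  "best_rank_approx k A M \<longleftrightarrow>
     M \<in> carrier_mat (dim_row A) (dim_col A) \<and> vec_space.rank (dim_row A) M \<le> k \<and>
     (\<forall>N \<in> carrier_mat (dim_row A) (dim_col A).
        vec_space.rank (dim_row A) N \<le> k \<longrightarrow> frob_norm (A - M) \<le> frob_norm (A - N))"

subsection \<open>Singular value decompositions\<close>

definition is_svd :: "real mat \<Rightarrow> real mat \<Rightarrow> (nat \<Rightarrow> real) \<Rightarrow> real mat \<Rightarrow> bool" where
  "is_svd B U \<sigma> V \<longleftrightarrow>
     U \<in> carrier_mat (dim_row B) (dim_row B) \<and> transpose_mat U * U = 1\<^sub>m (dim_row B) \<and>
     V \<in> carrier_mat (dim_col B) (dim_col B) \<and> transpose_mat V * V = 1\<^sub>m (dim_col B) \<and>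
     (\<forall>i. 0 \<le> \<sigma> i) \<and> (\<forall>i j. i \<le> j \<longrightarrow> \<sigma> j \<le> \<sigma> i) \<and>
     B = U * Matrix.mat (dim_row B) (dim_col B) (\<lambda>(i, j). if i = j then \<sigma> i else 0) * transpose_mat V"

text \<open>
  The left singular vectors come from a full decomposition (\<open>U\<close> is square), so \<open>k\<close> of them exist
  whenever \<open>k \<le> dim_row B\<close>, even if \<open>B\<close> has rank, or number of columns, less than \<open>k\<close>. They need
  not be unique; the algorithm is therefore parameterized by a routine that picks some.
\<close>

definition top_left_singular :: "nat \<Rightarrow> real mat \<Rightarrow> real mat \<Rightarrow> bool" where
  "top_left_singular k B X \<longleftrightarrow>
     (\<exists>U \<sigma> V. is_svd B U \<sigma> V \<and> X = Matrix.mat (dim_row B) k (\<lambda>(i, j). U $$ (i, j)))"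

definition svd_routine :: "(nat \<Rightarrow> real mat \<Rightarrow> real mat) \<Rightarrow> bool" where
  "svd_routine svd \<longleftrightarrow> (\<forall>k B. k \<le> dim_row B \<longrightarrow> top_left_singular k B (svd k B))"

subsection \<open>Arithmetic complexity of matrix multiplication\<close>

text \<open>
  \<open>straight_line I l F\<close>: \<open>F\<close> is the set of all functions of the input available after a
  straight-line program with \<open>l\<close> operations \<open>+\<close>, \<open>-\<close>, \<open>*\<close>, where the functions in \<open>I\<close> and the
  real constants are available at no cost.
\<close>

inductive straight_line :: "('x \<Rightarrow> real) set \<Rightarrow> nat \<Rightarrow> ('x \<Rightarrow> real) set \<Rightarrow> bool" for I where
  start: "straight_line I 0 (I \<union> range (\<lambda>c _. c))"
| plus: "straight_line I l F \<Longrightarrow> f \<in> F \<Longrightarrow> g \<in> F \<Longrightarrow> straight_line I (Suc l) (insert (\<lambda>x. f x + g x) F)"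
| minus: "straight_line I l F \<Longrightarrow> f \<in> F \<Longrightarrow> g \<in> F \<Longrightarrow> straight_line I (Suc l) (insert (\<lambda>x. f x - g x) F)"
| times: "straight_line I l F \<Longrightarrow> f \<in> F \<Longrightarrow> g \<in> F \<Longrightarrow> straight_line I (Suc l) (insert (\<lambda>x. f x * g x) F)"

definition matmul_inputs :: "nat \<Rightarrow> nat \<Rightarrow> nat \<Rightarrow> ((nat \<Rightarrow> nat \<Rightarrow> real) \<times> (nat \<Rightarrow> nat \<Rightarrow> real) \<Rightarrow> real) set" where
  "matmul_inputs p q r = {(\<lambda>(P, Q). P i j) | i j. i < p \<and> j < q} \<union> {(\<lambda>(P, Q). Q j l) | j l. j < q \<and> l < r}"

definition matmul_outputs :: "nat \<Rightarrow> nat \<Rightarrow> nat \<Rightarrow> ((nat \<Rightarrow> nat \<Rightarrow> real) \<times> (nat \<Rightarrow> nat \<Rightarrow> real) \<Rightarrow> real) set" where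
  "matmul_outputs p q r = {(\<lambda>(P, Q). \<Sum>j<q. P i j * Q j l) | i l. i < p \<and> l < r}"

text \<open>The number of arithmetic operations needed to multiply a \<open>p \<times> q\<close> by a \<open>q \<times> r\<close> matrix.\<close>

definition matmul_ops :: "nat \<Rightarrow> nat \<Rightarrow> nat \<Rightarrow> nat" where
  "matmul_ops p q r = (LEAST l. \<exists>F. straight_line (matmul_inputs p q r) l F \<and> matmul_outputs p q r \<subseteq> F)"

text \<open>
  As usual in running time bounds, \<open>\<omega>\<close> stands for an exponent for which square matrix
  multiplication takes \<open>O(m powr \<omega>)\<close> operations. The infimum of these exponents need not be one of
  them; every number above the infimum is.
\<close>

definition matmul_exponent :: "real \<Rightarrow> bool" where
  "matmul_exponent \<omega> \<longleftrightarrow> (\<exists>c. \<forall>m\<ge>1. real (matmul_ops m m m) \<le> c * real m powr \<omega>)"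

subsection \<open>Randomized programs with query and operation counts\<close>

record cost_model =
  prep_ops :: "nat \<Rightarrow> nat" \<comment> \<open>preprocessing of an explicit distribution on \<open>n\<close> points\<close>
  sample_ops :: "nat \<Rightarrow> nat" \<comment> \<open>one sample from a preprocessed distribution on \<open>n\<close> points\<close>
  svd_ops :: "nat \<Rightarrow> nat \<Rightarrow> nat" \<comment> \<open>top left singular vectors of an \<open>n \<times> s\<close> matrix\<close>

definition charges :: "real \<Rightarrow> real \<Rightarrow> cost_model \<Rightarrow> bool" where
  "charges c \<omega> M \<longleftrightarrow> (\<forall>n\<ge>1. real (prep_ops M n) \<le> c * real n \<and> real (sample_ops M n) \<le> c \<and>
     (\<forall>s\<ge>1. real (svd_ops M n s) \<le> c * real n * real s powr (\<omega> - 1)))"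

datatype 'a run = Run (outcome: 'a) (queries: nat) (ops: nat)

text \<open>Probability mass missing from an \<open>spmf\<close> is the probability of non-termination.\<close>

type_synonym 'a prog = "'a run spmf"

definition bind_prog :: "'a prog \<Rightarrow> ('a \<Rightarrow> 'b prog) \<Rightarrow> 'b prog" where
  "bind_prog m f = bind_spmf m (\<lambda>r. map_spmf
     (\<lambda>r'. Run (outcome r') (queries r + queries r') (ops r + ops r')) (f (outcome r)))"

lemma bind_prog_mono [partial_function_mono]:
  assumes "mono_spmf B" and "\<And>y. mono_spmf (C y)"
  shows "mono_spmf (\<lambda>f. bind_prog (B f) (\<lambda>y. C y f))"
  unfolding bind_prog_def map_spmf_conv_bind_spmf
  by (intro bind_spmf_mono assms spmf.const_mono)

no_adhoc_overloading Monad_Syntax.bind \<rightleftharpoons> bind_spmf bind_pmf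
adhoc_overloading Monad_Syntax.bind \<rightleftharpoons> bind_prog

definition ret :: "'a \<Rightarrow> 'a prog" where
  "ret x = return_spmf (Run x 0 0)"

definition tick :: "nat \<Rightarrow> unit prog" where
  "tick a = return_spmf (Run () 0 a)"

definition query :: "real mat \<Rightarrow> nat \<Rightarrow> nat \<Rightarrow> real prog" where
  "query A i j = return_spmf (Run (A $$ (i, j)) 1 0)"

definition draw :: "nat \<Rightarrow> 'a pmf \<Rightarrow> 'a prog" where
  "draw a p = map_spmf (\<lambda>x. Run x 0 a) (spmf_of_pmf p)"

primrec for_each :: "('a \<Rightarrow> 'b prog) \<Rightarrow> 'a list \<Rightarrow> 'b list prog" where
  "for_each f [] = ret []"
| "for_each f (x # xs) = do { y \<leftarrow> f x; ys \<leftarrow> for_each f xs; ret (y # ys) }"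

text \<open>The distribution on \<open>{0..<n}\<close> with probabilities \<open>w i\<close>, meaningful only if these are
  nonnegative and add up to \<open>1\<close>.\<close>

definition weights_pmf :: "nat \<Rightarrow> (nat \<Rightarrow> real) \<Rightarrow> nat pmf" where
  "weights_pmf n w = embed_pmf (\<lambda>i. if i < n then w i else 0)"

subsection \<open>The sampling subroutine\<close>

text \<open>
  The \<open>3\<close> operations compute the acceptance probability; the coin flip is a sample from an explicit
  distribution on \<open>2\<close> points.
\<close>

partial_function (spmf) sample_loop ::
  "cost_model \<Rightarrow> real mat \<Rightarrow> real list \<Rightarrow> nat pmf \<Rightarrow> nat prog" where
  "sample_loop M A d D = do {
     i \<leftarrow> draw (sample_ops M (dim_row A)) D;
     j \<leftarrow> draw (sample_ops M (dim_row A)) D;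
     a \<leftarrow> query A i j;
     tick (3 + prep_ops M 2);
     b \<leftarrow> draw (sample_ops M 2) (bernoulli_pmf (a\<^sup>2 / (d ! i * d ! j)));
     if b then ret i else sample_loop M A d D }"

text \<open>Trace and normalization of the diagonal take at most \<open>2n\<close> operations.\<close>

definition sample_index :: "cost_model \<Rightarrow> real mat \<Rightarrow> nat prog" where
  "sample_index M A = (let n = dim_row A in do {
     d \<leftarrow> for_each (\<lambda>i. query A i i) [0..<n];
     tick (2 * n + prep_ops M n);
     sample_loop M A d (weights_pmf n (\<lambda>i. d ! i / sum_list d)) })"

subsection \<open>The low-rank approximation algorithm\<close>

definition read_col :: "real mat \<Rightarrow> nat \<Rightarrow> real Matrix.vec prog" where
  "read_col A j = do { xs \<leftarrow> for_each (\<lambda>i. query A i j) [0..<dim_row A]; ret (vec_of_list xs) }"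

definition read_row :: "real mat \<Rightarrow> nat \<Rightarrow> real Matrix.vec prog" where
  "read_row A i = do { xs \<leftarrow> for_each (\<lambda>j. query A i j) [0..<dim_col A]; ret (vec_of_list xs) }"

text \<open>
  Operations charged besides the calls of routines from the cost model: \<open>3n\<close> for each column of \<open>B\<close>
  (\<open>2n\<close> for its norm, \<open>n\<close> for scaling); \<open>2k\<close> for each weight \<open>w i = \<parallel>row X i\<parallel>\<^sup>2 / k\<close>; and for
  \<open>Y\<close>, which is the product of the \<open>n \<times> t\<close> matrix with columns \<open>rows ! r\<close> and the \<open>t \<times> k\<close> matrix
  with rows \<open>row X (Js ! r) / (t * w (Js ! r))\<close>, the \<open>t (k + 1)\<close> operations that form the second
  factor, and one fast matrix multiplication.
\<close>

definition low_rank_approx ::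
  "real \<Rightarrow> real \<Rightarrow> cost_model \<Rightarrow> (nat \<Rightarrow> real mat \<Rightarrow> real mat) \<Rightarrow> real mat \<Rightarrow> nat \<Rightarrow> real \<Rightarrow>
   (real mat \<times> real mat) prog" where
  "low_rank_approx C C' M svd A k \<epsilon> =
    (let n = dim_row A;
         s = nat \<lceil>C * real k / \<epsilon>\<^sup>2\<rceil>;
         t = nat \<lceil>C' * real k / \<epsilon>\<rceil>
     in do {
       Is \<leftarrow> for_each (\<lambda>_. sample_index M A) [0..<s];
       cols \<leftarrow> for_each (read_col A) Is;
       tick (s * (3 * n));
       let B = mat_of_cols n (map (\<lambda>v. smult_vec (1 / vec_nrm v) v) cols);
       tick (svd_ops M n s);
       let X = svd k B;
       let w = (\<lambda>i. (vec_nrm (Matrix.row X i))\<^sup>2 / real k);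
       tick (n * (2 * k) + prep_ops M n);
       Js \<leftarrow> for_each (\<lambda>_. draw (sample_ops M n) (weights_pmf n w)) [0..<t];
       rows \<leftarrow> for_each (read_row A) Js;
       let Y = Matrix.mat n k (\<lambda>(i, j).
                 1 / real t * (\<Sum>r<t. vec_index (rows ! r) i * X $$ (Js ! r, j) / w (Js ! r)));
       tick (t * (k + 1) + matmul_ops n t k);
       ret (X, Y) })"

end

(* Write X for the top k left singular vectors of B, g = ||A||_F^2 / s and D = A A^T - g B B^T.
   For orthonormal X,
     ||A - X Y^T||^2 = ||A||^2 - ||A^T X||^2 + ||A^T X - Y||^2,
   and a matrix of rank at most k is Z N^T with orthonormal Z, hence at distance at least
   ||A||^2 - ||A^T Z||^2 from A.  Since ||A^T X||^2 = <D, X X^T> + g ||B^T X||^2 and X maximizes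
   ||B^T X|| (Ky Fan), the loss ||A^T Z||^2 - ||A^T X||^2 is at most <D, Z Z^T - X X^T>, which by
   AM-GM is at most mu k + ||D||^2 / mu for every mu > 0.  Both D and A^T X - Y are errors of a
   mean of independent samples, with E ||D||^2 <= ||A||^4 / s and
   E ||A^T X - Y||^2 <= k ||A||^2 / t, so one application of Markov's inequality to the total error
   gives probability 2/3.

   One trial of the sampling subroutine succeeds with probability ||A||^2 / tr(A)^2 >= 1/n, so a
   sample takes at most n trials in expectation.  The operation count needs omega >= 2, which holds
   because the m^2 entries of a matrix product are distinct new functions and a straight-line
   program gains one function per step; the product forming Y is split into k x k blocks. *)

theory Submission
  imports Defs
begin

section \<open>Straight-line programs for matrix multiplication\<close>

text \<open>Cauchy-Schwarz would bound the loss by a multiple of sqrt(k) ||D||, while sampling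
  controls the mean of ||D||^2. The AM-GM form is linear in ||D||^2, so means pass through it and
  the error of \<open>Y\<close> can be added before applying Markov. The law of the second sample
  depends on the first through \<open>X\<close>, but its error bound is uniform over orthonormal
  \<open>X\<close> and survives averaging. The constants come from the budget e = eps ||A||^2, of
  which the mean may use e/3: mu k and E ||D||^2 / mu take e/12 each and the error of
  \<open>Y\<close> takes e/6. With mu = e / (12 k) this asks for s >= 144 k / eps^2 and t >= 6 k /
  eps. The orthonormal Z of the competitor is obtained from the assumed SVD routine, applied to a
  factor of it with k columns. The rejection loop enters only through its fixpoint equation, which
  determines the law of the output and, after truncation, bounds the expected cost. Zero columns of
  \<open>A\<close>, zero rows of \<open>X\<close> and zero diagonal entries lead to divisions by
  zero. These yield 0, and each time the quantity being estimated vanishes as well, so the formulas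
  for the means stay correct.\<close>

lemma straight_line_base: "straight_line I l F \<Longrightarrow> I \<union> range (\<lambda>c _. c) \<subseteq> F"
  by (induction rule: straight_line.induct) auto

lemma straight_line_card:
  "straight_line I l F \<Longrightarrow> finite (F - (I \<union> range (\<lambda>c _. c))) \<and> card (F - (I \<union> range (\<lambda>c _. c))) \<le> l"
proof (induction rule: straight_line.induct)
  case start
  then show ?case by simp
qed (auto simp: insert_Diff_if card_insert_if)

text \<open>Programs compose: pulling back along \<open>\<sigma>\<close> commutes with the pointwise
  operations, so once the pulled-back inputs are available every step of the first program can be
  replayed at the same price. Block multiplication calls the square routine in this way.\<close>

lemma straight_line_subst:
  assumes "straight_line I l F" "straight_line I' l' F'" "\<And>f. f \<in> I \<Longrightarrow> f \<circ> \<sigma> \<in> F'"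
  shows "\<exists>F''. straight_line I' (l' + l) F'' \<and> F' \<subseteq> F'' \<and> (\<lambda>f. f \<circ> \<sigma>) ` F \<subseteq> F''"
  using assms(1)
proof (induction rule: straight_line.induct)
  case start
  have "(\<lambda>f. f \<circ> \<sigma>) ` (I \<union> range (\<lambda>c _. c)) \<subseteq> F'"
    using assms(3) straight_line_base[OF assms(2)] by (auto simp: o_def)
  then show ?case using assms(2) by (metis add_0_right order_refl)
next
  case (plus l F f g)
  then obtain F'' where F'': "straight_line I' (l' + l) F''" "F' \<subseteq> F''" "(\<lambda>f. f \<circ> \<sigma>) ` F \<subseteq> F''" by blast
  with plus(2,3) have "f \<circ> \<sigma> \<in> F''" "g \<circ> \<sigma> \<in> F''" by auto
  from straight_line.plus[OF F''(1) this] F''(2,3) show ?case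
    by (intro exI[of _ "insert (\<lambda>x. (f \<circ> \<sigma>) x + (g \<circ> \<sigma>) x) F''"]) (auto simp: o_def)
next
  case (minus l F f g)
  then obtain F'' where F'': "straight_line I' (l' + l) F''" "F' \<subseteq> F''" "(\<lambda>f. f \<circ> \<sigma>) ` F \<subseteq> F''" by blast
  with minus(2,3) have "f \<circ> \<sigma> \<in> F''" "g \<circ> \<sigma> \<in> F''" by auto
  from straight_line.minus[OF F''(1) this] F''(2,3) show ?case
    by (intro exI[of _ "insert (\<lambda>x. (f \<circ> \<sigma>) x - (g \<circ> \<sigma>) x) F''"]) (auto simp: o_def)
next
  case (times l F f g)
  then obtain F'' where F'': "straight_line I' (l' + l) F''" "F' \<subseteq> F''" "(\<lambda>f. f \<circ> \<sigma>) ` F \<subseteq> F''" by blast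
  with times(2,3) have "f \<circ> \<sigma> \<in> F''" "g \<circ> \<sigma> \<in> F''" by auto
  from straight_line.times[OF F''(1) this] F''(2,3) show ?case
    by (intro exI[of _ "insert (\<lambda>x. (f \<circ> \<sigma>) x * (g \<circ> \<sigma>) x) F''"]) (auto simp: o_def)
qed

text \<open>\<open>straight_line\<close> fixes the whole set of results, intermediate ones included.
  Passing to a subset allows bounds that do not name them.\<close>

definition computes :: "('x \<Rightarrow> real) set \<Rightarrow> nat \<Rightarrow> ('x \<Rightarrow> real) set \<Rightarrow> bool" where
  "computes I l G \<longleftrightarrow> (\<exists>F. straight_line I l F \<and> G \<subseteq> F)"

lemma computes_base: "computes I 0 (I \<union> range (\<lambda>c _. c))"
  unfolding computes_def using straight_line.start by blast

lemma computes_mono: "computes I l G \<Longrightarrow> H \<subseteq> G \<Longrightarrow> computes I l H"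
  unfolding computes_def by blast

lemma computes_plus:
  "computes I l G \<Longrightarrow> f \<in> G \<Longrightarrow> g \<in> G \<Longrightarrow> computes I (Suc l) (insert (\<lambda>x. f x + g x) G)"
  unfolding computes_def by (blast intro: straight_line.plus)

lemma computes_times:
  "computes I l G \<Longrightarrow> f \<in> G \<Longrightarrow> g \<in> G \<Longrightarrow> computes I (Suc l) (insert (\<lambda>x. f x * g x) G)"
  unfolding computes_def by (blast intro: straight_line.times)

lemma computes_subst:
  assumes "computes I l H" "computes I' l' G" "\<And>f. f \<in> I \<Longrightarrow> f \<circ> \<sigma> \<in> G"
  shows "computes I' (l' + l) (G \<union> (\<lambda>f. f \<circ> \<sigma>) ` H)"
proof -
  obtain F F' where *: "straight_line I l F" "H \<subseteq> F" "straight_line I' l' F'" "G \<subseteq> F'"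
    using assms(1,2) unfolding computes_def by blast
  from assms(3) * have "\<And>f. f \<in> I \<Longrightarrow> f \<circ> \<sigma> \<in> F'" by blast
  from straight_line_subst[OF *(1,3) this] * show ?thesis unfolding computes_def by blast
qed

text \<open>The sum starts from the constant \<open>0\<close>, which is free; hence \<open>q\<close>
  additions instead of \<open>q - 1\<close>, with no exception at \<open>q = 0\<close>.\<close>

lemma computes_sum:
  assumes "computes I l G" "range (\<lambda>c _. c) \<subseteq> G" "\<And>j. j < q \<Longrightarrow> f j \<in> G"
  shows "computes I (l + q) (insert (\<lambda>x. \<Sum>j<q. f j x) G)"
  using assms(3)
proof (induction q)
  case 0
  have "insert (\<lambda>x. 0) G = G" using assms(2) by blast
  then show ?case using assms(1) by simp
next
  case (Suc q)
  then have "computes I (l + q) (insert (\<lambda>x. \<Sum>j<q. f j x) G)" by simp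
  then have "computes I (Suc (l + q)) (insert (\<lambda>x. (\<Sum>j<q. f j x) + f q x) (insert (\<lambda>x. \<Sum>j<q. f j x) G))"
    using Suc.prems by (intro computes_plus) auto
  from computes_mono[OF this, of "insert (\<lambda>x. \<Sum>j<Suc q. f j x) G"] show ?case by auto
qed

text \<open>The step is assumed for every \<open>H\<close> containing \<open>G\<close>, because the
  results of the tasks already done have accumulated when the next one starts.\<close>

lemma computes_each:
  assumes "finite T" "computes I l G"
    and "\<And>t l H. t \<in> T \<Longrightarrow> computes I l H \<Longrightarrow> G \<subseteq> H \<Longrightarrow> computes I (l + c) (H \<union> h t)"
  shows "computes I (l + card T * c) (G \<union> (\<Union>t\<in>T. h t))"
  using assms(1,3)
proof (induction T rule: finite_induct)
  case empty
  then show ?case using assms(2) by simp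
next
  case (insert t T)
  then have "computes I (l + card T * c + c) ((G \<union> (\<Union>t\<in>T. h t)) \<union> h t)" by simp
  moreover have "(G \<union> (\<Union>t\<in>T. h t)) \<union> h t = G \<union> (\<Union>t\<in>insert t T. h t)" by auto
  moreover have "l + card T * c + c = l + card (insert t T) * c" using insert.hyps by simp
  ultimately show ?case by metis
qed

text \<open>This guarantees that some program exists, so that the \<open>LEAST\<close> in
  \<open>matmul_ops\<close> is attained. The count is that of the school method: \<open>q\<close>
  products and \<open>q\<close> additions per entry.\<close>

lemma computes_matmul: "computes (matmul_inputs p q r) (p * r * (2 * q)) (matmul_outputs p q r)"
proof -
  let ?G = "matmul_inputs p q r \<union> range (\<lambda>c _. c)"
  define f :: "nat \<times> nat \<Rightarrow> nat \<Rightarrow> (nat \<Rightarrow> nat \<Rightarrow> real) \<times> (nat \<Rightarrow> nat \<Rightarrow> real) \<Rightarrow> real"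
    where "f = (\<lambda>t j x. fst x (fst t) j * snd x j (snd t))"
  have 1: "computes (matmul_inputs p q r) (0 + card ({..<p} \<times> {..<r}) * (2 * q))
      (?G \<union> (\<Union>t\<in>{..<p} \<times> {..<r}. {\<lambda>x. \<Sum>j<q. f t j x}))"
  proof (rule computes_each)
    show "computes (matmul_inputs p q r) 0 ?G" by (rule computes_base)
  next
    fix t l H assume t: "t \<in> {..<p} \<times> {..<r}" and H: "computes (matmul_inputs p q r) l H" "?G \<subseteq> H"
    have "computes (matmul_inputs p q r) (l + card {..<q} * 1) (H \<union> (\<Union>j\<in>{..<q}. {f t j}))"
    proof (rule computes_each[OF _ H(1)])
      fix j l H' assume j: "j \<in> {..<q}" and H': "computes (matmul_inputs p q r) l H'" "H \<subseteq> H'"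
      have "(\<lambda>(P, Q). P (fst t) j) \<in> matmul_inputs p q r" "(\<lambda>(P, Q). Q j (snd t)) \<in> matmul_inputs p q r"
        using t j unfolding matmul_inputs_def by fastforce+
      then have "computes (matmul_inputs p q r) (Suc l) (insert (\<lambda>x. (\<lambda>(P, Q). P (fst t) j) x * (\<lambda>(P, Q). Q j (snd t)) x) H')"
        using H H' by (intro computes_times) auto
      then show "computes (matmul_inputs p q r) (l + 1) (H' \<union> {f t j})"
        by (auto simp: f_def case_prod_beta)
    qed auto
    then have "computes (matmul_inputs p q r) (l + q + q) (insert (\<lambda>x. \<Sum>j<q. f t j x) (H \<union> (\<Union>j\<in>{..<q}. {f t j})))"
      using H by (intro computes_sum) auto
    then show "computes (matmul_inputs p q r) (l + 2 * q) (H \<union> {\<lambda>x. \<Sum>j<q. f t j x})"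
      unfolding mult_2 add.assoc[symmetric] by (rule computes_mono) auto
  qed auto
  have 2: "matmul_outputs p q r \<subseteq> (\<Union>t\<in>{..<p} \<times> {..<r}. {\<lambda>x. \<Sum>j<q. f t j x})"
    unfolding matmul_outputs_def f_def by (auto simp: case_prod_unfold)
  show ?thesis using computes_mono[OF 1 le_supI2[OF 2]] by simp
qed

section \<open>The cost of square products and the lower bound on the exponent\<close>

lemma matmul_ops_computes: "computes (matmul_inputs p q r) (matmul_ops p q r) (matmul_outputs p q r)"
  using LeastI[of "\<lambda>l. computes (matmul_inputs p q r) l (matmul_outputs p q r)", OF computes_matmul]
  unfolding matmul_ops_def computes_def .

lemma matmul_ops_le: "computes (matmul_inputs p q r) l (matmul_outputs p q r) \<Longrightarrow> matmul_ops p q r \<le> l"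
  unfolding matmul_ops_def computes_def by (rule Least_le)

lemma matmul_ops_ge:
  assumes "1 \<le> m"
  shows "m * m \<le> matmul_ops m m m"
proof -
  let ?I = "matmul_inputs m m m" and ?C = "range (\<lambda>c _. c) :: ((nat \<Rightarrow> nat \<Rightarrow> real) \<times> (nat \<Rightarrow> nat \<Rightarrow> real) \<Rightarrow> real) set"
  define out where "out = (\<lambda>(i, l) (P :: nat \<Rightarrow> nat \<Rightarrow> real, Q :: nat \<Rightarrow> nat \<Rightarrow> real). \<Sum>j<m. P i j * Q j l)"
  \<comment> \<open>Matrix units. The product of \<open>E a 0\<close> and \<open>E 0 b\<close> is
    the unit at \<open>(a, b)\<close>, so evaluating there separates the outputs; the inner index
    \<open>0\<close> lies in the range because \<open>1 \<le> m\<close>.\<close>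
  define E :: "nat \<Rightarrow> nat \<Rightarrow> nat \<Rightarrow> nat \<Rightarrow> real" where "E = (\<lambda>a b i j. if i = a \<and> j = b then 1 else 0)"
  have ev: "out (i, l) (E a 0, E 0 b) = (if i = a \<and> l = b then 1 else 0)" for i l a b
  proof -
    have "out (i, l) (E a 0, E 0 b) = (\<Sum>j<m. if j = 0 then (if i = a \<and> l = b then 1 else 0) else 0)"
      unfolding out_def E_def prod.case by (rule sum.cong) auto
    then show ?thesis using assms by (simp add: sum.delta)
  qed
  have ev0: "out (i, l) (\<lambda>_ _. 0, Q) = 0" "out (i, l) (P, \<lambda>_ _. 0) = 0" for i l P Q
    unfolding out_def by simp_all
  have inj: "inj out"
  proof (rule injI)
    fix s t assume "out s = out t"
    then have "out s (E (fst s) 0, E 0 (snd s)) = out t (E (fst s) 0, E 0 (snd s))" by simp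
    then show "s = t" using ev[of "fst s" "snd s" "fst s" "snd s"] ev[of "fst t" "snd t" "fst s" "snd s"]
      by (auto simp: prod_eq_iff split: if_splits)
  qed
  \<comment> \<open>An output is bilinear: it drops from 1 to 0 when a factor is replaced by zero. A
    constant does not change then, nor does an entry of one factor when the other is
    replaced.\<close>
  have new: "out (i, l) \<notin> ?I \<union> ?C" for i l
  proof
    assume "out (i, l) \<in> ?I \<union> ?C"
    then consider (c) c where "out (i, l) = (\<lambda>_. c)" | (P) a b where "out (i, l) = (\<lambda>(P, Q). P a b)"
      | (Q) a b where "out (i, l) = (\<lambda>(P, Q). Q a b)"
      unfolding matmul_inputs_def by blast
    then show False
    proof cases
      case c
      then have "out (i, l) (E i 0, E 0 l) = out (i, l) (\<lambda>_ _. 0, \<lambda>_ _. 0)" by simp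
      then show False unfolding ev ev0 by simp
    next
      case P
      then have "out (i, l) (E i 0, E 0 l) = out (i, l) (E i 0, \<lambda>_ _. 0)" by simp
      then show False unfolding ev ev0 by simp
    next
      case Q
      then have "out (i, l) (E i 0, E 0 l) = out (i, l) (\<lambda>_ _. 0, E 0 l)" by simp
      then show False unfolding ev ev0 by simp
    qed
  qed
  obtain F where F: "straight_line ?I (matmul_ops m m m) F" "matmul_outputs m m m \<subseteq> F"
    using matmul_ops_computes[of m m m] unfolding computes_def by blast
  have "out ` ({..<m} \<times> {..<m}) \<subseteq> F - (?I \<union> ?C)"
  proof -
    have "out ` ({..<m} \<times> {..<m}) \<subseteq> matmul_outputs m m m"
      unfolding out_def matmul_outputs_def by auto
    then show ?thesis using F(2) new by fast
  qed
  then have "card (out ` ({..<m} \<times> {..<m})) \<le> matmul_ops m m m"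
    using straight_line_card[OF F(1)] by (meson card_mono le_trans)
  moreover have "card (out ` ({..<m} \<times> {..<m})) = m * m"
    using card_image[OF inj_on_subset[OF inj subset_UNIV]] by (simp add: card_cartesian_product)
  ultimately show ?thesis by simp
qed

lemma matmul_exponent_ge_2:
  assumes "matmul_exponent \<omega>"
  shows "2 \<le> \<omega>"
proof (rule ccontr)
  assume "\<not> 2 \<le> \<omega>"
  then have d: "0 < 2 - \<omega>" by simp
  obtain c where c: "\<And>m. 1 \<le> m \<Longrightarrow> real (matmul_ops m m m) \<le> c * real m powr \<omega>"
    using assms unfolding matmul_exponent_def by blast
  have "real m powr (2 - \<omega>) \<le> c" if "1 \<le> m" for m :: nat
  proof -
    have "real m powr 2 = real (m * m)" using that by (simp add: powr_realpow power2_eq_square)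
    also have "\<dots> \<le> real (matmul_ops m m m)" using matmul_ops_ge[OF that] by (simp only: of_nat_le_iff)
    also have "\<dots> \<le> c * real m powr \<omega>" by (rule c[OF that])
    finally show ?thesis using that by (simp add: powr_diff pos_divide_le_eq)
  qed
  moreover have "filterlim (\<lambda>m. real m powr (2 - \<omega>)) at_top sequentially"
    using d by real_asymp
  then have "eventually (\<lambda>m. real m powr (2 - \<omega>) \<ge> c + 1) sequentially"
    by (simp add: filterlim_at_top)
  then have "eventually (\<lambda>m. real m powr (2 - \<omega>) \<ge> c + 1 \<and> 1 \<le> m) sequentially"
    using eventually_ge_at_top[of 1] by eventually_elim simp
  then obtain m where "real m powr (2 - \<omega>) \<ge> c + 1" "1 \<le> m"
    using eventually_happens by force
  ultimately show False by force
qed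

section \<open>Rectangular products from square blocks\<close>

lemma sum_blocks:
  fixes f :: "nat \<Rightarrow> real"
  assumes "q \<le> b * m"
  shows "(\<Sum>\<beta><b. \<Sum>j<m. if \<beta> * m + j < q then f (\<beta> * m + j) else 0) = (\<Sum>j<q. f j)"
proof -
  let ?g = "\<lambda>j. if j < q then f j else 0"
  have "(\<Sum>\<beta><b. \<Sum>j<m. ?g (\<beta> * m + j)) = (\<Sum>\<beta><b. sum ?g {\<beta> * m..<\<beta> * m + m})"
  proof (rule sum.cong[OF refl])
    fix \<beta>
    show "(\<Sum>j<m. ?g (\<beta> * m + j)) = sum ?g {\<beta> * m..<\<beta> * m + m}"
      by (rule sum.reindex_bij_witness[of _ "\<lambda>i. i - \<beta> * m" "\<lambda>j. \<beta> * m + j"]) auto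
  qed
  also have "\<dots> = sum ?g {..<b * m}" by (rule sum.nat_group)
  also have "\<dots> = sum ?g {..<q}" using assms by (intro sum.mono_neutral_right) auto
  finally show ?thesis by simp
qed

text \<open>Padded with zeros, the left factor splits into \<open>a * b\<close> square blocks and
  the right one into \<open>b\<close>. One square product is spent on each left block, and then each
  of the \<open>p * m\<close> entries adds up \<open>b\<close> partial results.\<close>

lemma matmul_ops_blocks:
  assumes m: "1 \<le> m" and p: "p \<le> a * m" and q: "q \<le> b * m"
  shows "matmul_ops p q m \<le> a * b * matmul_ops m m m + p * m * b"
proof -
  let ?I = "matmul_inputs p q m" and ?c = "matmul_ops m m m"
  let ?G = "?I \<union> range (\<lambda>c _. c)"
  \<comment> \<open>Extracts block \<open>(\<alpha>, \<beta>)\<close> of the left factor and block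
    \<open>\<beta>\<close> of the right one. Padding is free since zero is a constant.\<close>
  define \<sigma> where "\<sigma> = (\<lambda>(\<alpha>, \<beta>) (P :: nat \<Rightarrow> nat \<Rightarrow> real, Q :: nat \<Rightarrow> nat \<Rightarrow> real).
    (\<lambda>i j. if \<alpha> * m + i < p \<and> \<beta> * m + j < q then P (\<alpha> * m + i) (\<beta> * m + j) else 0,
     \<lambda>j l. if \<beta> * m + j < q then Q (\<beta> * m + j) l else 0))"
  let ?T = "{..<a} \<times> {..<b}"
  let ?H = "?G \<union> (\<Union>t\<in>?T. (\<lambda>f. f \<circ> \<sigma> t) ` matmul_outputs m m m)"
  have "computes ?I (0 + card ?T * ?c) ?H"
  proof (rule computes_each)
    show "computes ?I 0 ?G" by (rule computes_base)
  next
    fix t l H assume t: "t \<in> ?T" and H: "computes ?I l H" "?G \<subseteq> H"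
    obtain \<alpha> \<beta> where t_def: "t = (\<alpha>, \<beta>)" by fastforce
    have "f \<circ> \<sigma> t \<in> ?G" if "f \<in> matmul_inputs m m m" for f
    proof -
      from that consider (P) i j where "i < m" "j < m" "f = (\<lambda>(P, Q). P i j)"
        | (Q) j l where "j < m" "l < m" "f = (\<lambda>(P, Q). Q j l)"
        unfolding matmul_inputs_def by blast
      then show ?thesis
      proof cases
        case P
        then have "f \<circ> \<sigma> t = (if \<alpha> * m + i < p \<and> \<beta> * m + j < q then \<lambda>(P, Q). P (\<alpha> * m + i) (\<beta> * m + j) else (\<lambda>_. 0))"
          by (auto simp: \<sigma>_def t_def fun_eq_iff)
        then show ?thesis unfolding matmul_inputs_def by auto
      next
        case Q
        then have "f \<circ> \<sigma> t = (if \<beta> * m + j < q then \<lambda>(P, Q). Q (\<beta> * m + j) l else (\<lambda>_. 0))"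
          by (auto simp: \<sigma>_def t_def fun_eq_iff)
        then show ?thesis using Q unfolding matmul_inputs_def by auto
      qed
    qed
    then show "computes ?I (l + ?c) (H \<union> (\<lambda>f. f \<circ> \<sigma> t) ` matmul_outputs m m m)"
      using H by (intro computes_subst[OF matmul_ops_computes]) auto
  qed auto
  then have H: "computes ?I (a * b * ?c) ?H" by simp
  \<comment> \<open>Row \<open>i\<close> is row \<open>i mod m\<close> of block row
    \<open>i div m\<close>; \<open>g (i, l) \<beta>\<close> is the contribution of inner block
    \<open>\<beta>\<close> to entry \<open>(i, l)\<close>.\<close>
  define g where "g = (\<lambda>(i, l) \<beta>. (\<lambda>(P :: nat \<Rightarrow> nat \<Rightarrow> real, Q :: nat \<Rightarrow> nat \<Rightarrow> real). \<Sum>j<m. P (i mod m) j * Q j l) \<circ> \<sigma> (i div m, \<beta>))"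
  have 1: "computes ?I (a * b * ?c + card ({..<p} \<times> {..<m}) * b) (?H \<union> (\<Union>t\<in>{..<p} \<times> {..<m}. {\<lambda>x. \<Sum>\<beta><b. g t \<beta> x}))"
  proof (rule computes_each[OF _ H])
    fix t l H assume t: "t \<in> {..<p} \<times> {..<m}" and H: "computes ?I l H" "?H \<subseteq> H"
    have "g t \<beta> \<in> H" if "\<beta> < b" for \<beta>
    proof -
      have "fst t div m < a" using t p m by (auto simp: less_mult_imp_div_less)
      then have *: "(fst t div m, \<beta>) \<in> ?T" using that by simp
      have "(\<lambda>(P, Q). \<Sum>j<m. P (fst t mod m) j * Q j (snd t)) \<in> matmul_outputs m m m"
        unfolding matmul_outputs_def mem_Collect_eq using t m
        by (intro exI[of _ "fst t mod m"] exI[of _ "snd t"]) auto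
      then have "(\<lambda>(P, Q). \<Sum>j<m. P (fst t mod m) j * Q j (snd t)) \<circ> \<sigma> (fst t div m, \<beta>)
          \<in> (\<lambda>f. f \<circ> \<sigma> (fst t div m, \<beta>)) ` matmul_outputs m m m" by blast
      then have "g t \<beta> \<in> ?H" using * unfolding g_def by (auto simp: case_prod_beta)
      then show ?thesis using H by blast
    qed
    then have "computes ?I (l + b) (insert (\<lambda>x. \<Sum>\<beta><b. g t \<beta> x) H)"
      using H by (intro computes_sum) auto
    then show "computes ?I (l + b) (H \<union> {\<lambda>x. \<Sum>\<beta><b. g t \<beta> x})" by simp
  qed auto
  have 2: "matmul_outputs p q m \<subseteq> (\<Union>t\<in>{..<p} \<times> {..<m}. {\<lambda>x. \<Sum>\<beta><b. g t \<beta> x})"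
  proof
    fix f assume "f \<in> matmul_outputs p q m"
    then obtain i l where il: "i < p" "l < m" "f = (\<lambda>(P, Q). \<Sum>j<q. P i j * Q j l)"
      unfolding matmul_outputs_def by blast
    have "f = (\<lambda>x. \<Sum>\<beta><b. g (i, l) \<beta> x)"
    proof
      fix x :: "(nat \<Rightarrow> nat \<Rightarrow> real) \<times> (nat \<Rightarrow> nat \<Rightarrow> real)"
      obtain P Q where x: "x = (P, Q)" by fastforce
      have "(\<Sum>\<beta><b. g (i, l) \<beta> x) = (\<Sum>\<beta><b. \<Sum>j<m. if \<beta> * m + j < q then P i (\<beta> * m + j) * Q (\<beta> * m + j) l else 0)"
        unfolding g_def \<sigma>_def x using il(1) by (auto intro!: sum.cong)
      also have "\<dots> = f x" using sum_blocks[OF q, of "\<lambda>j. P i j * Q j l"] il x by simp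
      finally show "f x = (\<Sum>\<beta><b. g (i, l) \<beta> x)" by simp
    qed
    then show "f \<in> (\<Union>t\<in>{..<p} \<times> {..<m}. {\<lambda>x. \<Sum>\<beta><b. g t \<beta> x})" using il by blast
  qed
  have "computes ?I (a * b * ?c + p * m * b) (matmul_outputs p q m)"
    using computes_mono[OF 1 le_supI2[OF 2]] by simp
  then show ?thesis by (rule matmul_ops_le)
qed

section \<open>The Frobenius inner product\<close>

lemma mult_index_sum:
  "A \<in> carrier_mat n p \<Longrightarrow> B \<in> carrier_mat p m \<Longrightarrow> i < n \<Longrightarrow> j < m \<Longrightarrow>
    (A * B) $$ (i, j) = (\<Sum>l<p. A $$ (i, l) * B $$ (l, j))"
  by (simp add: scalar_prod_def lessThan_atLeast0)

definition frob_inner :: "real mat \<Rightarrow> real mat \<Rightarrow> real" where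
  "frob_inner A B = (\<Sum>i<dim_row A. \<Sum>j<dim_col A. A $$ (i, j) * B $$ (i, j))"

lemma frob_inner_carrier:
  "A \<in> carrier_mat n m \<Longrightarrow> frob_inner A B = (\<Sum>i<n. \<Sum>j<m. A $$ (i, j) * B $$ (i, j))"
  unfolding frob_inner_def by auto

lemma frob_inner_self: "frob_inner A A = (frob_norm A)\<^sup>2"
  unfolding frob_inner_def frob_norm_def by (simp add: power2_eq_square sum_nonneg)

lemma frob_norm_carrier:
  "A \<in> carrier_mat n m \<Longrightarrow> (frob_norm A)\<^sup>2 = (\<Sum>i<n. \<Sum>j<m. (A $$ (i, j))\<^sup>2)"
  unfolding frob_inner_self[symmetric] by (simp add: frob_inner_carrier power2_eq_square)

lemma frob_inner_commute:
  "A \<in> carrier_mat n m \<Longrightarrow> B \<in> carrier_mat n m \<Longrightarrow> frob_inner A B = frob_inner B A"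
  by (simp add: frob_inner_carrier mult.commute)

lemma frob_inner_diff_left:
  assumes "A \<in> carrier_mat n m" "B \<in> carrier_mat n m"
  shows "frob_inner (A - B) D = frob_inner A D - frob_inner B D"
proof -
  have "A - B \<in> carrier_mat n m" using assms by (simp add: minus_carrier_mat)
  then show ?thesis using assms
    by (simp add: frob_inner_carrier left_diff_distrib sum_subtractf)
qed

lemma frob_inner_smult_left:
  assumes "A \<in> carrier_mat n m"
  shows "frob_inner (a \<cdot>\<^sub>m A) D = a * frob_inner A D"
proof -
  have "a \<cdot>\<^sub>m A \<in> carrier_mat n m" using assms by simp
  from frob_inner_carrier[OF this] frob_inner_carrier[OF assms] show ?thesis
    using assms by (simp add: sum_distrib_left mult.assoc)
qed

lemma frob_norm_diff:
  assumes "A \<in> carrier_mat n m" "B \<in> carrier_mat n m"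
  shows "(frob_norm (A - B))\<^sup>2 = (frob_norm A)\<^sup>2 - 2 * frob_inner A B + (frob_norm B)\<^sup>2"
proof -
  have AB: "A - B \<in> carrier_mat n m" using assms by (simp add: minus_carrier_mat)
  have "(frob_norm (A - B))\<^sup>2 = frob_inner A (A - B) - frob_inner B (A - B)"
    unfolding frob_inner_self[symmetric] by (rule frob_inner_diff_left[OF assms])
  also have "\<dots> = frob_inner (A - B) A - frob_inner (A - B) B"
    using frob_inner_commute[OF assms(1) AB] frob_inner_commute[OF assms(2) AB] by simp
  also have "\<dots> = (frob_norm A)\<^sup>2 - 2 * frob_inner A B + (frob_norm B)\<^sup>2"
    using frob_inner_commute[OF assms] 
    unfolding frob_inner_diff_left[OF assms] frob_inner_self[symmetric] by simp
  finally show ?thesis .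
qed

lemma frob_inner_transpose:
  assumes "A \<in> carrier_mat n m" "B \<in> carrier_mat n m"
  shows "frob_inner (transpose_mat A) (transpose_mat B) = frob_inner A B"
proof -
  have "transpose_mat A \<in> carrier_mat m n" using assms by simp
  then show ?thesis using assms by (simp add: frob_inner_carrier) (rule sum.swap)
qed

lemma frob_inner_mult_right:
  assumes A: "A \<in> carrier_mat n m" and P: "P \<in> carrier_mat n p" and B: "B \<in> carrier_mat p m"
  shows "frob_inner A (P * B) = frob_inner (transpose_mat P * A) B"
proof -
  have PA: "transpose_mat P * A \<in> carrier_mat p m" and Pt: "transpose_mat P \<in> carrier_mat p n"
    using assms by simp_all
  have "frob_inner A (P * B) = (\<Sum>i<n. \<Sum>j<m. \<Sum>l<p. A $$ (i, j) * (P $$ (i, l) * B $$ (l, j)))"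
    unfolding frob_inner_carrier[OF A]
    by (intro sum.cong refl) (simp add: mult_index_sum[OF P B] sum_distrib_left)
  also have "\<dots> = (\<Sum>l<p. \<Sum>j<m. \<Sum>i<n. A $$ (i, j) * (P $$ (i, l) * B $$ (l, j)))"
    by (subst sum.swap, subst (2) sum.swap, subst sum.swap, subst (2) sum.swap) (subst sum.swap, rule refl)
  also have "\<dots> = frob_inner (transpose_mat P * A) B"
    unfolding frob_inner_carrier[OF PA]
    by (intro sum.cong refl) (use P in \<open>simp add: mult_index_sum[OF Pt A] sum_distrib_left sum_distrib_right mult_ac\<close>)
  finally show ?thesis .
qed

lemma frob_norm_mult_orthonormal:
  assumes "X \<in> carrier_mat n k" "transpose_mat X * X = 1\<^sub>m k" "W \<in> carrier_mat k m"
  shows "(frob_norm (X * W))\<^sup>2 = (frob_norm W)\<^sup>2"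
proof -
  have "frob_inner (X * W) (X * W) = frob_inner (transpose_mat X * (X * W)) W"
    using assms by (intro frob_inner_mult_right) auto
  also have "transpose_mat X * (X * W) = (transpose_mat X * X) * W"
    using assms by (intro assoc_mult_mat[symmetric]) auto
  also have "\<dots> = W" using assms by simp
  finally show ?thesis by (simp add: frob_inner_self)
qed

lemma frob_norm_one: "(frob_norm (1\<^sub>m k))\<^sup>2 = real k"
proof -
  have "frob_inner (1\<^sub>m k) (1\<^sub>m k) = (\<Sum>i<k. \<Sum>j<k. if j = i then 1 else 0)"
    unfolding frob_inner_carrier[OF one_carrier_mat] by (intro sum.cong refl) auto
  also have "\<dots> = real k" by simp
  finally show ?thesis by (simp add: frob_inner_self)
qed

lemma frob_norm_orthonormal:
  assumes "X \<in> carrier_mat n k" "transpose_mat X * X = 1\<^sub>m k"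
  shows "(frob_norm X)\<^sup>2 = real k"
  using frob_norm_mult_orthonormal[OF assms one_carrier_mat] assms(1) by (simp add: frob_norm_one)

lemma frob_norm_transpose: "frob_norm (transpose_mat A) = frob_norm A"
  unfolding frob_norm_def by simp (subst sum.swap, rule refl)

lemma frob_norm_projection:
  assumes X: "X \<in> carrier_mat n k" "transpose_mat X * X = 1\<^sub>m k"
  shows "(frob_norm (X * transpose_mat X))\<^sup>2 = real k"
  using frob_norm_mult_orthonormal[OF X, of "transpose_mat X" n] frob_norm_orthonormal[OF X] X(1)
  by (simp add: frob_norm_transpose)

text \<open>The cross term equals <A^T X, Y> by adjointness and ||X Y^T|| = ||Y|| by orthonormality;
  completing the square in \<open>Y\<close> gives the identity. It is applied to the returned pair,
  and to a competitor with the last square dropped.\<close>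

lemma frob_norm_diff_factorization:
  assumes X: "X \<in> carrier_mat n k" "transpose_mat X * X = 1\<^sub>m k"
    and A: "A \<in> carrier_mat n m" and Y: "Y \<in> carrier_mat m k"
  shows "(frob_norm (A - X * transpose_mat Y))\<^sup>2 =
    (frob_norm A)\<^sup>2 - (frob_norm (transpose_mat A * X))\<^sup>2 + (frob_norm (transpose_mat A * X - Y))\<^sup>2"
proof -
  have "frob_inner A (X * transpose_mat Y) = frob_inner (transpose_mat X * A) (transpose_mat Y)"
    using assms by (intro frob_inner_mult_right) auto
  also have "transpose_mat X * A = transpose_mat (transpose_mat A * X)"
    using X A by (subst transpose_mult[of _ m n _ k]) auto
  also have "frob_inner \<dots> (transpose_mat Y) = frob_inner (transpose_mat A * X) Y"
    using assms by (intro frob_inner_transpose) auto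
  finally have 1: "frob_inner A (X * transpose_mat Y) = frob_inner (transpose_mat A * X) Y" .
  have "(frob_norm (X * transpose_mat Y))\<^sup>2 = (frob_norm Y)\<^sup>2"
    using frob_norm_mult_orthonormal[OF X, of "transpose_mat Y" m] Y by (simp add: frob_norm_transpose)
  moreover have "(frob_norm (A - X * transpose_mat Y))\<^sup>2
      = (frob_norm A)\<^sup>2 - 2 * frob_inner A (X * transpose_mat Y) + (frob_norm (X * transpose_mat Y))\<^sup>2"
    using assms by (intro frob_norm_diff) auto
  moreover have "(frob_norm (transpose_mat A * X - Y))\<^sup>2
      = (frob_norm (transpose_mat A * X))\<^sup>2 - 2 * frob_inner (transpose_mat A * X) Y + (frob_norm Y)\<^sup>2"
    using assms by (intro frob_norm_diff) auto
  ultimately show ?thesis using 1 by simp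
qed

text \<open>Makes the captured energy linear in A A^T, so that replacing A A^T by a sampled matrix
  costs an inner product with the difference.\<close>

lemma frob_norm_transpose_mult:
  assumes A: "A \<in> carrier_mat n m" and X: "X \<in> carrier_mat n k"
  shows "(frob_norm (transpose_mat A * X))\<^sup>2 = frob_inner (A * transpose_mat A) (X * transpose_mat X)"
proof -
  have At: "transpose_mat A \<in> carrier_mat m n" and AX: "transpose_mat A * X \<in> carrier_mat m k"
    using A X by auto
  have "frob_inner (A * transpose_mat A) (X * transpose_mat X)
      = frob_inner (transpose_mat X * (A * transpose_mat A)) (transpose_mat X)"
    using assms by (intro frob_inner_mult_right) auto
  also have "transpose_mat X * (A * transpose_mat A) = transpose_mat (A * (transpose_mat A * X))"
    using A X AX At by (simp add: transpose_mult[OF A AX] transpose_mult[OF At X])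
  also have "frob_inner (transpose_mat (A * (transpose_mat A * X))) (transpose_mat X) = frob_inner (A * (transpose_mat A * X)) X"
    using A X by (intro frob_inner_transpose) auto
  also have "\<dots> = frob_inner X (A * (transpose_mat A * X))"
    using A X by (intro frob_inner_commute) auto
  also have "\<dots> = frob_inner (transpose_mat A * X) (transpose_mat A * X)"
    using A X AX by (intro frob_inner_mult_right) auto
  finally show ?thesis by (simp add: frob_inner_self)
qed

text \<open>Expand 0 <= ||A - c B||^2 for \<open>c = \<mu>\<close> and \<open>c = - \<mu>\<close>
  and divide by \<open>\<mu>\<close>.\<close>

lemma frob_inner_bound:
  assumes "A \<in> carrier_mat n m" "B \<in> carrier_mat n m" "0 < \<mu>"
  shows "2 * \<bar>frob_inner A B\<bar> \<le> (frob_norm A)\<^sup>2 / \<mu> + \<mu> * (frob_norm B)\<^sup>2"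
proof -
  have "0 \<le> (frob_norm A)\<^sup>2 - 2 * c * frob_inner A B + c\<^sup>2 * (frob_norm B)\<^sup>2" for c
  proof -
    have cB: "c \<cdot>\<^sub>m B \<in> carrier_mat n m" using assms by simp
    have 1: "frob_inner A (c \<cdot>\<^sub>m B) = c * frob_inner A B"
      using frob_inner_commute[OF assms(1) cB] frob_inner_commute[OF assms(1,2)] frob_inner_smult_left[OF assms(2)] by simp
    have "(frob_norm (c \<cdot>\<^sub>m B))\<^sup>2 = c * frob_inner B (c \<cdot>\<^sub>m B)"
      unfolding frob_inner_self[symmetric] by (rule frob_inner_smult_left[OF assms(2)])
    also have "\<dots> = c\<^sup>2 * (frob_norm B)\<^sup>2"
      using frob_inner_commute[OF assms(2) cB] frob_inner_smult_left[OF assms(2)]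
      by (simp add: frob_inner_self power2_eq_square)
    finally have "(frob_norm (A - c \<cdot>\<^sub>m B))\<^sup>2 = (frob_norm A)\<^sup>2 - 2 * c * frob_inner A B + c\<^sup>2 * (frob_norm B)\<^sup>2"
      using frob_norm_diff[OF assms(1) cB] 1 by simp
    then show ?thesis by (metis zero_le_power2)
  qed
  from this[of \<mu>] this[of "- \<mu>"]
  have "2 * \<mu> * \<bar>frob_inner A B\<bar> \<le> (frob_norm A)\<^sup>2 + \<mu>\<^sup>2 * (frob_norm B)\<^sup>2" by (cases "frob_inner A B \<ge> 0") auto
  then show ?thesis using assms(3) by (simp add: field_simps power2_eq_square)
qed

section \<open>Singular vectors\<close>

lemma top_left_singular_orthonormal:
  assumes "top_left_singular k B X" "k \<le> dim_row B"
  shows "X \<in> carrier_mat (dim_row B) k" "transpose_mat X * X = 1\<^sub>m k"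
proof -
  let ?n = "dim_row B"
  obtain U \<sigma> V where svd: "is_svd B U \<sigma> V" and X: "X = Matrix.mat ?n k (\<lambda>(i, j). U $$ (i, j))"
    using assms unfolding top_left_singular_def by blast
  show Xc: "X \<in> carrier_mat ?n k" unfolding X by simp
  have U: "U \<in> carrier_mat ?n ?n" "transpose_mat U * U = 1\<^sub>m ?n" using svd unfolding is_svd_def by auto
  show "transpose_mat X * X = 1\<^sub>m k"
  proof (rule eq_matI)
    fix i j assume "i < dim_row (1\<^sub>m k :: real mat)" "j < dim_col (1\<^sub>m k :: real mat)"
    then have ij: "i < k" "j < k" by auto
    have "(transpose_mat X * X) $$ (i, j) = (\<Sum>l<?n. transpose_mat X $$ (i, l) * X $$ (l, j))"
      using Xc ij by (intro mult_index_sum) auto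
    also have "\<dots> = (\<Sum>l<?n. transpose_mat U $$ (i, l) * U $$ (l, j))"
      using U(1) Xc ij assms(2) by (intro sum.cong) (auto simp: X)
    also have "\<dots> = (transpose_mat U * U) $$ (i, j)"
      using U(1) ij assms(2) by (intro mult_index_sum[symmetric, of _ ?n ?n _ ?n]) auto
    finally show "(transpose_mat X * X) $$ (i, j) = 1\<^sub>m k $$ (i, j)" using U(2) ij assms(2) by simp
  qed (use Xc in auto)
qed

text \<open>P = G G^T is symmetric and idempotent, and its diagonal entry p at \<open>i\<close> is
  the squared norm of that row. Then p^2 is at most the squared norm of row \<open>i\<close> of P,
  which is (P P)_ii = p; hence p <= 1.\<close>

lemma row_norm_le_1:
  fixes G :: "real mat"
  assumes G: "G \<in> carrier_mat n k" "transpose_mat G * G = 1\<^sub>m k" and i: "i < n"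
  shows "(\<Sum>j<k. (G $$ (i, j))\<^sup>2) \<le> 1"
proof -
  let ?P = "G * transpose_mat G"
  have P: "?P \<in> carrier_mat n n" and Gt: "transpose_mat G \<in> carrier_mat k n" using G by auto
  have "?P * ?P = G * ((transpose_mat G * G) * transpose_mat G)"
    unfolding assoc_mult_mat[OF G(1) Gt P] assoc_mult_mat[OF Gt G(1) Gt] ..
  also have "\<dots> = ?P" using G by simp
  finally have PP: "?P * ?P = ?P" .
  have sym: "?P $$ (a, b) = ?P $$ (b, a)" if "a < n" "b < n" for a b
    unfolding mult_index_sum[OF G(1) Gt that] mult_index_sum[OF G(1) Gt that(2,1)]
    using that G(1) by (simp add: mult.commute)
  have q: "?P $$ (i, i) = (\<Sum>j<k. (G $$ (i, j))\<^sup>2)"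
    unfolding mult_index_sum[OF G(1) Gt i i] using i G(1) by (simp add: power2_eq_square)
  have "(?P $$ (i, i))\<^sup>2 \<le> (\<Sum>l<n. (?P $$ (i, l))\<^sup>2)"
    using i by (intro member_le_sum) auto
  also have "\<dots> = (?P * ?P) $$ (i, i)"
    unfolding mult_index_sum[OF P P i i] using sym i by (intro sum.cong) (auto simp: power2_eq_square)
  finally have "(?P $$ (i, i))\<^sup>2 \<le> ?P $$ (i, i)" unfolding PP .
  then have "\<not> 1 < ?P $$ (i, i)"
    using mult_strict_left_mono[of 1 "?P $$ (i, i)" "?P $$ (i, i)"] by (auto simp: power2_eq_square)
  then show ?thesis unfolding q by simp
qed

lemma weighted_sum_le_top:
  fixes \<tau> q :: "nat \<Rightarrow> real"
  assumes "antimono \<tau>" and q: "\<And>i. i < n \<Longrightarrow> 0 \<le> q i" "\<And>i. i < n \<Longrightarrow> q i \<le> 1"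
    and sum: "(\<Sum>i<n. q i) = real k" and "k \<le> n"
  shows "(\<Sum>i<n. \<tau> i * q i) \<le> (\<Sum>i<k. \<tau> i)"
proof -
  let ?d = "\<lambda>i. if i < k then 1 else 0 :: real"
  have d: "(\<Sum>i<n. f i * ?d i) = (\<Sum>i<k. f i)" for f :: "nat \<Rightarrow> real"
  proof -
    have "(\<Sum>i<n. f i * ?d i) = (\<Sum>i\<in>{..<k}. f i * ?d i)"
      using \<open>k \<le> n\<close> by (intro sum.mono_neutral_right) auto
    then show ?thesis by simp
  qed
  \<comment> \<open>The factors have opposite signs on either side of \<open>k\<close>.\<close>
  have "(\<tau> i - \<tau> k) * (q i - ?d i) \<le> 0" if "i < n" for i
  proof (cases "i < k")
    case True
    then have "\<tau> k \<le> \<tau> i" using assms(1) by (simp add: antimonoD)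
    then show ?thesis using True q(2)[OF that] by (simp add: mult_nonneg_nonpos)
  next
    case False
    then have "\<tau> i \<le> \<tau> k" using assms(1) by (simp add: antimonoD)
    then show ?thesis using False q(1)[OF that] by (simp add: mult_nonpos_nonneg)
  qed
  then have "(\<Sum>i<n. (\<tau> i - \<tau> k) * (q i - ?d i)) \<le> 0" by (intro sum_nonpos) auto
  \<comment> \<open>Both \<open>q\<close> and the indicator \<open>?d\<close> have total
    \<open>k\<close>, so the shift by \<open>\<tau> k\<close> cancels.\<close>
  also have "(\<Sum>i<n. (\<tau> i - \<tau> k) * (q i - ?d i)) = (\<Sum>i<n. \<tau> i * q i) - (\<Sum>i<n. \<tau> i * ?d i) - \<tau> k * ((\<Sum>i<n. q i) - (\<Sum>i<n. 1 * ?d i))"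
    by (simp only: left_diff_distrib right_diff_distrib sum_subtractf sum_distrib_left mult_1) 
  finally show ?thesis using sum by (simp only: d) simp
qed

text \<open>This is Ky Fan's maximum principle for \<open>B B\<^sup>T\<close>.\<close>

lemma top_left_singular_max:
  assumes X: "top_left_singular k B X" and B: "B \<in> carrier_mat n s" and "k \<le> n"
    and Z: "Z \<in> carrier_mat n k" "transpose_mat Z * Z = 1\<^sub>m k"
  shows "(frob_norm (transpose_mat B * Z))\<^sup>2 \<le> (frob_norm (transpose_mat B * X))\<^sup>2"
proof -
  obtain U \<sigma> V where svd: "is_svd B U \<sigma> V" and X_def: "X = Matrix.mat n k (\<lambda>(i, j). U $$ (i, j))"
    using X B unfolding top_left_singular_def by auto
  let ?S = "Matrix.mat n s (\<lambda>(i, j). if i = j then \<sigma> i else 0)"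
  have U: "U \<in> carrier_mat n n" "transpose_mat U * U = 1\<^sub>m n"
    and V: "V \<in> carrier_mat s s" "transpose_mat V * V = 1\<^sub>m s"
    and \<sigma>: "\<And>i. 0 \<le> \<sigma> i" "\<And>i j. i \<le> j \<Longrightarrow> \<sigma> j \<le> \<sigma> i"
    and B_eq: "B = U * ?S * transpose_mat V"
    using svd B unfolding is_svd_def by auto
  \<comment> \<open>For a square matrix a left inverse is also a right inverse.\<close>
  have UU: "U * transpose_mat U = 1\<^sub>m n"
    using mat_mult_left_right_inverse[of "transpose_mat U" n U] U by simp
  have Xc: "X \<in> carrier_mat n k" "transpose_mat X * X = 1\<^sub>m k"
    using top_left_singular_orthonormal[OF X] B \<open>k \<le> n\<close> by auto
  \<comment> \<open>The eigenvalues of B B^T in decreasing order. \<open>\<sigma>\<close> is a total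
    function whose values from \<open>s\<close> on do not enter \<open>B\<close>, so they are
    replaced by 0.\<close>
  define \<tau> where "\<tau> = (\<lambda>i. if i < s then (\<sigma> i)\<^sup>2 else 0)"
  have \<tau>: "antimono \<tau>"
    using \<sigma> by (intro antimonoI) (auto simp: \<tau>_def intro!: power_mono)
  have S: "?S \<in> carrier_mat n s" by simp
  \<comment> \<open>B^T = V S^T U^T: the isometry \<open>V\<close> drops out, and S^T scales row
    \<open>i\<close> of U^T W by \<open>\<sigma> i\<close>.\<close>
  have energy: "(frob_norm (transpose_mat B * W))\<^sup>2 = (\<Sum>i<n. \<tau> i * (\<Sum>j<k. ((transpose_mat U * W) $$ (i, j))\<^sup>2))"
    if W: "W \<in> carrier_mat n k" for W
  proof -
    let ?G = "transpose_mat U * W" and ?St = "transpose_mat ?S"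
    have G: "?G \<in> carrier_mat n k" using U W by simp
    have St: "?St \<in> carrier_mat s n" by simp
    have "transpose_mat B = V * (?St * transpose_mat U)"
      unfolding B_eq using U V S
      by (simp add: transpose_mult[of "U * ?S" n s "transpose_mat V" s] transpose_mult[OF U(1) S])
    then have "transpose_mat B * W = V * (?St * transpose_mat U * W)"
      using U V W St by (simp only:) (rule assoc_mult_mat, auto)
    also have "?St * transpose_mat U * W = ?St * ?G"
      using U W St by (intro assoc_mult_mat) auto
    finally have "transpose_mat B * W = V * (?St * ?G)" .
    then have "(frob_norm (transpose_mat B * W))\<^sup>2 = (frob_norm (?St * ?G))\<^sup>2"
      by (simp only: frob_norm_mult_orthonormal[OF V mult_carrier_mat[OF St G]])
    also have "\<dots> = (\<Sum>i<s. \<Sum>j<k. ((?St * ?G) $$ (i, j))\<^sup>2)"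
      by (rule frob_norm_carrier[OF mult_carrier_mat[OF St G]])
    also have "\<dots> = (\<Sum>i<s. \<Sum>j<k. if i < n then (\<sigma> i)\<^sup>2 * (?G $$ (i, j))\<^sup>2 else 0)"
    proof (intro sum.cong refl)
      fix i j assume ij: "i \<in> {..<s}" "j \<in> {..<k}"
      have "(?St * ?G) $$ (i, j) = (\<Sum>l<n. ?St $$ (i, l) * ?G $$ (l, j))"
        using ij by (intro mult_index_sum[OF St G]) auto
      also have "\<dots> = (\<Sum>l<n. if l = i then \<sigma> i * ?G $$ (i, j) else 0)"
        using ij by (intro sum.cong) auto
      also have "\<dots> = (if i < n then \<sigma> i * ?G $$ (i, j) else 0)" by simp
      finally show "((?St * ?G) $$ (i, j))\<^sup>2 = (if i < n then (\<sigma> i)\<^sup>2 * (?G $$ (i, j))\<^sup>2 else 0)"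
        by (simp add: power_mult_distrib)
    qed
    also have "\<dots> = (\<Sum>i<s. if i < n then (\<sigma> i)\<^sup>2 * (\<Sum>j<k. (?G $$ (i, j))\<^sup>2) else 0)"
      by (intro sum.cong) (auto simp: sum_distrib_left)
    also have "\<dots> = (\<Sum>i\<in>{..<s} \<inter> {..<n}. (\<sigma> i)\<^sup>2 * (\<Sum>j<k. (?G $$ (i, j))\<^sup>2))"
      by (subst sum.inter_restrict) auto
    also have "\<dots> = (\<Sum>i\<in>{..<n} \<inter> {..<s}. (\<sigma> i)\<^sup>2 * (\<Sum>j<k. (?G $$ (i, j))\<^sup>2))"
      by (simp add: Int_commute)
    also have "\<dots> = (\<Sum>i<n. \<tau> i * (\<Sum>j<k. (?G $$ (i, j))\<^sup>2))"
      by (subst sum.inter_restrict) (auto simp: \<tau>_def intro!: sum.cong)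
    finally show ?thesis .
  qed
  have "(frob_norm (transpose_mat B * Z))\<^sup>2 = (\<Sum>i<n. \<tau> i * (\<Sum>j<k. ((transpose_mat U * Z) $$ (i, j))\<^sup>2))"
    by (rule energy[OF Z(1)])
  \<comment> \<open>U^T Z again has orthonormal columns, so its squared row norms lie between 0 and
    1 and add up to \<open>k\<close>, as the weights must.\<close>
  also have "\<dots> \<le> (\<Sum>i<k. \<tau> i)"
  proof (rule weighted_sum_le_top[OF \<tau>])
    let ?G = "transpose_mat U * Z"
    have G: "?G \<in> carrier_mat n k" using U Z by simp
    have "transpose_mat ?G * ?G = transpose_mat Z * ((U * transpose_mat U) * Z)"
      using U Z by (simp add: transpose_mult[of "transpose_mat U" n n Z k] assoc_mult_mat[of _ k n _ n _ k] assoc_mult_mat[of U n n _ n _ k])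
    also have "\<dots> = 1\<^sub>m k" using UU Z by simp
    finally have GG: "transpose_mat ?G * ?G = 1\<^sub>m k" .
    show "(\<Sum>j<k. (?G $$ (i, j))\<^sup>2) \<le> 1" if "i < n" for i
      by (rule row_norm_le_1[OF G GG that])
    show "(\<Sum>i<n. \<Sum>j<k. (?G $$ (i, j))\<^sup>2) = real k"
      using frob_norm_orthonormal[OF G GG] by (simp only: frob_norm_carrier[OF G])
  qed (auto intro: sum_nonneg \<open>k \<le> n\<close>)
  also have "(\<Sum>i<k. \<tau> i) = (\<Sum>i<n. if i \<in> {..<k} then \<tau> i else 0)"
    using \<open>k \<le> n\<close> by (subst sum.inter_restrict[symmetric]) (auto simp: Int_absorb1)
  \<comment> \<open>The bound is attained by \<open>X\<close>: U^T X consists of the first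
    \<open>k\<close> columns of the identity.\<close>
  also have "\<dots> = (\<Sum>i<n. \<tau> i * (\<Sum>j<k. ((transpose_mat U * X) $$ (i, j))\<^sup>2))"
  proof (rule sum.cong[OF refl])
    fix i assume i: "i \<in> {..<n}"
    have "(transpose_mat U * X) $$ (i, j) = (if j = i then 1 else 0)" if j: "j < k" for j
    proof -
      have "(transpose_mat U * X) $$ (i, j) = (\<Sum>l<n. transpose_mat U $$ (i, l) * X $$ (l, j))"
        using U Xc i j by (intro mult_index_sum) auto
      also have "\<dots> = (\<Sum>l<n. transpose_mat U $$ (i, l) * U $$ (l, j))"
        using j by (intro sum.cong) (auto simp: X_def)
      also have "\<dots> = (transpose_mat U * U) $$ (i, j)"
        using U(1) i j \<open>k \<le> n\<close> by (intro mult_index_sum[symmetric, of _ n n _ n]) auto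
      finally show ?thesis using U(2) i j \<open>k \<le> n\<close> by auto
    qed
    then have "(\<Sum>j<k. ((transpose_mat U * X) $$ (i, j))\<^sup>2) = (\<Sum>j<k. if j = i then 1 else 0)"
      by (intro sum.cong) auto
    then show "(if i \<in> {..<k} then \<tau> i else 0) = \<tau> i * (\<Sum>j<k. ((transpose_mat U * X) $$ (i, j))\<^sup>2)"
      by simp
  qed
  also have "\<dots> = (frob_norm (transpose_mat B * X))\<^sup>2" by (rule energy[OF Xc(1), symmetric])
  finally show ?thesis .
qed

text \<open>A maximal independent set of columns spans all columns and has at most \<open>k\<close>
  elements. These become the columns of \<open>W\<close>, and the coordinates with respect to them
  fill \<open>T\<close>.\<close>

lemma low_rank_factorization:
  fixes M :: "real mat"
  assumes M: "M \<in> carrier_mat n m" and rank: "vec_space.rank n M \<le> k"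
  obtains W T where "W \<in> carrier_mat n k" "T \<in> carrier_mat k m" "M = W * T"
proof -
  interpret vec_space "TYPE(real)" n .
  let ?C = "set (cols M)" and ?P = "\<lambda>T. T \<subseteq> set (cols M) \<and> lin_indpt T"
  have C: "?C \<subseteq> carrier_vec n" using cols_dim M by blast
  have "lin_indpt {}" by (simp add: finite_lin_indpt2)
  then obtain S where S: "finite S" "maximal S ?P"
    using maximal_exists_superset[of ?C ?P "{}"] by auto
  have S': "S \<subseteq> ?C" "lin_indpt S" using S(2) unfolding maximal_def by auto
  have card: "card S \<le> k" using rank rank_card_indpt[OF M S(2)] by simp
  obtain ws where ws: "set ws = S" "distinct ws" using finite_distinct_list[OF S(1)] by blast
  have len: "length ws = card S" using ws distinct_card by force
  \<comment> \<open>A column outside the span could be added to \<open>S\<close>, against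
    maximality.\<close>
  have spanned: "\<exists>a. v = lincomb a S" if v: "v \<in> ?C" for v
  proof -
    have "v \<in> span S"
    proof (rule ccontr)
      assume nv: "v \<notin> span S"
      have "v \<notin> S" using nv S' C span_mem by (meson subset_trans)
      moreover have "lin_indpt (S \<union> {v})"
        using lin_dep_iff_in_span[of S v] S' C v nv \<open>v \<notin> S\<close> by auto
      ultimately show False using S(2) S'(1) v unfolding maximal_def by blast
    qed
    then show ?thesis using finite_in_span[OF S(1), of v] S' C by auto
  qed
  then obtain a where a: "\<And>v. v \<in> ?C \<Longrightarrow> v = lincomb (a v) S" by metis
  \<comment> \<open>Zero columns fill \<open>?W\<close> up to exactly \<open>k\<close> columns when
    the rank is smaller.\<close>
  let ?W = "Matrix.mat n k (\<lambda>(i, l). if l < length ws then vec_index (ws ! l) i else 0)"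
  let ?T = "Matrix.mat k m (\<lambda>(l, j). a (col M j) (ws ! l))"
  have "M = ?W * ?T"
  proof (rule eq_matI)
    fix i j assume "i < dim_row (?W * ?T)" "j < dim_col (?W * ?T)"
    then have ij: "i < n" "j < m" by auto
    have "M $$ (i, j) = vec_index (col M j) i" using ij M by simp
    also have "\<dots> = vec_index (lincomb (a (col M j)) S) i"
      using a[of "col M j"] ij M by (metis carrier_matD(2) cols_length cols_nth nth_mem)
    also have "\<dots> = (\<Sum>x\<in>S. a (col M j) x * vec_index x i)"
      using lincomb_index[OF ij(1)] S' C by blast
    also have "\<dots> = (\<Sum>l<length ws. a (col M j) (ws ! l) * vec_index (ws ! l) i)"
      unfolding ws(1)[symmetric] using ws(2)
      by (subst sum.reindex_bij_betw[OF bij_betw_nth[OF ws(2) refl refl], symmetric]) simp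
    also have "\<dots> = (\<Sum>l<k. ?W $$ (i, l) * ?T $$ (l, j))"
      using ij len card by (intro sum.mono_neutral_cong_left) auto
    also have "\<dots> = (?W * ?T) $$ (i, j)"
      using ij by (intro mult_index_sum[symmetric]) auto
    finally show "M $$ (i, j) = (?W * ?T) $$ (i, j)" .
  qed (use M in auto)
  then show ?thesis by (intro that[of ?W ?T]) auto
qed

text \<open>
  A decomposition of a matrix with only \<open>k\<close> columns orthonormalizes them, whatever its rank; no
  Gram-Schmidt process is needed.
\<close>

lemma top_left_singular_range:
  assumes X: "top_left_singular k W X" and W: "W \<in> carrier_mat n k" and "k \<le> n"
  obtains R where "R \<in> carrier_mat k k" "W = X * R"
proof -
  obtain U \<sigma> V where svd: "is_svd W U \<sigma> V" and X_def: "X = Matrix.mat n k (\<lambda>(i, j). U $$ (i, j))"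
    using X W unfolding top_left_singular_def by auto
  let ?S = "Matrix.mat n k (\<lambda>(i, j). if i = j then \<sigma> i else 0)"
  let ?S' = "Matrix.mat k k (\<lambda>(i, j). if i = j then \<sigma> i else 0)"
  have U: "U \<in> carrier_mat n n" and V: "V \<in> carrier_mat k k" and W_eq: "W = U * ?S * transpose_mat V"
    using svd W unfolding is_svd_def by auto
  have Xc: "X \<in> carrier_mat n k" unfolding X_def by simp
  \<comment> \<open>\<open>?S\<close> has only \<open>k\<close> columns, so its rows from
    \<open>k\<close> on vanish and only the first \<open>k\<close> columns of \<open>U\<close>,
    which form \<open>X\<close>, take part.\<close>
  have "U * ?S = X * ?S'"
  proof (rule eq_matI)
    fix i j assume "i < dim_row (X * ?S')" "j < dim_col (X * ?S')"
    then have ij: "i < n" "j < k" using Xc by auto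
    have "(U * ?S) $$ (i, j) = (\<Sum>l<n. U $$ (i, l) * ?S $$ (l, j))"
      using U ij by (intro mult_index_sum) auto
    also have "\<dots> = (\<Sum>l<k. X $$ (i, l) * ?S' $$ (l, j))"
      using ij \<open>k \<le> n\<close> by (intro sum.mono_neutral_cong_right) (auto simp: X_def)
    also have "\<dots> = (X * ?S') $$ (i, j)"
      using Xc ij by (intro mult_index_sum[symmetric]) auto
    finally show "(U * ?S) $$ (i, j) = (X * ?S') $$ (i, j)" .
  qed (use Xc U in auto)
  then have "W = X * (?S' * transpose_mat V)"
    unfolding W_eq using Xc V by (simp add: assoc_mult_mat[of X n k ?S' k _ k])
  then show ?thesis using V by (intro that[of "?S' * transpose_mat V"]) auto
qed

text \<open>The deterministic core: all randomness enters through the last two squares.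
  \<open>M\<close> may be any matrix of rank at most \<open>k\<close>, and
  \<open>0 \<le> \<gamma>\<close> lets the optimality of \<open>svd k B\<close> for \<open>B\<close>
  carry over to \<gamma> B B^T.\<close>

lemma low_rank_error_bound:
  assumes svd: "svd_routine svd" and A: "A \<in> carrier_mat n n" and B: "B \<in> carrier_mat n s" and k: "k \<le> n"
    and M: "M \<in> carrier_mat n n" "vec_space.rank n M \<le> k" and Y: "Y \<in> carrier_mat n k"
    and "0 \<le> \<gamma>" "0 < \<mu>"
  shows "(frob_norm (A - svd k B * transpose_mat Y))\<^sup>2 \<le> (frob_norm (A - M))\<^sup>2 + \<mu> * real k
    + (frob_norm (A * transpose_mat A - \<gamma> \<cdot>\<^sub>m (B * transpose_mat B)))\<^sup>2 / \<mu>
    + (frob_norm (transpose_mat A * svd k B - Y))\<^sup>2"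
proof -
  obtain W T where W: "W \<in> carrier_mat n k" and T: "T \<in> carrier_mat k n" and M_eq: "M = W * T"
    using low_rank_factorization[OF M] .
  let ?Z = "svd k W" and ?X = "svd k B"
  let ?D = "A * transpose_mat A - \<gamma> \<cdot>\<^sub>m (B * transpose_mat B)"
  have Z: "top_left_singular k W ?Z" and X: "top_left_singular k B ?X"
    using svd W B k unfolding svd_routine_def by auto
  obtain R where R: "R \<in> carrier_mat k k" "W = ?Z * R"
    using top_left_singular_range[OF Z W k] .
  have Zc: "?Z \<in> carrier_mat n k" "transpose_mat ?Z * ?Z = 1\<^sub>m k"
    using top_left_singular_orthonormal[OF Z] W k by auto
  have Xc: "?X \<in> carrier_mat n k" "transpose_mat ?X * ?X = 1\<^sub>m k"
    using top_left_singular_orthonormal[OF X] B k by auto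
  let ?N = "transpose_mat (R * T)"
  have N: "?N \<in> carrier_mat n k" using R T by simp
  have "M = ?Z * transpose_mat ?N"
    unfolding M_eq by (subst R(2)) (use R(1) T Zc in \<open>simp add: assoc_mult_mat[of _ n k _ k _ n]\<close>)
  then have M_dist: "(frob_norm A)\<^sup>2 - (frob_norm (transpose_mat A * ?Z))\<^sup>2 \<le> (frob_norm (A - M))\<^sup>2"
    using frob_norm_diff_factorization[OF Zc A N] by simp
  have c: "A * transpose_mat A \<in> carrier_mat n n" "\<gamma> \<cdot>\<^sub>m (B * transpose_mat B) \<in> carrier_mat n n"
    "B * transpose_mat B \<in> carrier_mat n n" "?D \<in> carrier_mat n n" using A B by auto
  \<comment> \<open>A A^T is split as \<open>?D\<close> plus \<gamma> B B^T; the second part favors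
    \<open>?X\<close> over \<open>?Z\<close>.\<close>
  have split: "(frob_norm (transpose_mat A * W'))\<^sup>2 = frob_inner ?D (W' * transpose_mat W') + \<gamma> * (frob_norm (transpose_mat B * W'))\<^sup>2"
    if "W' \<in> carrier_mat n k" for W'
    unfolding frob_inner_diff_left[OF c(1,2)] frob_inner_smult_left[OF c(3)]
      frob_norm_transpose_mult[OF A that] frob_norm_transpose_mult[OF B that] by simp
  have "\<gamma> * (frob_norm (transpose_mat B * ?Z))\<^sup>2 \<le> \<gamma> * (frob_norm (transpose_mat B * ?X))\<^sup>2"
    using top_left_singular_max[OF X B k Zc] \<open>0 \<le> \<gamma>\<close> by (rule mult_left_mono)
  \<comment> \<open>Each of the two inner products uses half of the bound, so together they cost it
    exactly once.\<close>
  moreover have "2 * \<bar>frob_inner ?D (W' * transpose_mat W')\<bar> \<le> (frob_norm ?D)\<^sup>2 / \<mu> + \<mu> * real k"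
    if "W' \<in> carrier_mat n k" "transpose_mat W' * W' = 1\<^sub>m k" for W'
    using frob_inner_bound[OF c(4) _ \<open>0 < \<mu>\<close>, of "W' * transpose_mat W'"] that frob_norm_projection[OF that] by simp
  note this[OF Zc] this[OF Xc]
  moreover note split[OF Zc(1)] split[OF Xc(1)] M_dist frob_norm_diff_factorization[OF Xc A Y]
  ultimately show ?thesis by linarith
qed

section \<open>Estimating a sum by independent samples\<close>

lemma finite_set_replicate_pmf:
  assumes "finite (set_pmf p)"
  shows "finite (set_pmf (replicate_pmf n p))"
proof -
  have "set_pmf (replicate_pmf n p) = {xs. set xs \<subseteq> set_pmf p \<and> length xs = n}"
    by (auto simp: set_replicate_pmf)
  then show ?thesis using finite_lists_length_eq[OF assms] by simp
qed

text \<open>Supports are finite throughout the sampling argument, so every real function is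
  integrable and expectations are finite sums.\<close>

lemma expectation_bind_pmf_finite:
  fixes f :: "'b \<Rightarrow> real"
  assumes "finite (set_pmf p)" "\<And>x. x \<in> set_pmf p \<Longrightarrow> finite (set_pmf (q x))"
  shows "measure_pmf.expectation (bind_pmf p q) f =
    measure_pmf.expectation p (\<lambda>x. measure_pmf.expectation (q x) f)"
  using assms by (simp add: pmf_expectation_bind[of "set_pmf p"] integral_measure_pmf[of "set_pmf p"])

lemma expectation_replicate_pmf_Suc:
  fixes f :: "'a list \<Rightarrow> real"
  assumes "finite (set_pmf p)"
  shows "measure_pmf.expectation (replicate_pmf (Suc n) p) f =
    measure_pmf.expectation p (\<lambda>x. measure_pmf.expectation (replicate_pmf n p) (\<lambda>xs. f (x # xs)))"
proof -
  have "replicate_pmf (Suc n) p = bind_pmf p (\<lambda>x. map_pmf ((#) x) (replicate_pmf n p))"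
    by (simp add: map_pmf_def)
  then show ?thesis
    using assms finite_set_replicate_pmf[OF assms] by (simp add: expectation_bind_pmf_finite)
qed

text \<open>Variances of independent centered variables add. The two claims share one induction
  because the cross term of the square vanishes by the first claim.\<close>

lemma expectation_replicate_pmf_square:
  fixes h :: "'a \<Rightarrow> real"
  assumes fin: "finite (set_pmf p)" and mean: "measure_pmf.expectation p h = 0"
  shows "measure_pmf.expectation (replicate_pmf n p) (\<lambda>xs. \<Sum>x\<leftarrow>xs. h x) = 0"
    and "measure_pmf.expectation (replicate_pmf n p) (\<lambda>xs. (\<Sum>x\<leftarrow>xs. h x)\<^sup>2)
      = real n * measure_pmf.expectation p (\<lambda>x. (h x)\<^sup>2)"
proof (induction n)
  case 0
  { case 1 show ?case by simp next case 2 show ?case by simp }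
next
  case (Suc n)
  note [simp] = integrable_measure_pmf_finite[OF fin]
    integrable_measure_pmf_finite[OF finite_set_replicate_pmf[OF fin]]
  { case 1 show ?case using Suc.IH(1) mean
      by (simp add: expectation_replicate_pmf_Suc[OF fin] del: replicate_pmf.simps) }
  { case 2 show ?case using Suc.IH mean
      by (simp add: expectation_replicate_pmf_Suc[OF fin] power2_sum algebra_simps del: replicate_pmf.simps) }
qed

text \<open>For each coordinate the variance of the mean is the variance of one sample over
  \<open>n\<close>, hence at most the second moment over \<open>n\<close>. With \<open>I\<close> the
  set of matrix positions, the sum is a squared Frobenius error.\<close>

lemma sample_mean_error:
  fixes g :: "'c \<Rightarrow> 'a \<Rightarrow> real"
  assumes fin: "finite (set_pmf p)" and "finite I" and "0 < n"
  shows "measure_pmf.expectation (replicate_pmf n p)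
      (\<lambda>xs. \<Sum>c\<in>I. (measure_pmf.expectation p (g c) - (\<Sum>x\<leftarrow>xs. g c x) / real n)\<^sup>2)
    \<le> measure_pmf.expectation p (\<lambda>x. \<Sum>c\<in>I. (g c x)\<^sup>2) / real n"
proof -
  note [simp] = integrable_measure_pmf_finite[OF fin]
    integrable_measure_pmf_finite[OF finite_set_replicate_pmf[OF fin]]
  define m where "m = (\<lambda>c. measure_pmf.expectation p (g c))"
  define h where "h = (\<lambda>c x. g c x - m c)"
  have h0: "measure_pmf.expectation p (h c) = 0" for c
    by (simp add: h_def m_def)
  have h2: "measure_pmf.expectation p (\<lambda>x. (h c x)\<^sup>2) \<le> measure_pmf.expectation p (\<lambda>x. (g c x)\<^sup>2)" for c
  proof -
    have "measure_pmf.expectation p (\<lambda>x. (h c x)\<^sup>2) = measure_pmf.expectation p (\<lambda>x. (g c x)\<^sup>2) - (m c)\<^sup>2"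
      by (simp add: h_def power2_diff m_def[symmetric]) (simp add: power2_eq_square m_def)
    then show ?thesis by simp
  qed
  have "measure_pmf.expectation (replicate_pmf n p) (\<lambda>xs. \<Sum>c\<in>I. (m c - (\<Sum>x\<leftarrow>xs. g c x) / real n)\<^sup>2)
      = measure_pmf.expectation (replicate_pmf n p) (\<lambda>xs. \<Sum>c\<in>I. (\<Sum>x\<leftarrow>xs. h c x)\<^sup>2 / (real n)\<^sup>2)"
  proof (intro integral_cong_AE)
    show "AE xs in replicate_pmf n p. (\<Sum>c\<in>I. (m c - (\<Sum>x\<leftarrow>xs. g c x) / real n)\<^sup>2)
        = (\<Sum>c\<in>I. (\<Sum>x\<leftarrow>xs. h c x)\<^sup>2 / (real n)\<^sup>2)"
    proof (intro AE_pmfI sum.cong refl)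
      fix xs c assume "xs \<in> set_pmf (replicate_pmf n p)"
      then have "length xs = n" by (simp add: set_replicate_pmf)
      then have "(\<Sum>x\<leftarrow>xs. h c x) = (\<Sum>x\<leftarrow>xs. g c x) - real n * m c"
        unfolding h_def by (simp add: sum_list_subtractf sum_list_triv)
      then have "m c - (\<Sum>x\<leftarrow>xs. g c x) / real n = - ((\<Sum>x\<leftarrow>xs. h c x) / real n)"
        using \<open>0 < n\<close> by (simp add: diff_divide_distrib)
      then show "(m c - (\<Sum>x\<leftarrow>xs. g c x) / real n)\<^sup>2 = (\<Sum>x\<leftarrow>xs. h c x)\<^sup>2 / (real n)\<^sup>2"
        by (simp add: power_divide)
    qed
  qed auto
  also have "\<dots> = (\<Sum>c\<in>I. measure_pmf.expectation (replicate_pmf n p) (\<lambda>xs. (\<Sum>x\<leftarrow>xs. h c x)\<^sup>2) / (real n)\<^sup>2)"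
    by simp
  also have "\<dots> = (\<Sum>c\<in>I. measure_pmf.expectation p (\<lambda>x. (h c x)\<^sup>2) / real n)"
    unfolding expectation_replicate_pmf_square(2)[OF fin h0] using \<open>0 < n\<close> by (simp add: power2_eq_square)
  also have "\<dots> \<le> (\<Sum>c\<in>I. measure_pmf.expectation p (\<lambda>x. (g c x)\<^sup>2) / real n)"
    using h2 \<open>0 < n\<close> by (intro sum_mono divide_right_mono) auto
  also have "\<dots> = measure_pmf.expectation p (\<lambda>x. \<Sum>c\<in>I. (g c x)\<^sup>2) / real n"
    by (simp add: sum_divide_distrib)
  finally show ?thesis unfolding m_def .
qed

text \<open>The bound \<open>e\<close> holds for every first outcome, so the mean of the total error
  is at most \<open>d + e\<close>, a third of the threshold \<open>a\<close>, although the law of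
  the second stage varies with the first.\<close>

lemma markov_two_stage:
  fixes D :: "'a \<Rightarrow> real" and N :: "'a \<Rightarrow> 'b \<Rightarrow> real"
  assumes fin: "finite (set_pmf p)" "\<And>x. x \<in> set_pmf p \<Longrightarrow> finite (set_pmf (q x))"
    and nonneg: "\<And>x. 0 \<le> D x" "\<And>x y. 0 \<le> N x y"
    and D: "measure_pmf.expectation p D \<le> d"
    and N: "\<And>x. x \<in> set_pmf p \<Longrightarrow> measure_pmf.expectation (q x) (N x) \<le> e"
    and a: "0 < a" "3 * (d + e) \<le> a"
    and good: "\<And>x y. x \<in> set_pmf p \<Longrightarrow> y \<in> set_pmf (q x) \<Longrightarrow> D x + N x y \<le> a \<Longrightarrow> f x y \<in> G"
  shows "2 / 3 \<le> measure_pmf.prob (bind_pmf p (\<lambda>x. map_pmf (f x) (q x))) G"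
proof -
  \<comment> \<open>The pair of samples is kept, since the errors \<open>D\<close> and
    \<open>N\<close> need not be functions of the result \<open>f x y\<close>.\<close>
  let ?R = "bind_pmf p (\<lambda>x. map_pmf (Pair x) (q x))"
  let ?Z = "\<lambda>(x, y). D x + N x y"
  have setR: "set_pmf ?R = (SIGMA x:set_pmf p. set_pmf (q x))" by auto
  have finR: "finite (set_pmf ?R)" unfolding setR using fin by auto
  have eq: "bind_pmf p (\<lambda>x. map_pmf (f x) (q x)) = map_pmf (\<lambda>(x, y). f x y) ?R"
    by (simp add: map_bind_pmf pmf.map_comp o_def)
  have "measure_pmf.expectation ?R ?Z = measure_pmf.expectation p (\<lambda>x. measure_pmf.expectation (q x) (\<lambda>y. D x + N x y))"
    using fin by (simp add: expectation_bind_pmf_finite)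
  also have "\<dots> \<le> measure_pmf.expectation p (\<lambda>x. D x + e)"
  proof (intro integral_mono_AE AE_pmfI)
    fix x assume x: "x \<in> set_pmf p"
    note [simp] = integrable_measure_pmf_finite[OF fin(2)[OF x]]
    show "measure_pmf.expectation (q x) (\<lambda>y. D x + N x y) \<le> D x + e" using N[OF x] by simp
  qed (auto intro: integrable_measure_pmf_finite fin)
  also have "\<dots> \<le> d + e" using D by (simp add: integrable_measure_pmf_finite[OF fin(1)])
  finally have EZ: "measure_pmf.expectation ?R ?Z \<le> d + e" .
  have "measure_pmf.prob ?R {z. a \<le> ?Z z} \<le> measure_pmf.expectation ?R ?Z / a"
    using integral_Markov_inequality_measure[OF integrable_measure_pmf_finite[OF finR, of ?Z], of "{}" a] nonneg a(1)
    by (simp add: case_prod_unfold)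
  also have "\<dots> \<le> 1 / 3" using EZ a by (simp add: field_simps)
  finally have bad: "measure_pmf.prob ?R {z. a \<le> ?Z z} \<le> 1 / 3" .
  have "2 / 3 \<le> measure_pmf.prob ?R (UNIV - {z. a \<le> ?Z z})"
    using bad measure_pmf.prob_compl[of "{z. a \<le> ?Z z}" ?R] by simp
  also have "\<dots> \<le> measure_pmf.prob ?R ((\<lambda>(x, y). f x y) -` G)"
  proof -
    have "measure_pmf.prob ?R (UNIV - {z. a \<le> ?Z z}) = measure_pmf.prob ?R ((UNIV - {z. a \<le> ?Z z}) \<inter> set_pmf ?R)"
      by (rule measure_Int_set_pmf[symmetric])
    also have "\<dots> \<le> measure_pmf.prob ?R ((\<lambda>(x, y). f x y) -` G)"
      by (intro measure_pmf.finite_measure_mono) (auto, metis good linear)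
    finally show ?thesis .
  qed
  also have "\<dots> = measure_pmf.prob (bind_pmf p (\<lambda>x. map_pmf (f x) (q x))) G"
    unfolding eq by simp
  finally show ?thesis .
qed

lemma pmf_weights:
  assumes "\<And>i. i < n \<Longrightarrow> 0 \<le> w i" "(\<Sum>i<n. w i) = 1"
  shows "pmf (weights_pmf n w) i = (if i < n then w i else 0)"
  unfolding weights_pmf_def
proof (rule pmf_embed_pmf)
  show "0 \<le> (if i < n then w i else 0)" for i using assms(1) by simp
  have "(\<integral>\<^sup>+ i. ennreal (if i < n then w i else 0) \<partial>count_space UNIV) = (\<Sum>i<n. ennreal (w i))"
    by (subst nn_integral_count_space'[of "{..<n}"]) (auto split: if_splits)
  also have "\<dots> = 1" using assms by (subst sum_ennreal) auto
  finally show "(\<integral>\<^sup>+ i. ennreal (if i < n then w i else 0) \<partial>count_space UNIV) = 1" .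
qed

lemma set_weights_pmf:
  assumes "\<And>i. i < n \<Longrightarrow> 0 \<le> w i" "(\<Sum>i<n. w i) = 1"
  shows "set_pmf (weights_pmf n w) = {i. i < n \<and> w i \<noteq> 0}"
  using pmf_weights[OF assms] by (auto simp: set_pmf_eq split: if_splits)

lemma expectation_weights_pmf:
  fixes f :: "nat \<Rightarrow> real"
  assumes "\<And>i. i < n \<Longrightarrow> 0 \<le> w i" "(\<Sum>i<n. w i) = 1"
  shows "measure_pmf.expectation (weights_pmf n w) f = (\<Sum>i<n. w i * f i)"
proof -
  have "measure_pmf.expectation (weights_pmf n w) f = (\<Sum>i<n. pmf (weights_pmf n w) i *\<^sub>R f i)"
    by (rule integral_measure_pmf) (auto simp: set_weights_pmf[OF assms])
  then show ?thesis by (simp add: pmf_weights[OF assms])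
qed

section \<open>Length-squared sampling\<close>

lemma vec_nrm_col: "A \<in> carrier_mat n m \<Longrightarrow> j < m \<Longrightarrow> (vec_nrm (col A j))\<^sup>2 = (\<Sum>i<n. (A $$ (i, j))\<^sup>2)"
  unfolding vec_nrm_def by (simp add: sum_nonneg)

lemma vec_nrm_row: "A \<in> carrier_mat n m \<Longrightarrow> i < n \<Longrightarrow> (vec_nrm (Matrix.row A i))\<^sup>2 = (\<Sum>j<m. (A $$ (i, j))\<^sup>2)"
  unfolding vec_nrm_def by (simp add: sum_nonneg)

definition length_squared_pmf :: "real mat \<Rightarrow> nat pmf" where
  "length_squared_pmf A = weights_pmf (dim_col A) (\<lambda>i. (vec_nrm (col A i))\<^sup>2 / (frob_norm A)\<^sup>2)"

lemma sum_col_norms: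
  assumes "A \<in> carrier_mat n m"
  shows "(\<Sum>j<m. (vec_nrm (col A j))\<^sup>2) = (frob_norm A)\<^sup>2"
proof -
  have "(\<Sum>j<m. (vec_nrm (col A j))\<^sup>2) = (\<Sum>j<m. \<Sum>i<n. (A $$ (i, j))\<^sup>2)"
    using vec_nrm_col[OF assms] by (intro sum.cong) auto
  also have "\<dots> = (frob_norm A)\<^sup>2" unfolding frob_norm_carrier[OF assms] by (rule sum.swap)
  finally show ?thesis .
qed

lemma length_squared_weights:
  assumes "frob_norm A \<noteq> 0"
  shows "0 \<le> (vec_nrm (col A i))\<^sup>2 / (frob_norm A)\<^sup>2"
    and "(\<Sum>i<dim_col A. (vec_nrm (col A i))\<^sup>2 / (frob_norm A)\<^sup>2) = 1"
  using assms sum_col_norms[of A "dim_row A" "dim_col A"] by (simp_all add: sum_divide_distrib[symmetric])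

definition normalized_cols :: "nat \<Rightarrow> real mat \<Rightarrow> nat list \<Rightarrow> real mat" where
  "normalized_cols n A Is = mat_of_cols n (map (\<lambda>v. smult_vec (1 / vec_nrm v) v) (map (col A) Is))"

text \<open>Let u be the normalized sampled column. The length-squared probabilities make the mean
  of ||A||^2 u u^T equal to A A^T, and this matrix has squared norm ||A||^4 for every nonzero
  column. The scaled product in the statement is the mean of \<open>s\<close> such samples.\<close>

lemma column_sampling_error:
  assumes A: "A \<in> carrier_mat n m" and nz: "frob_norm A \<noteq> 0" and "0 < s"
  shows "measure_pmf.expectation (replicate_pmf s (length_squared_pmf A))
      (\<lambda>Is. (frob_norm (A * transpose_mat A - ((frob_norm A)\<^sup>2 / real s) \<cdot>\<^sub>m
        (normalized_cols n A Is * transpose_mat (normalized_cols n A Is))))\<^sup>2)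
    \<le> (frob_norm A)^4 / real s"
proof -
  let ?F = "(frob_norm A)\<^sup>2" and ?p = "length_squared_pmf A"
  define u where "u = (\<lambda>x a. A $$ (a, x) / vec_nrm (col A x))"
  define g where "g = (\<lambda>(a, b) x. ?F * (u x a * u x b))"
  let ?I = "{..<n} \<times> {..<n}"
  have dim: "dim_col A = m" "dim_row A = n" using A by auto
  have w: "\<And>i. i < m \<Longrightarrow> 0 \<le> (vec_nrm (col A i))\<^sup>2 / ?F" "(\<Sum>i<m. (vec_nrm (col A i))\<^sup>2 / ?F) = 1"
    using length_squared_weights[OF nz] dim by auto
  have p: "?p = weights_pmf m (\<lambda>i. (vec_nrm (col A i))\<^sup>2 / ?F)"
    unfolding length_squared_pmf_def dim ..
  have set_p: "set_pmf ?p \<subseteq> {..<m}" using set_weights_pmf[OF w] unfolding p by auto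
  have fin: "finite (set_pmf ?p)" using set_p finite_subset by blast
  \<comment> \<open>For a zero column the division yields \<open>u = 0\<close>, and its term in A
    A^T is zero as well.\<close>
  have zero: "A $$ (a, x) = 0" if "vec_nrm (col A x) = 0" "a < n" "x < m" for a x
  proof -
    have "(\<Sum>i<n. (A $$ (i, x))\<^sup>2) = 0" using vec_nrm_col[OF A that(3)] that(1) by simp
    then show ?thesis using that(2) by (subst (asm) sum_nonneg_eq_0_iff) auto
  qed
  have mean: "measure_pmf.expectation ?p (g (a, b)) = (A * transpose_mat A) $$ (a, b)" if "a < n" "b < n" for a b
  proof -
    have "measure_pmf.expectation ?p (g (a, b)) = (\<Sum>x<m. (vec_nrm (col A x))\<^sup>2 / ?F * g (a, b) x)"
      unfolding p by (rule expectation_weights_pmf[OF w])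
    also have "\<dots> = (\<Sum>x<m. A $$ (a, x) * A $$ (b, x))"
    proof (intro sum.cong refl)
      fix x assume "x \<in> {..<m}"
      then show "(vec_nrm (col A x))\<^sup>2 / ?F * g (a, b) x = A $$ (a, x) * A $$ (b, x)"
        using zero[of x a] that nz
        by (cases "vec_nrm (col A x) = 0") (auto simp: g_def u_def power2_eq_square)
    qed
    also have "\<dots> = (A * transpose_mat A) $$ (a, b)"
      using A that by (subst mult_index_sum[of _ n m _ n]) auto
    finally show ?thesis .
  qed
  have second: "(\<Sum>c\<in>?I. (g c x)\<^sup>2) \<le> ?F\<^sup>2" if "x < m" for x
  proof -
    have "(\<Sum>c\<in>?I. (g c x)\<^sup>2) = (\<Sum>a<n. \<Sum>b<n. ?F\<^sup>2 * ((u x a)\<^sup>2 * (u x b)\<^sup>2))"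
      unfolding sum.cartesian_product by (intro sum.cong) (auto simp: g_def power_mult_distrib)
    also have "\<dots> = ?F\<^sup>2 * ((\<Sum>a<n. (u x a)\<^sup>2) * (\<Sum>b<n. (u x b)\<^sup>2))"
      unfolding sum_product by (simp only: sum_distrib_left)
    also have "(\<Sum>a<n. (u x a)\<^sup>2) = (vec_nrm (col A x))\<^sup>2 / (vec_nrm (col A x))\<^sup>2"
      unfolding u_def by (simp add: power_divide sum_divide_distrib[symmetric] vec_nrm_col[OF A that, symmetric])
    \<comment> \<open>Each quotient is 1, or 0 for a zero column.\<close>
    also have "?F\<^sup>2 * (\<dots> * \<dots>) \<le> ?F\<^sup>2" by (cases "vec_nrm (col A x) = 0") auto
    finally show ?thesis .
  qed
  let ?B = "normalized_cols n A"
  have err: "(frob_norm (A * transpose_mat A - (?F / real s) \<cdot>\<^sub>m (?B Is * transpose_mat (?B Is))))\<^sup>2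
      = (\<Sum>c\<in>?I. (measure_pmf.expectation ?p (g c) - (\<Sum>x\<leftarrow>Is. g c x) / real s)\<^sup>2)"
    if Is: "Is \<in> set_pmf (replicate_pmf s ?p)" for Is
  proof -
    have len: "length Is = s" and sub: "set Is \<subseteq> {..<m}" using Is set_p by (auto simp: set_replicate_pmf)
    have B: "?B Is \<in> carrier_mat n s" using mat_of_cols_carrier(1)[of n "map (\<lambda>v. 1 / vec_nrm v \<cdot>\<^sub>v v) (map (col A) Is)"] len
      by (simp add: normalized_cols_def)
    have BB: "?B Is * transpose_mat (?B Is) \<in> carrier_mat n n" using B by simp
    have AA: "A * transpose_mat A \<in> carrier_mat n n" using A by simp
    let ?D = "A * transpose_mat A - (?F / real s) \<cdot>\<^sub>m (?B Is * transpose_mat (?B Is))"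
    have D: "?D \<in> carrier_mat n n" using BB by (simp add: minus_carrier_mat)
    have entry: "?B Is $$ (a, r) = u (Is ! r) a" if "a < n" "r < s" for a r
    proof -
      have "Is ! r < m" using subsetD[OF sub nth_mem[of r Is]] len that by auto
      then show ?thesis unfolding normalized_cols_def u_def using that len A
        by (simp add: mat_of_cols_index)
    qed
    have "?D $$ (a, b) = measure_pmf.expectation ?p (g (a, b)) - (\<Sum>x\<leftarrow>Is. g (a, b) x) / real s"
      if ab: "a < n" "b < n" for a b
    proof -
      have "(?B Is * transpose_mat (?B Is)) $$ (a, b) = (\<Sum>r<s. u (Is ! r) a * u (Is ! r) b)"
        using B ab by (subst mult_index_sum[of _ n s _ n]) (auto simp: entry)
      also have "?F * \<dots> = (\<Sum>x\<leftarrow>Is. g (a, b) x)"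
        by (simp add: sum_list_sum_nth atLeast0LessThan len g_def sum_distrib_left)
      finally show ?thesis using ab B AA mean[OF ab] by (simp del: index_mult_mat(1))
    qed
    then show ?thesis unfolding frob_norm_carrier[OF D] sum.cartesian_product
      by (intro sum.cong) auto
  qed
  have "measure_pmf.expectation (replicate_pmf s ?p)
      (\<lambda>Is. (frob_norm (A * transpose_mat A - (?F / real s) \<cdot>\<^sub>m (?B Is * transpose_mat (?B Is))))\<^sup>2)
    = measure_pmf.expectation (replicate_pmf s ?p)
      (\<lambda>Is. \<Sum>c\<in>?I. (measure_pmf.expectation ?p (g c) - (\<Sum>x\<leftarrow>Is. g c x) / real s)\<^sup>2)"
    by (intro integral_cong_AE AE_pmfI err) auto
  also have "\<dots> \<le> measure_pmf.expectation ?p (\<lambda>x. \<Sum>c\<in>?I. (g c x)\<^sup>2) / real s"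
    using \<open>0 < s\<close> by (intro sample_mean_error[OF fin]) auto
  also have "\<dots> \<le> measure_pmf.expectation ?p (\<lambda>x. ?F\<^sup>2) / real s"
    using set_p second
    by (intro divide_right_mono integral_mono_AE AE_pmfI integrable_measure_pmf_finite[OF fin]) auto
  also have "\<dots> = (frob_norm A)^4 / real s" by simp
  finally show ?thesis .
qed

text \<open>The matrix \<open>Y\<close> of the algorithm in the same shape, with
  \<open>length Js\<close> for \<open>t\<close> so that it depends on \<open>Js\<close> alone; the
  two agree on samples of length \<open>t\<close>.\<close>

definition row_estimate :: "nat \<Rightarrow> nat \<Rightarrow> real mat \<Rightarrow> real mat \<Rightarrow> nat list \<Rightarrow> real mat" where
  "row_estimate n k A X Js = Matrix.mat n k (\<lambda>(i, j). 1 / real (length Js) *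
    (\<Sum>r<length Js. vec_index (map (Matrix.row A) Js ! r) i * X $$ (Js ! r, j)
      / ((vec_nrm (Matrix.row X (Js ! r)))\<^sup>2 / real k)))"

lemma leverage_weights:
  assumes X: "X \<in> carrier_mat n k" "transpose_mat X * X = 1\<^sub>m k" and "0 < k"
  shows "0 \<le> (vec_nrm (Matrix.row X i))\<^sup>2 / real k"
    and "(\<Sum>i<n. (vec_nrm (Matrix.row X i))\<^sup>2 / real k) = 1"
proof -
  have "(\<Sum>i<n. (vec_nrm (Matrix.row X i))\<^sup>2) = (frob_norm X)\<^sup>2"
    unfolding frob_norm_carrier[OF X(1)] using vec_nrm_row[OF X(1)] by (intro sum.cong) auto
  then show "(\<Sum>i<n. (vec_nrm (Matrix.row X i))\<^sup>2 / real k) = 1"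
    using \<open>0 < k\<close> frob_norm_orthonormal[OF X] by (simp add: sum_divide_distrib[symmetric])
qed simp

text \<open>A row \<open>x\<close> drawn with probability w contributes w ||A_x||^2 ||X_x||^2 / w^2
  to the second moment. Since ||X_x||^2 = k w, the weights cancel to k ||A_x||^2, which sums to k
  ||A||^2.\<close>

lemma row_sampling_error:
  assumes A: "A \<in> carrier_mat n m" and X: "X \<in> carrier_mat n k" "transpose_mat X * X = 1\<^sub>m k"
    and "0 < k" "0 < t"
  shows "measure_pmf.expectation (replicate_pmf t (weights_pmf n (\<lambda>i. (vec_nrm (Matrix.row X i))\<^sup>2 / real k)))
      (\<lambda>Js. (frob_norm (transpose_mat A * X - row_estimate m k A X Js))\<^sup>2)
    \<le> real k * (frob_norm A)\<^sup>2 / real t"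
proof -
  define w where "w = (\<lambda>i. (vec_nrm (Matrix.row X i))\<^sup>2 / real k)"
  let ?p = "weights_pmf n w" and ?I = "{..<m} \<times> {..<k}"
  define g where "g = (\<lambda>(i, j) x. A $$ (x, i) * X $$ (x, j) / w x)"
  have w: "\<And>i. i < n \<Longrightarrow> 0 \<le> w i" "(\<Sum>i<n. w i) = 1"
    using leverage_weights[OF X \<open>0 < k\<close>] unfolding w_def by auto
  have w_row: "real k * w x = (\<Sum>j<k. (X $$ (x, j))\<^sup>2)" if "x < n" for x
    unfolding w_def using vec_nrm_row[OF X(1) that] \<open>0 < k\<close> by simp
  have set_p: "set_pmf ?p \<subseteq> {..<n}" using set_weights_pmf[OF w] by auto
  have fin: "finite (set_pmf ?p)" using set_p finite_subset by blast
  \<comment> \<open>Rows of probability 0 are never drawn, but they are zero rows of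
    \<open>X\<close> and contribute nothing to A^T X.\<close>
  have zero: "X $$ (x, j) = 0" if "w x = 0" "x < n" "j < k" for x j
  proof -
    have "(\<Sum>j<k. (X $$ (x, j))\<^sup>2) = 0" using w_row[OF that(2)] that(1) by simp
    then show ?thesis using that(3) by (subst (asm) sum_nonneg_eq_0_iff) auto
  qed
  have AX: "transpose_mat A * X \<in> carrier_mat m k" using A X by simp
  have mean: "measure_pmf.expectation ?p (g (i, j)) = (transpose_mat A * X) $$ (i, j)" if "i < m" "j < k" for i j
  proof -
    have "measure_pmf.expectation ?p (g (i, j)) = (\<Sum>x<n. w x * g (i, j) x)"
      by (rule expectation_weights_pmf[OF w])
    also have "\<dots> = (\<Sum>x<n. A $$ (x, i) * X $$ (x, j))"
    proof (intro sum.cong refl)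
      fix x assume "x \<in> {..<n}"
      then show "w x * g (i, j) x = A $$ (x, i) * X $$ (x, j)"
        using zero[of x j] that by (cases "w x = 0") (auto simp: g_def)
    qed
    also have "\<dots> = (transpose_mat A * X) $$ (i, j)"
      using A X that by (subst mult_index_sum[of _ m n _ k]) auto
    finally show ?thesis .
  qed
  have second: "measure_pmf.expectation ?p (\<lambda>x. \<Sum>c\<in>?I. (g c x)\<^sup>2) \<le> real k * (frob_norm A)\<^sup>2"
  proof -
    have "measure_pmf.expectation ?p (\<lambda>x. \<Sum>c\<in>?I. (g c x)\<^sup>2) = (\<Sum>x<n. w x * (\<Sum>c\<in>?I. (g c x)\<^sup>2))"
      by (rule expectation_weights_pmf[OF w])
    also have "\<dots> \<le> (\<Sum>x<n. real k * (\<Sum>i<m. (A $$ (x, i))\<^sup>2))"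
    proof (intro sum_mono)
      fix x assume x: "x \<in> {..<n}"
      have "(\<Sum>c\<in>?I. (g c x)\<^sup>2) = (\<Sum>i<m. \<Sum>j<k. (A $$ (x, i))\<^sup>2 * (X $$ (x, j))\<^sup>2 / (w x)\<^sup>2)"
        unfolding sum.cartesian_product by (intro sum.cong) (auto simp: g_def power_mult_distrib power_divide)
      also have "\<dots> = (\<Sum>i<m. (A $$ (x, i))\<^sup>2) * (\<Sum>j<k. (X $$ (x, j))\<^sup>2) / (w x)\<^sup>2"
        by (simp add: sum_product sum_divide_distrib)
      also have "\<dots> = (\<Sum>i<m. (A $$ (x, i))\<^sup>2) * (real k * w x) / (w x)\<^sup>2"
        using w_row x by simp
      finally have "w x * (\<Sum>c\<in>?I. (g c x)\<^sup>2) = (if w x = 0 then 0 else real k * (\<Sum>i<m. (A $$ (x, i))\<^sup>2))"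
        by (simp add: power2_eq_square)
      then show "w x * (\<Sum>c\<in>?I. (g c x)\<^sup>2) \<le> real k * (\<Sum>i<m. (A $$ (x, i))\<^sup>2)"
        by (simp add: sum_nonneg)
    qed
    also have "\<dots> = real k * (frob_norm A)\<^sup>2"
      unfolding frob_norm_carrier[OF A] by (simp add: sum_distrib_left)
    finally show ?thesis .
  qed
  have err: "(frob_norm (transpose_mat A * X - row_estimate m k A X Js))\<^sup>2
      = (\<Sum>c\<in>?I. (measure_pmf.expectation ?p (g c) - (\<Sum>x\<leftarrow>Js. g c x) / real t)\<^sup>2)"
    if Js: "Js \<in> set_pmf (replicate_pmf t ?p)" for Js
  proof -
    have len: "length Js = t" and sub: "set Js \<subseteq> {..<n}" using Js set_p by (auto simp: set_replicate_pmf)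
    let ?D = "transpose_mat A * X - row_estimate m k A X Js"
    have Y: "row_estimate m k A X Js \<in> carrier_mat m k" unfolding row_estimate_def by simp
    have D: "?D \<in> carrier_mat m k" using Y by (simp add: minus_carrier_mat)
    have "?D $$ (i, j) = measure_pmf.expectation ?p (g (i, j)) - (\<Sum>x\<leftarrow>Js. g (i, j) x) / real t"
      if ij: "i < m" "j < k" for i j
    proof -
      have "row_estimate m k A X Js $$ (i, j)
          = 1 / real t * (\<Sum>r<t. vec_index (map (Matrix.row A) Js ! r) i * X $$ (Js ! r, j) / w (Js ! r))"
        unfolding row_estimate_def w_def len using ij by simp
      also have "(\<Sum>r<t. vec_index (map (Matrix.row A) Js ! r) i * X $$ (Js ! r, j) / w (Js ! r)) = (\<Sum>r<t. g (i, j) (Js ! r))"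
      proof (intro sum.cong refl)
        fix r assume "r \<in> {..<t}"
        moreover from this have "Js ! r < n" using subsetD[OF sub nth_mem[of r Js]] len by auto
        ultimately show "vec_index (map (Matrix.row A) Js ! r) i * X $$ (Js ! r, j) / w (Js ! r) = g (i, j) (Js ! r)"
          using ij A len by (simp add: g_def)
      qed
      also have "\<dots> = (\<Sum>x\<leftarrow>Js. g (i, j) x)" by (simp add: sum_list_sum_nth atLeast0LessThan len)
      finally show ?thesis using ij Y AX mean[OF ij] by (simp del: index_mult_mat(1))
    qed
    then show ?thesis unfolding frob_norm_carrier[OF D] sum.cartesian_product
      by (intro sum.cong) auto
  qed
  have "measure_pmf.expectation (replicate_pmf t ?p) (\<lambda>Js. (frob_norm (transpose_mat A * X - row_estimate m k A X Js))\<^sup>2)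
    = measure_pmf.expectation (replicate_pmf t ?p)
      (\<lambda>Js. \<Sum>c\<in>?I. (measure_pmf.expectation ?p (g c) - (\<Sum>x\<leftarrow>Js. g c x) / real t)\<^sup>2)"
    by (intro integral_cong_AE AE_pmfI err) auto
  also have "\<dots> \<le> measure_pmf.expectation ?p (\<lambda>x. \<Sum>c\<in>?I. (g c x)\<^sup>2) / real t"
    using \<open>0 < t\<close> by (intro sample_mean_error[OF fin]) auto
  also have "\<dots> \<le> real k * (frob_norm A)\<^sup>2 / real t"
    using second by (intro divide_right_mono) auto
  finally show ?thesis unfolding w_def .
qed

section \<open>Outcome and expected cost of a program\<close>

text \<open>Deterministic costs are pulled out of a program as an outer map and merged there, so
  that only the random choices remain inside.\<close>

definition charge :: "nat \<Rightarrow> nat \<Rightarrow> 'a run \<Rightarrow> 'a run" where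
  "charge q c r = Run (outcome r) (q + queries r) (c + ops r)"

lemma charge_simps [simp]:
  "outcome (charge q c r) = outcome r" "queries (charge q c r) = q + queries r" "ops (charge q c r) = c + ops r"
  unfolding charge_def by simp_all

lemma map_spmf_charge [simp]:
  fixes R :: "'a prog"
  shows "map_spmf (charge q c) (map_spmf (charge q' c') R) = map_spmf (charge (q + q') (c + c')) R"
proof -
  have "charge q c \<circ> charge q' c' = (charge (q + q') (c + c') :: 'a run \<Rightarrow> 'a run)"
    by (simp add: fun_eq_iff charge_def add.assoc)
  then show ?thesis by (simp only: spmf.map_comp)
qed

lemma bind_prog_map_return [simp]:
  "bind_prog (return_spmf (Run x q c)) f = map_spmf (charge q c) (f x)"
  unfolding bind_prog_def charge_def by simp

lemma bind_prog_tick [simp]: "bind_prog (tick c) f = map_spmf (charge 0 c) (f ())"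
  unfolding tick_def by simp

lemma bind_prog_query [simp]: "bind_prog (query A i j) f = map_spmf (charge 1 0) (f (A $$ (i, j)))"
  unfolding query_def by simp

lemma bind_prog_draw: "bind_prog (draw c p) f = bind_pmf p (\<lambda>x. map_spmf (charge 0 c) (f x))"
  unfolding draw_def bind_prog_def charge_def by (simp add: bind_map_pmf)

lemma map_spmf_outcome_bind:
  "map_spmf outcome (bind_prog m f) = bind_spmf (map_spmf outcome m) (\<lambda>x. map_spmf outcome (f x))"
  unfolding bind_prog_def by (simp add: map_spmf_bind_spmf bind_map_spmf o_def spmf.map_comp)

lemma map_spmf_outcome_charge [simp]: "map_spmf outcome (map_spmf (charge q c) R) = map_spmf outcome R"
  by (simp add: spmf.map_comp o_def)

lemma map_spmf_outcome_ret [simp]: "map_spmf outcome (ret x) = return_spmf x"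
  unfolding ret_def by simp

lemma map_spmf_outcome_draw [simp]: "map_spmf outcome (draw c p) = spmf_of_pmf p"
  unfolding draw_def by (simp add: pmf.map_comp o_def)

lemma map_spmf_outcome_for_each:
  assumes "\<And>x. x \<in> set xs \<Longrightarrow> map_spmf outcome (f x) = spmf_of_pmf p"
  shows "map_spmf outcome (for_each f xs) = spmf_of_pmf (replicate_pmf (length xs) p)"
  using assms
  by (induction xs) (simp_all add: map_spmf_outcome_bind spmf_of_pmf_bind)

lemma for_each_return:
  "(\<And>x. x \<in> set xs \<Longrightarrow> f x = return_spmf (Run (g x) q c)) \<Longrightarrow>
    for_each f xs = return_spmf (Run (map g xs) (q * length xs) (c * length xs))"
  by (induction xs) (simp_all add: ret_def charge_def)

section \<open>Expected cost of sequential programs\<close>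

lemma nn_integral_measure_spmf_option:
  "(\<integral>\<^sup>+ x. f x \<partial>measure_spmf p) = (\<integral>\<^sup>+ z. (case z of None \<Rightarrow> 0 | Some x \<Rightarrow> f x) \<partial>measure_pmf p)"
proof -
  have "(\<integral>\<^sup>+ x. f x \<partial>measure_spmf p) = (\<integral>\<^sup>+ z. f (the z) * indicator (range Some) z \<partial>measure_pmf p)"
    by (simp add: nn_integral_measure_spmf_conv_measure_pmf nn_integral_restrict_space)
  also have "\<dots> = (\<integral>\<^sup>+ z. (case z of None \<Rightarrow> 0 | Some x \<Rightarrow> f x) \<partial>measure_pmf p)"
    by (intro nn_integral_cong) (auto split: option.split)
  finally show ?thesis .
qed

lemma nn_integral_bind_spmf:
  "(\<integral>\<^sup>+ y. f y \<partial>measure_spmf (bind_spmf p g)) = (\<integral>\<^sup>+ x. \<integral>\<^sup>+ y. f y \<partial>measure_spmf (g x) \<partial>measure_spmf p)"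
  unfolding nn_integral_measure_spmf_option bind_spmf_def
  by (simp, intro nn_integral_cong) (auto split: option.split)

text \<open>The weights \<open>(1, 0)\<close> give the expected queries and \<open>(0, 1)\<close> the expected operations.\<close>

definition cost :: "nat \<Rightarrow> nat \<Rightarrow> 'a prog \<Rightarrow> ennreal" where
  "cost a b R = (\<integral>\<^sup>+ r. ennreal (real (a * queries r + b * ops r)) \<partial>measure_spmf R)"

text \<open>Only an inequality, since a subprobability may have total mass below 1.\<close>

lemma nn_integral_spmf_add_const_le:
  "(\<integral>\<^sup>+ r. c + f r \<partial>measure_spmf R) \<le> c + (\<integral>\<^sup>+ r. f r \<partial>measure_spmf R)"
proof -
  have "(\<integral>\<^sup>+ r. c + f r \<partial>measure_spmf R) = c * emeasure (measure_spmf R) (space (measure_spmf R)) + (\<integral>\<^sup>+ r. f r \<partial>measure_spmf R)"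
    by (simp add: nn_integral_add)
  also have "c * emeasure (measure_spmf R) (space (measure_spmf R)) \<le> c * 1"
    using measure_spmf.subprob_emeasure_le_1[of R] by (intro mult_left_mono) auto
  finally show ?thesis by (simp add: add_right_mono)
qed

lemma cost_ret [simp]: "cost a b (ret x) = 0"
  unfolding cost_def ret_def by (simp add: nn_integral_measure_spmf_option)

lemma cost_charge_le: "cost a b (map_spmf (charge q c) R) \<le> ennreal (real (a * q + b * c)) + cost a b R"
proof -
  have "cost a b (map_spmf (charge q c) R)
      = (\<integral>\<^sup>+ r. ennreal (real (a * q + b * c)) + ennreal (real (a * queries r + b * ops r)) \<partial>measure_spmf R)"
    unfolding cost_def by (simp add: o_def ennreal_plus[symmetric] algebra_simps del: ennreal_plus)
  then show ?thesis unfolding cost_def using nn_integral_spmf_add_const_le by simp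
qed

text \<open>The bound on the continuation is asked only for outcomes that can occur. The sizes of
  the sampled lists, on which later costs depend, are known only there.\<close>

lemma cost_bind_le:
  assumes "cost a b m \<le> P" "\<And>x. x \<in> outcome ` set_spmf m \<Longrightarrow> cost a b (f x) \<le> Q"
  shows "cost a b (bind_prog m f) \<le> P + Q"
proof -
  let ?w = "\<lambda>r. ennreal (real (a * queries r + b * ops r))"
  have "cost a b (bind_prog m f) = (\<integral>\<^sup>+ r. cost a b (map_spmf (charge (queries r) (ops r)) (f (outcome r))) \<partial>measure_spmf m)"
    unfolding cost_def bind_prog_def nn_integral_bind_spmf charge_def ..
  also have "\<dots> \<le> (\<integral>\<^sup>+ r. Q + ?w r \<partial>measure_spmf m)"
  proof (intro nn_integral_mono_AE)
    show "AE r in measure_spmf m. cost a b (map_spmf (charge (queries r) (ops r)) (f (outcome r))) \<le> Q + ?w r"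
    proof (subst AE_measure_spmf_iff, intro ballI)
      fix r assume "r \<in> set_spmf m"
      then have "cost a b (f (outcome r)) \<le> Q" by (intro assms(2)) auto
      then have "?w r + cost a b (f (outcome r)) \<le> ?w r + Q" by (rule add_left_mono)
      with cost_charge_le have "cost a b (map_spmf (charge (queries r) (ops r)) (f (outcome r))) \<le> ?w r + Q"
        by (rule order_trans)
      then show "cost a b (map_spmf (charge (queries r) (ops r)) (f (outcome r))) \<le> Q + ?w r"
        by (simp only: add.commute)
    qed
  qed
  also have "\<dots> \<le> Q + cost a b m" unfolding cost_def by (rule nn_integral_spmf_add_const_le)
  also have "\<dots> \<le> P + Q" using assms(1) by (simp add: add.commute add_left_mono)
  finally show ?thesis .
qed

lemma cost_draw: "cost a b (draw c p) = ennreal (real (b * c))"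
  unfolding cost_def draw_def by (simp add: o_def)

lemma cost_for_each_le:
  assumes "\<And>x. cost a b (f x) \<le> P"
  shows "cost a b (for_each f xs) \<le> of_nat (length xs) * P"
proof (induction xs)
  case (Cons x xs)
  have "cost a b (bind_prog (for_each f xs) (\<lambda>ys. ret (y # ys))) \<le> of_nat (length xs) * P + 0" for y
    by (rule cost_bind_le[OF Cons.IH]) simp
  then have "cost a b (for_each f (x # xs)) \<le> P + of_nat (length xs) * P"
    by (simp, intro cost_bind_le assms) simp
  then show ?case by (simp add: distrib_right)
qed simp

section \<open>Rejection sampling\<close>

text \<open>With \<rho> the rejection probability, the fixpoint equation gives y =
  \<open>pmf T (Some x)\<close> + \<rho> y for the probability y of returning \<open>x\<close>, and
  \<rho> < 1 makes the solution unique.\<close>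

lemma retry_outcome:
  assumes L: "L = bind_pmf T (\<lambda>z. map_spmf (charge q c) (case z of None \<Rightarrow> L | Some x \<Rightarrow> ret x))"
    and "pmf T None < 1"
  shows "spmf (map_spmf outcome L) x = pmf T (Some x) / (1 - pmf T None)"
proof -
  let ?\<mu> = "map_spmf outcome L"
  have "?\<mu> = bind_pmf T (\<lambda>z. map_spmf outcome (case z of None \<Rightarrow> L | Some x \<Rightarrow> ret x))"
    by (subst L) (simp add: map_bind_pmf)
  then have "spmf ?\<mu> x = measure_pmf.expectation T (\<lambda>z. spmf (map_spmf outcome (case z of None \<Rightarrow> L | Some x \<Rightarrow> ret x)) x)"
    by (metis pmf_bind)
  also have "\<dots> = measure_pmf.expectation T (\<lambda>z. indicator {Some x} z + spmf ?\<mu> x * indicator {None} z)"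
    by (intro Bochner_Integration.integral_cong) (auto split: option.split split_indicator)
  also have "\<dots> = pmf T (Some x) + spmf ?\<mu> x * pmf T None"
    by (subst Bochner_Integration.integral_add)
      (auto simp: measure_pmf_single intro!: measure_pmf.integrable_const_bound[where B = 1] integrable_mult_right)
  finally show ?thesis using assms(2) by (simp add: field_simps)
qed

lemma retry_cost:
  assumes L: "L = bind_pmf T (\<lambda>z. map_spmf (charge q c) (case z of None \<Rightarrow> L | Some x \<Rightarrow> ret x))"
    and "pmf T None < 1"
  shows "cost a b L \<le> ennreal (real (a * q + b * c) / (1 - pmf T None))"
proof -
  let ?w = "\<lambda>r :: 'a run. real (a * queries r + b * ops r)" and ?k = "real (a * q + b * c)" and ?\<rho> = "pmf T None"
  \<comment> \<open>The recurrence \<open>e \<le> k + \<rho> e\<close> says nothing if \<open>e = \<infinity>\<close>, hence the truncation at \<open>N\<close>.\<close>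
  define e where "e = (\<lambda>N :: nat. \<integral>\<^sup>+ r. ennreal (min (?w r) (real N)) \<partial>measure_spmf L)"
  have bound: "e N \<le> ennreal (?k / (1 - ?\<rho>))" for N
  proof -
    have "e N \<le> (\<integral>\<^sup>+ r. ennreal (real N) + 0 \<partial>measure_spmf L)"
      unfolding e_def by (intro nn_integral_mono) (auto intro: ennreal_leI)
    also have "\<dots> \<le> ennreal (real N) + (\<integral>\<^sup>+ r. 0 \<partial>measure_spmf L)"
      by (rule nn_integral_spmf_add_const_le)
    finally have fin: "e N \<le> ennreal (real N)" by simp
    have step: "(\<integral>\<^sup>+ r. ennreal (min (?w r) (real N)) \<partial>measure_spmf (map_spmf (charge q c) (case z of None \<Rightarrow> L | Some x \<Rightarrow> ret x)))
        \<le> ennreal ?k + e N * indicator {None} z" for z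
    proof (cases z)
      case None
      have "(\<integral>\<^sup>+ r. ennreal (min (?w (charge q c r)) (real N)) \<partial>measure_spmf L)
          \<le> (\<integral>\<^sup>+ r. ennreal ?k + ennreal (min (?w r) (real N)) \<partial>measure_spmf L)"
      proof (intro nn_integral_mono)
        fix r
        have "?w (charge q c r) = ?k + ?w r" by (simp add: algebra_simps)
        moreover have "min (k + w) x \<le> k + min w x" if "0 \<le> k" for k w x :: real using that by linarith
        ultimately have "min (?w (charge q c r)) (real N) \<le> ?k + min (?w r) (real N)" by (metis of_nat_0_le_iff)
        then have "ennreal (min (?w (charge q c r)) (real N)) \<le> ennreal (?k + min (?w r) (real N))" by (rule ennreal_leI)
        then show "ennreal (min (?w (charge q c r)) (real N)) \<le> ennreal ?k + ennreal (min (?w r) (real N))"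
          by (subst ennreal_plus[symmetric]) auto
      qed
      also have "\<dots> \<le> ennreal ?k + e N" unfolding e_def by (rule nn_integral_spmf_add_const_le)
      finally show ?thesis using None by (simp add: o_def)
    next
      case (Some x)
      then have "(\<integral>\<^sup>+ r. ennreal (min (?w r) (real N)) \<partial>measure_spmf (map_spmf (charge q c) (case z of None \<Rightarrow> L | Some x \<Rightarrow> ret x)))
          = ennreal (min ?k (real N))"
        by (simp add: ret_def nn_integral_measure_spmf_option charge_def)
      also have "\<dots> \<le> ennreal ?k" by (intro ennreal_leI) simp
      finally show ?thesis using Some by simp
    qed
    have "e N = (\<integral>\<^sup>+ z. \<integral>\<^sup>+ r. ennreal (min (?w r) (real N)) \<partial>measure_spmf (map_spmf (charge q c) (case z of None \<Rightarrow> L | Some x \<Rightarrow> ret x)) \<partial>measure_pmf T)"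
      unfolding e_def by (subst L) (simp add: nn_integral_measure_spmf_option)
    also have "\<dots> \<le> (\<integral>\<^sup>+ z. ennreal ?k + e N * indicator {None} z \<partial>measure_pmf T)"
      by (intro nn_integral_mono step)
    also have "\<dots> = ennreal ?k + e N * ennreal ?\<rho>"
      by (simp add: nn_integral_add nn_integral_cmult emeasure_pmf_single)
    finally have le: "e N \<le> ennreal ?k + e N * ennreal ?\<rho>" .
    obtain y where y: "e N = ennreal y" "0 \<le> y"
      using fin by (metis ennreal_cases ennreal_less_top leD)
    have "ennreal ?k + ennreal y * ennreal ?\<rho> = ennreal (?k + y * ?\<rho>)"
      using y(2) by (subst ennreal_plus) (auto simp: ennreal_mult')
    with le y(1) have "ennreal y \<le> ennreal (?k + y * ?\<rho>)" by (simp only:)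
    moreover have "0 \<le> ?k + y * ?\<rho>" using y(2) by (intro add_nonneg_nonneg mult_nonneg_nonneg) auto
    ultimately have "y \<le> ?k + y * ?\<rho>" by (metis ennreal_le_iff)
    then have "y \<le> ?k / (1 - ?\<rho>)" using assms(2) by (simp add: field_simps)
    then show ?thesis using y by (simp add: ennreal_leI)
  qed
  \<comment> \<open>The truncated costs increase to the full cost, so the bound, which does not
    depend on \<open>N\<close>, passes to the limit.\<close>
  have "cost a b L = (\<integral>\<^sup>+ r. (SUP N. ennreal (min (?w r) (real N))) \<partial>measure_spmf L)"
    unfolding cost_def
  proof (intro nn_integral_cong)
    fix r :: "'a run"
    show "ennreal (?w r) = (SUP N. ennreal (min (?w r) (real N)))"
    proof (rule antisym)
      obtain N where "?w r \<le> real N" using real_arch_simple by blast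
      then have "ennreal (?w r) = ennreal (min (?w r) (real N))" by (simp only: min_absorb1)
      also have "\<dots> \<le> (SUP N. ennreal (min (?w r) (real N)))" by (rule SUP_upper) simp
      finally show "ennreal (?w r) \<le> (SUP N. ennreal (min (?w r) (real N)))" .
      show "(SUP N. ennreal (min (?w r) (real N))) \<le> ennreal (?w r)"
        by (intro SUP_least ennreal_leI min.cobounded1)
    qed
  qed
  also have "\<dots> = (SUP N. e N)"
    unfolding e_def by (intro nn_integral_monotone_convergence_SUP) (auto simp: incseq_def le_fun_def intro!: ennreal_leI)
  also have "\<dots> \<le> ennreal (?k / (1 - ?\<rho>))" by (intro SUP_least bound)
  finally show ?thesis .
qed

section \<open>The sampling subroutine\<close>

lemma psd_quadratic:
  assumes A: "psd_mat n A" and ij: "i < n" "j < n"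
  shows "0 \<le> x\<^sup>2 * A $$ (i, i) + 2 * x * y * A $$ (i, j) + y\<^sup>2 * A $$ (j, j)"
proof -
  have Ac: "A \<in> carrier_mat n n" and sym: "transpose_mat A = A" using A unfolding psd_mat_def by auto
  \<comment> \<open>A sum of two conditionals, so that \<open>i = j\<close> is covered with entry
    \<open>x + y\<close>.\<close>
  define v where "v = Matrix.vec n (\<lambda>a. (if a = i then x else 0) + (if a = j then y else 0))"
  have v: "v \<in> carrier_vec n" unfolding v_def by simp
  have pick: "(\<Sum>a<n. ((if a = i then x else 0) + (if a = j then y else 0)) * f a) = x * f i + y * f j" for f :: "nat \<Rightarrow> real"
    using ij by (simp add: distrib_right sum.distrib if_distrib[of "\<lambda>z. z * _"] cong: if_cong)
  have "vec_index (mult_mat_vec A v) a = x * A $$ (a, i) + y * A $$ (a, j)" if "a < n" for a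
  proof -
    have "vec_index (mult_mat_vec A v) a = (\<Sum>b<n. A $$ (a, b) * vec_index v b)"
      using that Ac v by (simp add: scalar_prod_def lessThan_atLeast0)
    also have "\<dots> = (\<Sum>b<n. ((if b = i then x else 0) + (if b = j then y else 0)) * A $$ (a, b))"
      by (intro sum.cong) (auto simp: v_def)
    finally show ?thesis unfolding pick .
  qed
  then have "scalar_prod v (mult_mat_vec A v) = (\<Sum>a<n. vec_index v a * (x * A $$ (a, i) + y * A $$ (a, j)))"
    using Ac unfolding scalar_prod_def by (intro sum.cong) auto
  also have "\<dots> = (\<Sum>a<n. ((if a = i then x else 0) + (if a = j then y else 0)) * (x * A $$ (a, i) + y * A $$ (a, j)))"
    by (intro sum.cong) (auto simp: v_def)
  also have "\<dots> = x * (x * A $$ (i, i) + y * A $$ (i, j)) + y * (x * A $$ (j, i) + y * A $$ (j, j))"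
    by (rule pick)
  also have "A $$ (j, i) = A $$ (i, j)" using sym ij Ac by (metis index_transpose_mat(1) carrier_matD)
  also have "x * (x * A $$ (i, i) + y * A $$ (i, j)) + y * (x * A $$ (i, j) + y * A $$ (j, j))
      = x\<^sup>2 * A $$ (i, i) + 2 * x * y * A $$ (i, j) + y\<^sup>2 * A $$ (j, j)"
    by (simp add: algebra_simps power2_eq_square)
  finally show ?thesis using A v unfolding psd_mat_def by auto
qed

lemma psd_diag_nonneg: "psd_mat n A \<Longrightarrow> i < n \<Longrightarrow> 0 \<le> A $$ (i, i)"
  using psd_quadratic[of n A i i 1 0] by simp

lemma psd_minor:
  assumes A: "psd_mat n A" and ij: "i < n" "j < n"
  shows "(A $$ (i, j))\<^sup>2 \<le> A $$ (i, i) * A $$ (j, j)"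
proof (cases "A $$ (i, i) = 0")
  case True
  have "A $$ (i, j) = 0"
  proof (rule ccontr)
    \<comment> \<open>With a zero diagonal entry the form is affine in \<open>x\<close> at
      \<open>y = 1\<close>; this \<open>x\<close> makes its value -1.\<close>
    assume nz: "A $$ (i, j) \<noteq> 0"
    have "0 \<le> 2 * (- (A $$ (j, j) + 1) / (2 * A $$ (i, j))) * A $$ (i, j) + A $$ (j, j)"
      using psd_quadratic[OF assms, of "- (A $$ (j, j) + 1) / (2 * A $$ (i, j))" 1] True by simp
    then show False using nz by (simp add: field_simps)
  qed
  then show ?thesis using True by simp
next
  case False
  then have pos: "0 < A $$ (i, i)" using psd_diag_nonneg[OF A ij(1)] by simp
  \<comment> \<open>The vector with coordinates \<open>- A $$ (i, j)\<close> and
    \<open>A $$ (i, i)\<close> is, up to scaling, the minimizer of the form, and its value is the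
    diagonal entry times the minor.\<close>
  have "0 \<le> A $$ (i, i) * (A $$ (i, i) * A $$ (j, j) - (A $$ (i, j))\<^sup>2)"
    using psd_quadratic[OF assms, of "- A $$ (i, j)" "A $$ (i, i)"] by (simp add: algebra_simps power2_eq_square)
  then show ?thesis using pos by (simp add: zero_le_mult_iff)
qed

text \<open>A zero trace forces a zero diagonal, and then the 2 x 2 minors force every entry to
  vanish.\<close>

lemma psd_trace_pos:
  assumes A: "psd_mat n A" "A \<noteq> 0\<^sub>m n n"
  shows "0 < (\<Sum>i<n. A $$ (i, i))"
proof (rule ccontr)
  assume "\<not> 0 < (\<Sum>i<n. A $$ (i, i))"
  moreover have "0 \<le> (\<Sum>i<n. A $$ (i, i))" using psd_diag_nonneg[OF A(1)] by (intro sum_nonneg) auto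
  ultimately have "(\<Sum>i<n. A $$ (i, i)) = 0" by simp
  then have diag: "A $$ (i, i) = 0" if "i < n" for i
    using that psd_diag_nonneg[OF A(1)] by (subst (asm) sum_nonneg_eq_0_iff) auto
  have "A $$ (i, j) = 0" if "i < n" "j < n" for i j
    using psd_minor[OF A(1) that] diag that by simp
  moreover have "A \<in> carrier_mat n n" using A unfolding psd_mat_def by auto
  ultimately have "A = 0\<^sub>m n n" by (intro eq_matI) auto
  then show False using A(2) by simp
qed

text \<open>Cauchy-Schwarz on the diagonal. It bounds the expected number of rounds of the rejection
  loop by \<open>n\<close>.\<close>

lemma trace_square_le:
  fixes A :: "real mat"
  assumes A: "A \<in> carrier_mat n n"
  shows "(\<Sum>i<n. A $$ (i, i))\<^sup>2 \<le> real n * (frob_norm A)\<^sup>2"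
proof -
  have "(\<Sum>i<n. A $$ (i, i))\<^sup>2 \<le> (\<Sum>i<n. 1\<^sup>2) * (\<Sum>i<n. (A $$ (i, i))\<^sup>2)"
    using Cauchy_Schwarz_ineq_sum[of "\<lambda>_. 1" "\<lambda>i. A $$ (i, i)" "{..<n}"] by simp
  also have "\<dots> \<le> real n * (\<Sum>i<n. \<Sum>j<n. (A $$ (i, j))\<^sup>2)"
    by (simp, intro mult_left_mono sum_mono) (auto intro: member_le_sum)
  finally show ?thesis unfolding frob_norm_carrier[OF A] .
qed

lemma pmf_bind_weights:
  assumes "\<And>i. i < n \<Longrightarrow> 0 \<le> w i" "(\<Sum>i<n. w i) = 1"
  shows "pmf (bind_pmf (weights_pmf n w) f) x = (\<Sum>i<n. w i * pmf (f i) x)"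
  by (simp add: pmf_bind expectation_weights_pmf[OF assms])

section \<open>Law and cost of the rejection loop\<close>

definition trial_ops :: "cost_model \<Rightarrow> nat \<Rightarrow> nat" where
  "trial_ops M n = 2 * sample_ops M n + 3 + prep_ops M 2 + sample_ops M 2"

context
  fixes M :: cost_model and n :: nat and A :: "real mat"
  assumes psd: "psd_mat n A" and nonzero: "A \<noteq> 0\<^sub>m n n"
begin

abbreviation (input) "diag_list \<equiv> map (\<lambda>i. A $$ (i, i)) [0..<n]"
abbreviation (input) "diag_pmf \<equiv> weights_pmf n (\<lambda>i. diag_list ! i / sum_list diag_list)"
abbreviation (input) "tr \<equiv> \<Sum>i<n. A $$ (i, i)"

lemma psd_carrier: "A \<in> carrier_mat n n"
  using psd unfolding psd_mat_def by auto

lemma diag_weights: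
  shows "\<And>i. i < n \<Longrightarrow> 0 \<le> diag_list ! i / sum_list diag_list"
    and "(\<Sum>i<n. diag_list ! i / sum_list diag_list) = 1"
    and "sum_list diag_list = tr"
proof -
  show tr: "sum_list diag_list = tr" by (simp add: sum_list_sum_nth lessThan_atLeast0)
  show "\<And>i. i < n \<Longrightarrow> 0 \<le> diag_list ! i / sum_list diag_list"
    unfolding tr using psd_diag_nonneg[OF psd] psd_trace_pos[OF psd nonzero] by simp
  show "(\<Sum>i<n. diag_list ! i / sum_list diag_list) = 1"
    unfolding tr using psd_trace_pos[OF psd nonzero] by (simp add: sum_divide_distrib[symmetric])
qed

text \<open>One round without its costs; \<open>None\<close> means rejection. Accepted and rejected
  rounds cost the same, so the price of a round can be charged outside.\<close>

definition trial :: "nat option pmf" where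
  "trial = bind_pmf diag_pmf (\<lambda>i. bind_pmf diag_pmf (\<lambda>j. map_pmf (\<lambda>b. if b then Some i else None)
    (bernoulli_pmf ((A $$ (i, j))\<^sup>2 / (diag_list ! i * diag_list ! j)))))"

lemma sample_loop_retry:
  "sample_loop M A diag_list diag_pmf = bind_pmf trial (\<lambda>z. map_spmf (charge 1 (trial_ops M n))
    (case z of None \<Rightarrow> sample_loop M A diag_list diag_pmf | Some i \<Rightarrow> ret i))"
proof -
  have dim: "dim_row A = n" using psd_carrier by simp
  have sum: "sample_ops M n + (sample_ops M n + (3 + prep_ops M 2 + sample_ops M 2)) = trial_ops M n"
    unfolding trial_ops_def by simp
  have case_if: "(case if b then Some i else None of None \<Rightarrow> L | Some i \<Rightarrow> ret i) = (if b then ret i else L)"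
    for b and i :: nat and L by simp
  show ?thesis
    by (subst sample_loop.simps)
      (simp add: bind_prog_draw trial_def bind_assoc_pmf bind_map_pmf map_bind_pmf sum dim case_if)
qed

text \<open>The minor bound makes \<open>p\<close> a probability. The diagonal entries in its
  denominator cancel the sampling probabilities, which leaves the squared entry over the squared
  trace.\<close>

lemma acceptance:
  assumes ij: "i < n" "j < n"
  defines "p \<equiv> (A $$ (i, j))\<^sup>2 / (diag_list ! i * diag_list ! j)"
  shows "0 \<le> p" "p \<le> 1"
    and "diag_list ! i / tr * (diag_list ! j / tr * p) = (A $$ (i, j))\<^sup>2 / tr\<^sup>2"
proof -
  have d: "diag_list ! i = A $$ (i, i)" "diag_list ! j = A $$ (j, j)" using ij by auto
  have nn: "0 \<le> A $$ (i, i)" "0 \<le> A $$ (j, j)" using psd_diag_nonneg[OF psd] ij by auto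
  note minor = psd_minor[OF psd ij]
  show "0 \<le> p" unfolding p_def d using nn by simp
  show "p \<le> 1" unfolding p_def d using nn minor
    by (cases "A $$ (i, i) * A $$ (j, j) = 0") (auto simp: divide_le_eq_1)
  show "diag_list ! i / tr * (diag_list ! j / tr * p) = (A $$ (i, j))\<^sup>2 / tr\<^sup>2"
    unfolding p_def d using minor
  proof (cases "A $$ (i, i) = 0 \<or> A $$ (j, j) = 0")
    \<comment> \<open>Here the quotient is 0 by convention, and the minor bound makes the
      off-diagonal entry 0 too.\<close>
    case True
    then have "(A $$ (i, j))\<^sup>2 \<le> 0" using minor by auto
    then show "A $$ (i, i) / tr * (A $$ (j, j) / tr * ((A $$ (i, j))\<^sup>2 / (A $$ (i, i) * A $$ (j, j)))) = (A $$ (i, j))\<^sup>2 / tr\<^sup>2"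
      by simp
  qed (simp add: power2_eq_square)
qed

lemma pmf_trial_Some:
  "pmf trial (Some i) = (if i < n then (vec_nrm (col A i))\<^sup>2 / tr\<^sup>2 else 0)"
proof -
  note w = diag_weights(1,2)
  let ?D = "\<lambda>i. diag_list ! i / sum_list diag_list"
  have bind: "pmf (bind_pmf diag_pmf f) x = (\<Sum>i<n. ?D i * pmf (f i) x)" for f :: "nat \<Rightarrow> nat option pmf" and x
    by (rule pmf_bind_weights[OF w])
  have "pmf trial (Some i) = (\<Sum>i'<n. ?D i' * (\<Sum>j<n. ?D j * pmf (map_pmf (\<lambda>b. if b then Some i' else None)
    (bernoulli_pmf ((A $$ (i', j))\<^sup>2 / (diag_list ! i' * diag_list ! j)))) (Some i)))"
    unfolding trial_def bind ..
  also have "\<dots> = (\<Sum>i'<n. \<Sum>j<n. if i' = i then (A $$ (i, j))\<^sup>2 / tr\<^sup>2 else 0)"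
    unfolding sum_distrib_left
  proof (intro sum.cong refl)
    fix i' j assume ij: "i' \<in> {..<n}" "j \<in> {..<n}"
    then have p: "0 \<le> (A $$ (i', j))\<^sup>2 / (diag_list ! i' * diag_list ! j)" "(A $$ (i', j))\<^sup>2 / (diag_list ! i' * diag_list ! j) \<le> 1"
      using acceptance by auto
    have pm: "pmf (map_pmf (\<lambda>b. if b then Some i' else None) (bernoulli_pmf ((A $$ (i', j))\<^sup>2 / (diag_list ! i' * diag_list ! j)))) (Some i)
      = (if i' = i then (A $$ (i', j))\<^sup>2 / (diag_list ! i' * diag_list ! j) else 0)"
      by (simp add: map_pmf_def pmf_bind integral_bernoulli_pmf[OF p])
    have acc: "diag_list ! i' / tr * (diag_list ! j / tr * ((A $$ (i', j))\<^sup>2 / (diag_list ! i' * diag_list ! j))) = (A $$ (i', j))\<^sup>2 / tr\<^sup>2"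
      by (rule acceptance(3)) (use ij in auto)
    show "?D i' * (?D j * pmf (map_pmf (\<lambda>b. if b then Some i' else None)
        (bernoulli_pmf ((A $$ (i', j))\<^sup>2 / (diag_list ! i' * diag_list ! j)))) (Some i))
      = (if i' = i then (A $$ (i, j))\<^sup>2 / tr\<^sup>2 else 0)"
      unfolding diag_weights(3) pm using acc by (cases "i' = i") (simp_all only: simp_thms if_True if_False mult_zero_right)
  qed
  also have "\<dots> = (\<Sum>i'<n. if i' = i then (\<Sum>j<n. (A $$ (i, j))\<^sup>2) / tr\<^sup>2 else 0)"
    by (intro sum.cong) (auto simp: sum_divide_distrib)
  also have "\<dots> = (if i < n then (\<Sum>j<n. (A $$ (i, j))\<^sup>2) / tr\<^sup>2 else 0)" by simp
  also have "\<dots> = (if i < n then (vec_nrm (col A i))\<^sup>2 / tr\<^sup>2 else 0)"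
  \<comment> \<open>Summing over \<open>j\<close> yields a row norm; symmetry turns it into the
    column norm.\<close>
  proof -
    have "A $$ (i, j) = A $$ (j, i)" if "i < n" "j < n" for j
      using psd that psd_carrier unfolding psd_mat_def by (metis index_transpose_mat(1) carrier_matD)
    then show ?thesis using vec_nrm_col[OF psd_carrier, of i] by simp
  qed
  finally show ?thesis .
qed

lemma pmf_trial_None: "pmf trial None = 1 - (frob_norm A)\<^sup>2 / tr\<^sup>2"
proof -
  have "set_pmf trial \<subseteq> insert None (Some ` {..<n})"
    unfolding trial_def using set_weights_pmf[where w = "\<lambda>i. diag_list ! i / sum_list diag_list", OF diag_weights(1,2)] by (auto split: if_splits)
  then have "(\<Sum>z\<in>insert None (Some ` {..<n}). pmf trial z) = 1"
    by (intro sum_pmf_eq_1) auto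
  also have "(\<Sum>z\<in>insert None (Some ` {..<n}). pmf trial z) = pmf trial None + (\<Sum>i<n. pmf trial (Some i))"
    by (subst sum.insert) (auto simp: sum.reindex)
  also have "(\<Sum>i<n. pmf trial (Some i)) = (frob_norm A)\<^sup>2 / tr\<^sup>2"
    using sum_col_norms[OF psd_carrier] by (simp add: pmf_trial_Some sum_divide_distrib[symmetric])
  finally show ?thesis by simp
qed

lemma frob_norm_pos: "0 < (frob_norm A)\<^sup>2"
proof -
  have "0 < tr\<^sup>2" using psd_trace_pos[OF psd nonzero] by simp
  then have "0 < real n * (frob_norm A)\<^sup>2" using trace_square_le[OF psd_carrier] by linarith
  then show ?thesis by (simp add: zero_less_mult_iff)
qed

lemma trial_None_less: "pmf trial None < 1"
  unfolding pmf_trial_None using frob_norm_pos psd_trace_pos[OF psd nonzero] by simp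

lemma sample_index_charge:
  "sample_index M A = map_spmf (charge n (2 * n + prep_ops M n)) (sample_loop M A diag_list diag_pmf)"
proof -
  have dim: "dim_row A = n" using psd_carrier by simp
  have "for_each (\<lambda>i. query A i i) [0..<n] = return_spmf (Run diag_list n 0)"
    by (subst for_each_return[where g = "\<lambda>i. A $$ (i, i)" and q = 1 and c = 0]) (auto simp: query_def)
  then show ?thesis unfolding sample_index_def dim Let_def by simp
qed

lemma sample_index_outcome: "map_spmf outcome (sample_index M A) = spmf_of_pmf (length_squared_pmf A)"
proof (rule spmf_eqI)
  fix i
  have nz: "frob_norm A \<noteq> 0" using frob_norm_pos by auto
  have dim: "dim_col A = n" using psd_carrier by simp
  have "spmf (map_spmf outcome (sample_index M A)) i = pmf trial (Some i) / (1 - pmf trial None)"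
    unfolding sample_index_charge map_spmf_outcome_charge
    by (rule retry_outcome[OF sample_loop_retry trial_None_less])
  also have "\<dots> = (if i < n then (vec_nrm (col A i))\<^sup>2 / (frob_norm A)\<^sup>2 else 0)"
    unfolding pmf_trial_Some pmf_trial_None using psd_trace_pos[OF psd nonzero] by simp
  also have "\<dots> = pmf (length_squared_pmf A) i"
    unfolding length_squared_pmf_def using length_squared_weights[OF nz] dim by (subst pmf_weights) auto
  finally show "spmf (map_spmf outcome (sample_index M A)) i = spmf (spmf_of_pmf (length_squared_pmf A)) i"
    by simp
qed

text \<open>The diagonal takes \<open>n\<close> queries and the loop at most \<open>n\<close> rounds
  in expectation, with one query each; hence the factor 2.\<close>

lemma sample_index_cost:
  "cost a b (sample_index M A) \<le> ennreal (real (n * (2 * a + b * (2 + trial_ops M n)) + b * prep_ops M n))"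
proof -
  have "cost a b (sample_index M A) \<le> ennreal (real (a * n + b * (2 * n + prep_ops M n)))
      + cost a b (sample_loop M A diag_list diag_pmf)"
    unfolding sample_index_charge by (rule cost_charge_le)
  also have "cost a b (sample_loop M A diag_list diag_pmf) \<le> ennreal (real (a * 1 + b * trial_ops M n) / (1 - pmf trial None))"
    by (rule retry_cost[OF sample_loop_retry trial_None_less])
  also have "real (a * 1 + b * trial_ops M n) / (1 - pmf trial None) \<le> real (a * 1 + b * trial_ops M n) * real n"
  proof -
    have "1 / (1 - pmf trial None) \<le> real n"
      unfolding pmf_trial_None using trace_square_le[OF psd_carrier] frob_norm_pos
      by (simp add: pos_divide_le_eq)
    then have "real (a * 1 + b * trial_ops M n) * (1 / (1 - pmf trial None)) \<le> real (a * 1 + b * trial_ops M n) * real n"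
      by (intro mult_left_mono) auto
    then show ?thesis by simp
  qed
  finally have "cost a b (sample_index M A) \<le> ennreal (real (a * n + b * (2 * n + prep_ops M n)))
      + ennreal (real (a * 1 + b * trial_ops M n) * real n)"
    by (auto intro: ennreal_leI add_left_mono order_trans)
  also have "\<dots> = ennreal (real (n * (2 * a + b * (2 + trial_ops M n)) + b * prep_ops M n))"
    by (subst ennreal_plus[symmetric]) (auto simp: algebra_simps simp del: ennreal_plus)
  finally show ?thesis .
qed

end

section \<open>The low-rank approximation algorithm\<close>

lemma map_vec_upt: "map_vec f (vec_of_list [0..<m]) = Matrix.vec m f"
  by (intro eq_vecI) (auto simp: vec_of_list_index)

lemma read_col_eq: "read_col A j = return_spmf (Run (col A j) (dim_row A) 0)"
  unfolding read_col_def
  by (subst for_each_return[where g = "\<lambda>i. A $$ (i, j)" and q = 1 and c = 0])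
    (auto simp: query_def ret_def charge_def map_vec_upt col_def)

lemma read_row_eq: "read_row A i = return_spmf (Run (Matrix.row A i) (dim_col A) 0)"
  unfolding read_row_def
  by (subst for_each_return[where g = "\<lambda>j. A $$ (i, j)" and q = 1 and c = 0])
    (auto simp: query_def ret_def charge_def map_vec_upt row_def)

definition leverage_pmf :: "nat \<Rightarrow> nat \<Rightarrow> real mat \<Rightarrow> nat pmf" where
  "leverage_pmf n k X = weights_pmf n (\<lambda>i. (vec_nrm (Matrix.row X i))\<^sup>2 / real k)"

text \<open>Reading columns and rows is deterministic and dissolves into charges, leaving two random
  stages. The charges still mention \<open>length Is\<close> and \<open>length Js\<close>, whose
  values are known only on the support.\<close>

lemma low_rank_approx_eq:
  assumes A: "A \<in> carrier_mat n n"
    and s: "s = nat \<lceil>C * real k / \<epsilon>\<^sup>2\<rceil>" and t: "t = nat \<lceil>C' * real k / \<epsilon>\<rceil>"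
  shows "low_rank_approx C C' M svd A k \<epsilon> = bind_prog (for_each (\<lambda>_. sample_index M A) [0..<s])
    (\<lambda>Is. map_spmf (charge (n * length Is) (s * (3 * n) + svd_ops M n s + (n * (2 * k) + prep_ops M n)))
      (bind_prog (for_each (\<lambda>_. draw (sample_ops M n) (leverage_pmf n k (svd k (normalized_cols n A Is)))) [0..<t])
        (\<lambda>Js. map_spmf (charge (n * length Js) (t * (k + 1) + matmul_ops n t k))
          (ret (svd k (normalized_cols n A Is),
            Matrix.mat n k (\<lambda>(i, j). 1 / real t * (\<Sum>r<t. vec_index (map (Matrix.row A) Js ! r) i
              * svd k (normalized_cols n A Is) $$ (Js ! r, j)
              / ((vec_nrm (Matrix.row (svd k (normalized_cols n A Is)) (Js ! r)))\<^sup>2 / real k))))))))"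
proof -
  have dim: "dim_row A = n" "dim_col A = n" using A by auto
  have cols: "for_each (read_col A) Is = return_spmf (Run (map (col A) Is) (n * length Is) 0)" for Is
    using for_each_return[of Is "read_col A" "col A" n 0] by (simp add: read_col_eq dim)
  have rows: "for_each (read_row A) Js = return_spmf (Run (map (Matrix.row A) Js) (n * length Js) 0)" for Js
    using for_each_return[of Js "read_row A" "Matrix.row A" n 0] by (simp add: read_row_eq dim)
  show ?thesis
    unfolding low_rank_approx_def Let_def dim s[symmetric] t[symmetric] cols rows
      bind_prog_map_return bind_prog_tick map_spmf_charge normalized_cols_def[symmetric] leverage_pmf_def[symmetric]
    by (simp only: add_0 add_0_right add.assoc)
qed

lemma low_rank_approx_outcome:
  assumes psd: "psd_mat n A" and nonzero: "A \<noteq> 0\<^sub>m n n"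
    and s: "s = nat \<lceil>C * real k / \<epsilon>\<^sup>2\<rceil>" and t: "t = nat \<lceil>C' * real k / \<epsilon>\<rceil>"
  shows "map_spmf outcome (low_rank_approx C C' M svd A k \<epsilon>) = spmf_of_pmf
    (bind_pmf (replicate_pmf s (length_squared_pmf A)) (\<lambda>Is.
      map_pmf (\<lambda>Js. (svd k (normalized_cols n A Is), row_estimate n k A (svd k (normalized_cols n A Is)) Js))
        (replicate_pmf t (leverage_pmf n k (svd k (normalized_cols n A Is))))))"
proof -
  have A: "A \<in> carrier_mat n n" using psd unfolding psd_mat_def by auto
  have Is: "map_spmf outcome (for_each (\<lambda>_. sample_index M A) [0..<s]) = spmf_of_pmf (replicate_pmf s (length_squared_pmf A))"
    using map_spmf_outcome_for_each[of "[0..<s]" "\<lambda>_. sample_index M A"] sample_index_outcome[OF psd nonzero] by simp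
  have Js: "map_spmf outcome (for_each (\<lambda>_. draw c p) [0..<t]) = spmf_of_pmf (replicate_pmf t p)" for c and p :: "nat pmf"
    using map_spmf_outcome_for_each[of "[0..<t]" "\<lambda>_. draw c p"] by simp
  have "map_spmf outcome (low_rank_approx C C' M svd A k \<epsilon>) =
    bind_pmf (replicate_pmf s (length_squared_pmf A)) (\<lambda>Is.
      bind_pmf (replicate_pmf t (leverage_pmf n k (svd k (normalized_cols n A Is)))) (\<lambda>Js.
        return_spmf (svd k (normalized_cols n A Is),
            Matrix.mat n k (\<lambda>(i, j). 1 / real t * (\<Sum>r<t. vec_index (map (Matrix.row A) Js ! r) i
              * svd k (normalized_cols n A Is) $$ (Js ! r, j)
              / ((vec_nrm (Matrix.row (svd k (normalized_cols n A Is)) (Js ! r)))\<^sup>2 / real k))))))"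
    unfolding low_rank_approx_eq[OF A s t] map_spmf_outcome_bind map_spmf_outcome_charge Is Js
      bind_spmf_of_pmf map_spmf_outcome_ret ..
  also have "\<dots> = bind_pmf (replicate_pmf s (length_squared_pmf A)) (\<lambda>Is.
      bind_pmf (replicate_pmf t (leverage_pmf n k (svd k (normalized_cols n A Is)))) (\<lambda>Js.
        return_spmf (svd k (normalized_cols n A Is), row_estimate n k A (svd k (normalized_cols n A Is)) Js)))"
    \<comment> \<open>Lists in the support have length \<open>t\<close>, where the algorithm's
      matrix and \<open>row_estimate\<close> coincide.\<close>
    by (intro bind_pmf_cong refl) (auto simp: row_estimate_def set_replicate_pmf)
  also have "\<dots> = spmf_of_pmf
    (bind_pmf (replicate_pmf s (length_squared_pmf A)) (\<lambda>Is.
      map_pmf (\<lambda>Js. (svd k (normalized_cols n A Is), row_estimate n k A (svd k (normalized_cols n A Is)) Js))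
        (replicate_pmf t (leverage_pmf n k (svd k (normalized_cols n A Is))))))"
    unfolding map_pmf_def spmf_of_pmf_bind spmf_of_pmf_return_pmf ..
  finally show ?thesis .
qed

lemma low_rank_approx_cost:
  assumes psd: "psd_mat n A" and nonzero: "A \<noteq> 0\<^sub>m n n"
    and s: "s = nat \<lceil>C * real k / \<epsilon>\<^sup>2\<rceil>" and t: "t = nat \<lceil>C' * real k / \<epsilon>\<rceil>"
  shows "cost a b (low_rank_approx C C' M svd A k \<epsilon>) \<le> ennreal (real (
    s * (n * (2 * a + b * (2 + trial_ops M n)) + b * prep_ops M n) +
    (a * (n * s) + b * (s * (3 * n) + svd_ops M n s + (n * (2 * k) + prep_ops M n)) +
    (t * (b * sample_ops M n) + (a * (n * t) + b * (t * (k + 1) + matmul_ops n t k))))))"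
proof -
  have A: "A \<in> carrier_mat n n" using psd unfolding psd_mat_def by auto
  \<comment> \<open>The possible outcomes are read off the known law of the sample, a product
    distribution on lists of length \<open>s\<close>.\<close>
  have lenI: "length Is = s" if "Is \<in> outcome ` set_spmf (for_each (\<lambda>_. sample_index M A) [0..<s])" for Is
  proof -
    have "Is \<in> set_spmf (map_spmf outcome (for_each (\<lambda>_. sample_index M A) [0..<s]))" using that by (simp only: set_map_spmf)
    also have "map_spmf outcome (for_each (\<lambda>_. sample_index M A) [0..<s]) = spmf_of_pmf (replicate_pmf s (length_squared_pmf A))"
      using map_spmf_outcome_for_each[of "[0..<s]" "\<lambda>_. sample_index M A"] sample_index_outcome[OF psd nonzero] by simp
    finally show ?thesis by (simp add: set_replicate_pmf)
  qed
  have lenJ: "length Js = t" if "Js \<in> outcome ` set_spmf (for_each (\<lambda>_. draw c p) [0..<t])" for Js c and p :: "nat pmf"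
  proof -
    have "Js \<in> set_spmf (map_spmf outcome (for_each (\<lambda>_. draw c p) [0..<t]))" using that by (simp only: set_map_spmf)
    also have "map_spmf outcome (for_each (\<lambda>_. draw c p) [0..<t]) = spmf_of_pmf (replicate_pmf t p)"
      using map_spmf_outcome_for_each[of "[0..<t]" "\<lambda>_. draw c p"] by simp
    finally show ?thesis by (simp add: set_replicate_pmf)
  qed
  have "cost a b (low_rank_approx C C' M svd A k \<epsilon>) \<le>
    of_nat (length [0..<s]) * ennreal (real (n * (2 * a + b * (2 + trial_ops M n)) + b * prep_ops M n)) +
    (ennreal (real (a * (n * s) + b * (s * (3 * n) + svd_ops M n s + (n * (2 * k) + prep_ops M n)))) +
    (of_nat (length [0..<t]) * ennreal (real (b * sample_ops M n))
      + (ennreal (real (a * (n * t) + b * (t * (k + 1) + matmul_ops n t k))) + 0)))"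
    unfolding low_rank_approx_eq[OF A s t]
  proof (intro cost_bind_le cost_for_each_le sample_index_cost[OF psd nonzero])
    fix Is assume "Is \<in> outcome ` set_spmf (for_each (\<lambda>_. sample_index M A) [0..<s])"
    note lenI[OF this, simp]
    show "cost a b (map_spmf (charge (n * length Is) (s * (3 * n) + svd_ops M n s + (n * (2 * k) + prep_ops M n)))
      (bind_prog (for_each (\<lambda>_. draw (sample_ops M n) (leverage_pmf n k (svd k (normalized_cols n A Is)))) [0..<t])
        (\<lambda>Js. map_spmf (charge (n * length Js) (t * (k + 1) + matmul_ops n t k))
          (ret (svd k (normalized_cols n A Is),
            Matrix.mat n k (\<lambda>(i, j). 1 / real t * (\<Sum>r<t. vec_index (map (Matrix.row A) Js ! r) i
              * svd k (normalized_cols n A Is) $$ (Js ! r, j)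
              / ((vec_nrm (Matrix.row (svd k (normalized_cols n A Is)) (Js ! r)))\<^sup>2 / real k))))))))
      \<le> ennreal (real (a * (n * s) + b * (s * (3 * n) + svd_ops M n s + (n * (2 * k) + prep_ops M n)))) +
    (of_nat (length [0..<t]) * ennreal (real (b * sample_ops M n))
      + (ennreal (real (a * (n * t) + b * (t * (k + 1) + matmul_ops n t k))) + 0))"
      unfolding lenI[OF \<open>Is \<in> _\<close>]
    proof (rule order_trans[OF cost_charge_le add_left_mono], rule cost_bind_le)
      show "cost a b (for_each (\<lambda>_. draw (sample_ops M n) (leverage_pmf n k (svd k (normalized_cols n A Is)))) [0..<t])
        \<le> of_nat (length [0..<t]) * ennreal (real (b * sample_ops M n))"
        by (rule cost_for_each_le) (simp only: cost_draw)
    next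
      fix Js assume "Js \<in> outcome ` set_spmf (for_each (\<lambda>_. draw (sample_ops M n) (leverage_pmf n k (svd k (normalized_cols n A Is)))) [0..<t])"
      then have len: "length Js = t" by (rule lenJ)
      show "cost a b (map_spmf (charge (n * length Js) (t * (k + 1) + matmul_ops n t k))
          (ret (svd k (normalized_cols n A Is),
            Matrix.mat n k (\<lambda>(i, j). 1 / real t * (\<Sum>r<t. vec_index (map (Matrix.row A) Js ! r) i
              * svd k (normalized_cols n A Is) $$ (Js ! r, j)
              / ((vec_nrm (Matrix.row (svd k (normalized_cols n A Is)) (Js ! r)))\<^sup>2 / real k))))))
          \<le> ennreal (real (a * (n * t) + b * (t * (k + 1) + matmul_ops n t k))) + 0"
        unfolding len by (rule order_trans[OF cost_charge_le]) (simp only: cost_ret order_refl)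
    qed
  qed
  also have "\<dots> = ennreal (real (
    s * (n * (2 * a + b * (2 + trial_ops M n)) + b * prep_ops M n) +
    (a * (n * s) + b * (s * (3 * n) + svd_ops M n s + (n * (2 * k) + prep_ops M n)) +
    (t * (b * sample_ops M n) + (a * (n * t) + b * (t * (k + 1) + matmul_ops n t k))))))"
    by (simp only: ennreal_of_nat_eq_real_of_nat[symmetric] of_nat_add[symmetric] of_nat_mult[symmetric] length_upt add_0_right diff_zero)
  finally show ?thesis .
qed

lemma low_rank_approx_accuracy:
  assumes svd: "svd_routine svd" and psd: "psd_mat n A" and nonzero: "A \<noteq> 0\<^sub>m n n"
    and k: "1 \<le> k" "k \<le> n" and \<epsilon>: "0 < \<epsilon>"
    and s: "144 * real k / \<epsilon>\<^sup>2 \<le> real s" and t: "6 * real k / \<epsilon> \<le> real t"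
    and B: "B \<in> carrier_mat n n" "vec_space.rank n B \<le> k"
  shows "2 / 3 \<le> measure_pmf.prob (bind_pmf (replicate_pmf s (length_squared_pmf A)) (\<lambda>Is.
      map_pmf (\<lambda>Js. (svd k (normalized_cols n A Is), row_estimate n k A (svd k (normalized_cols n A Is)) Js))
        (replicate_pmf t (leverage_pmf n k (svd k (normalized_cols n A Is))))))
    {(X, Y). X \<in> carrier_mat n k \<and> Y \<in> carrier_mat n k \<and>
      (frob_norm (A - X * transpose_mat Y))\<^sup>2 \<le> (frob_norm (A - B))\<^sup>2 + \<epsilon> * (frob_norm A)\<^sup>2}"
proof -
  have A: "A \<in> carrier_mat n n" using psd unfolding psd_mat_def by auto
  let ?F = "(frob_norm A)\<^sup>2"
  have F: "0 < ?F" using frob_norm_pos[OF psd nonzero] .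
  have nz: "frob_norm A \<noteq> 0" using F by auto
  have s_pos: "0 < s" and t_pos: "0 < t"
  proof -
    have "0 < 144 * real k / \<epsilon>\<^sup>2" "0 < 6 * real k / \<epsilon>" using k \<epsilon> by auto
    then have "0 < real s" "0 < real t" using s t by linarith+
    then show "0 < s" "0 < t" by auto
  qed
  \<comment> \<open>This choice balances \<open>\<mu> k\<close> and \<open>E \<Delta> / \<mu>\<close>: both become \<open>\<epsilon> ?F / 12\<close>.\<close>
  define \<mu> where "\<mu> = \<epsilon> * ?F / (12 * real k)"
  have \<mu>: "0 < \<mu>" unfolding \<mu>_def using \<epsilon> F k by simp
  have \<mu>k: "\<mu> * real k = \<epsilon> * ?F / 12" unfolding \<mu>_def using k by simp
  let ?B = "normalized_cols n A"
  let ?X = "\<lambda>Is. svd k (?B Is)"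
  define \<Delta> where "\<Delta> = (\<lambda>Is. (frob_norm (A * transpose_mat A - (?F / real s) \<cdot>\<^sub>m (?B Is * transpose_mat (?B Is))))\<^sup>2)"
  have dim_B: "?B Is \<in> carrier_mat n (length Is)" for Is
    using mat_of_cols_carrier(1)[of n "map (\<lambda>v. 1 / vec_nrm v \<cdot>\<^sub>v v) (map (col A) Is)"]
    by (simp add: normalized_cols_def)
  have X: "?X Is \<in> carrier_mat n k" "transpose_mat (?X Is) * ?X Is = 1\<^sub>m k" for Is
  proof -
    have dim: "dim_row (?B Is) = n" using dim_B by blast
    then have "top_left_singular k (?B Is) (?X Is)" using svd k unfolding svd_routine_def by simp
    from top_left_singular_orthonormal[OF this] show "?X Is \<in> carrier_mat n k" "transpose_mat (?X Is) * ?X Is = 1\<^sub>m k"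
      using dim k by auto
  qed
  have fin_ls: "finite (set_pmf (length_squared_pmf A))"
  proof -
    have "set_pmf (length_squared_pmf A) \<subseteq> {..<dim_col A}"
      unfolding length_squared_pmf_def using length_squared_weights[OF nz] by (subst set_weights_pmf) auto
    then show ?thesis using finite_subset by blast
  qed
  have fin_lev: "finite (set_pmf (leverage_pmf n k (?X Is)))" for Is
  proof -
    have "set_pmf (leverage_pmf n k (?X Is)) \<subseteq> {..<n}"
      unfolding leverage_pmf_def using leverage_weights[OF X] k by (subst set_weights_pmf) auto
    then show ?thesis using finite_subset by blast
  qed
  show ?thesis
  \<comment> \<open>The deterministic term \<open>\<mu> * real k\<close> is counted in
    \<open>D\<close>, whose mean is then at most twice a twelfth of the threshold; the mean of
    \<open>N\<close> adds a sixth.\<close>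
  proof (rule markov_two_stage[where D = "\<lambda>Is. \<epsilon> * ?F / 12 + \<Delta> Is / \<mu>"
        and N = "\<lambda>Is Js. (frob_norm (transpose_mat A * ?X Is - row_estimate n k A (?X Is) Js))\<^sup>2"
        and a = "\<epsilon> * ?F" and d = "\<epsilon> * ?F / 6" and e = "\<epsilon> * ?F / 6"])
    show "finite (set_pmf (replicate_pmf s (length_squared_pmf A)))"
      by (rule finite_set_replicate_pmf[OF fin_ls])
    show "finite (set_pmf (replicate_pmf t (leverage_pmf n k (?X Is))))" for Is
      by (rule finite_set_replicate_pmf[OF fin_lev])
    show "0 \<le> \<epsilon> * ?F / 12 + \<Delta> Is / \<mu>" for Is
      unfolding \<Delta>_def using \<epsilon> \<mu> by simp
    note [simp] = integrable_measure_pmf_finite[OF finite_set_replicate_pmf[OF fin_ls]]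
    have "measure_pmf.expectation (replicate_pmf s (length_squared_pmf A)) \<Delta> \<le> ?F * ?F / real s"
      using column_sampling_error[OF A nz s_pos] unfolding \<Delta>_def by (simp add: power4_eq_xxxx power2_eq_square mult.assoc)
    \<comment> \<open>The right side is \<epsilon>^2 ||A||^4 / (144 k), which is where 144 comes
      from.\<close>
    also have "\<dots> \<le> \<mu> * (\<epsilon> * ?F / 12)"
    proof -
      have "144 * real k \<le> real s * \<epsilon>\<^sup>2" using s \<epsilon> by (simp add: field_simps)
      then have "?F * ?F * (144 * real k) \<le> ?F * ?F * (real s * \<epsilon>\<^sup>2)"
        using F by (intro mult_left_mono) auto
      then show ?thesis unfolding \<mu>_def using s_pos k by (simp add: field_simps power2_eq_square)
    qed
    finally have "measure_pmf.expectation (replicate_pmf s (length_squared_pmf A)) \<Delta> / \<mu> \<le> \<epsilon> * ?F / 12"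
      using \<mu> by (simp add: pos_divide_le_eq mult.commute)
    moreover have "measure_pmf.expectation (replicate_pmf s (length_squared_pmf A)) (\<lambda>Is. \<epsilon> * ?F / 12 + \<Delta> Is / \<mu>)
        = \<epsilon> * ?F / 12 + measure_pmf.expectation (replicate_pmf s (length_squared_pmf A)) \<Delta> / \<mu>"
      by simp
    ultimately show "measure_pmf.expectation (replicate_pmf s (length_squared_pmf A)) (\<lambda>Is. \<epsilon> * ?F / 12 + \<Delta> Is / \<mu>) \<le> \<epsilon> * ?F / 6"
      by linarith
    show "measure_pmf.expectation (replicate_pmf t (leverage_pmf n k (?X Is)))
        (\<lambda>Js. (frob_norm (transpose_mat A * ?X Is - row_estimate n k A (?X Is) Js))\<^sup>2) \<le> \<epsilon> * ?F / 6" for Is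
    proof -
      have "measure_pmf.expectation (replicate_pmf t (leverage_pmf n k (?X Is)))
        (\<lambda>Js. (frob_norm (transpose_mat A * ?X Is - row_estimate n k A (?X Is) Js))\<^sup>2) \<le> real k * ?F / real t"
        unfolding leverage_pmf_def using k t_pos by (intro row_sampling_error[OF A X]) auto
      also have "\<dots> \<le> \<epsilon> * ?F / 6"
      proof -
        have "6 * real k \<le> real t * \<epsilon>" using t \<epsilon> by (simp add: field_simps)
        then have "?F * (6 * real k) \<le> ?F * (real t * \<epsilon>)" using F by (intro mult_left_mono) auto
        then show ?thesis using t_pos by (simp add: field_simps)
      qed
      finally show ?thesis .
    qed
    fix Is Js
    assume "\<epsilon> * ?F / 12 + \<Delta> Is / \<mu> + (frob_norm (transpose_mat A * ?X Is - row_estimate n k A (?X Is) Js))\<^sup>2 \<le> \<epsilon> * ?F"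
    moreover have Y: "row_estimate n k A (?X Is) Js \<in> carrier_mat n k" unfolding row_estimate_def by simp
    moreover have "(frob_norm (A - ?X Is * transpose_mat (row_estimate n k A (?X Is) Js)))\<^sup>2
      \<le> (frob_norm (A - B))\<^sup>2 + \<mu> * real k + \<Delta> Is / \<mu> + (frob_norm (transpose_mat A * ?X Is - row_estimate n k A (?X Is) Js))\<^sup>2"
      unfolding \<Delta>_def using F by (intro low_rank_error_bound[OF svd A dim_B k(2) B Y _ \<mu>]) simp
    ultimately show "(?X Is, row_estimate n k A (?X Is) Js) \<in> {(X, Y). X \<in> carrier_mat n k \<and> Y \<in> carrier_mat n k \<and>
      (frob_norm (A - X * transpose_mat Y))\<^sup>2 \<le> (frob_norm (A - B))\<^sup>2 + \<epsilon> * (frob_norm A)\<^sup>2}"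
      unfolding \<mu>k using X(1) by simp
  qed (use \<epsilon> F in auto)
qed

section \<open>Query and operation counts\<close>

text \<open>With blocks of size \<open>k\<close> there are O(n/k) block rows and O(1/\<epsilon>)
  inner blocks, so O(n / (k \<epsilon>)) square products of size \<open>k\<close>; the second term
  is for adding up partial results.\<close>

lemma matmul_ops_rectangle:
  assumes c: "\<And>m. 1 \<le> m \<Longrightarrow> real (matmul_ops m m m) \<le> c * real m powr \<omega>"
    and k: "1 \<le> k" "k \<le> n" and \<epsilon>: "0 < \<epsilon>" "\<epsilon> < 1" and t: "real t \<le> 7 * real k / \<epsilon>"
  shows "real (matmul_ops n t k) \<le> 16 * c * real n * real k powr (\<omega> - 1) / \<epsilon> + 8 * real n * real k / \<epsilon>"
proof -
  have c0: "0 \<le> c" using order_trans[OF of_nat_0_le_iff c[of 1]] by simp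
  \<comment> \<open>Adding 1 covers a possibly incomplete last block. By \<open>k \<le> n\<close>
    and \<open>\<epsilon> < 1\<close> the counts are at most 2 n / k and 8 / \<epsilon>, whence 16
    and 8 in the bound.\<close>
  let ?a = "n div k + 1" and ?b = "t div k + 1"
  have cover: "m \<le> (m div k + 1) * k" for m
    using dividend_less_div_times[of k m] k by simp
  have div: "real (m div k) \<le> real m / real k" for m
    by (rule of_nat_div_le_of_nat)
  have a: "real ?a \<le> 2 * real n / real k"
  proof -
    have "1 \<le> real n / real k" using k by (simp add: le_divide_eq)
    then show ?thesis using div[of n] by simp
  qed
  have b: "real ?b \<le> 8 / \<epsilon>"
  proof -
    have "real t / real k \<le> 7 / \<epsilon>" using t k by (simp add: divide_le_eq mult.commute)
    moreover have "1 \<le> 1 / \<epsilon>" using \<epsilon> by simp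
    ultimately show ?thesis using div[of t] by simp
  qed
  have "matmul_ops n t k \<le> ?a * ?b * matmul_ops k k k + n * k * ?b"
    by (rule matmul_ops_blocks[OF k(1) cover cover])
  then have "real (matmul_ops n t k) \<le> real ?a * real ?b * real (matmul_ops k k k) + real n * real k * real ?b"
    by (metis (mono_tags, lifting) of_nat_add of_nat_mult of_nat_mono)
  also have "\<dots> \<le> (2 * real n / real k) * (8 / \<epsilon>) * (c * real k powr \<omega>) + real n * real k * (8 / \<epsilon>)"
    using a b c[OF k(1)] c0 \<epsilon> by (intro add_mono mult_mono) auto
  also have "\<dots> = 16 * c * real n * (real k powr \<omega> / real k) / \<epsilon> + 8 * real n * real k / \<epsilon>"
    by (simp add: field_simps)
  also have "real k powr \<omega> / real k = real k powr (\<omega> - 1)" using k by (simp add: powr_diff)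
  finally show ?thesis .
qed

lemma nat_ceiling_bounds:
  assumes "1 \<le> x"
  shows "x \<le> real (nat \<lceil>x\<rceil>)" "real (nat \<lceil>x\<rceil>) \<le> x + 1"
  using assms by linarith+

text \<open>With P = k / \<epsilon>^2 >= 1, all terms except the SVD and the square products are O(n
  P), and \<open>2 \<le> \<omega>\<close> absorbs n P into n P^(\<omega> - 1).\<close>

lemma operation_count:
  assumes \<omega>: "2 \<le> \<omega>" and c\<^sub>0: "\<And>m. 1 \<le> m \<Longrightarrow> real (matmul_ops m m m) \<le> c\<^sub>0 * real m powr \<omega>"
    and M: "charges c \<omega> M" and k: "1 \<le> k" "k \<le> n" and \<epsilon>: "0 < \<epsilon>" "\<epsilon> < 1"
    and s: "1 \<le> s" "real s \<le> 145 * (real k / \<epsilon>\<^sup>2)" and t: "real t \<le> 7 * real k / \<epsilon>"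
  shows "real (s * (n * (2 + trial_ops M n) + prep_ops M n) +
      (s * (3 * n) + svd_ops M n s + (n * (2 * k) + prep_ops M n) +
      (t * sample_ops M n + (t * (k + 1) + matmul_ops n t k))))
    \<le> (1184 + 878 * c + c * 145 powr (\<omega> - 1) + 16 * c\<^sub>0) * (real n * (real k / \<epsilon>\<^sup>2) powr (\<omega> - 1))"
proof -
  define P where "P = real k / \<epsilon>\<^sup>2"
  define Q where "Q = real n * P powr (\<omega> - 1)"
  have n: "1 \<le> n" using k by simp
  have \<epsilon>2: "\<epsilon>\<^sup>2 \<le> \<epsilon>" "0 < \<epsilon>\<^sup>2" using \<epsilon> by (auto simp: power2_eq_square mult_left_le)
  have kP: "real k \<le> P" unfolding P_def using \<epsilon> \<epsilon>2 by (simp add: le_divide_eq mult_left_le)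
  then have P1: "1 \<le> P" using k by simp
  have k\<epsilon>: "real k / \<epsilon> \<le> P" unfolding P_def by (intro divide_left_mono mult_pos_pos \<epsilon>(1) \<epsilon>2) simp
  have PQ: "real n * P \<le> Q"
  proof -
    have "P powr 1 \<le> P powr (\<omega> - 1)" using P1 \<omega> by (intro powr_mono) auto
    then show ?thesis unfolding Q_def using P1 by (intro mult_left_mono) auto
  qed
  have nQ: "real n \<le> Q"
  proof -
    have "real n * 1 \<le> real n * P" using P1 by (intro mult_left_mono) auto
    then show ?thesis using PQ by simp
  qed
  have P_le: "P \<le> Q"
  proof -
    have "1 * P \<le> real n * P" using P1 n by (intro mult_right_mono) auto
    then show ?thesis using PQ by simp
  qed
  have ch: "real (prep_ops M m) \<le> c * real m" "real (sample_ops M m) \<le> c" if "1 \<le> m" for m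
    using M that unfolding charges_def by auto
  have c: "0 \<le> c" using order_trans[OF of_nat_0_le_iff ch(2)[of 1]] by simp
  have c\<^sub>0': "0 \<le> c\<^sub>0" using order_trans[OF of_nat_0_le_iff c\<^sub>0[of 1]] by simp
  have svd: "real (svd_ops M n s) \<le> c * 145 powr (\<omega> - 1) * Q"
  proof -
    have "real (svd_ops M n s) \<le> c * real n * real s powr (\<omega> - 1)"
      using M n s unfolding charges_def by auto
    also have "\<dots> \<le> c * real n * (145 * P) powr (\<omega> - 1)"
      using s c \<omega> unfolding P_def by (intro mult_left_mono powr_mono2) auto
    also have "\<dots> = c * 145 powr (\<omega> - 1) * Q"
      unfolding Q_def using P1 by (simp add: powr_mult)
    finally show ?thesis .
  qed
  have trial: "real (trial_ops M n) \<le> 5 * c + 3"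
    unfolding trial_ops_def using ch[OF n] ch[of 2] by simp
  have sn: "real s * real n \<le> 145 * Q"
  proof -
    have "real s * real n \<le> 145 * P * real n" using s unfolding P_def by (intro mult_right_mono) auto
    then show ?thesis using PQ by (simp add: mult.commute mult.left_commute)
  qed
  have one: "real (s * (n * (2 + trial_ops M n) + prep_ops M n)) \<le> (725 + 870 * c) * Q"
  proof -
    have "real (s * (n * (2 + trial_ops M n) + prep_ops M n)) = real s * (real n * (2 + real (trial_ops M n)) + real (prep_ops M n))"
      by (simp add: distrib_left)
    also have "\<dots> \<le> real s * (real n * (5 + 5 * c) + c * real n)"
    proof -
      have "2 + real (trial_ops M n) \<le> 5 + 5 * c" using trial by simp
      then show ?thesis by (intro mult_left_mono add_mono[OF mult_left_mono ch(1)[OF n]]) auto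
    qed
    also have "\<dots> = (real s * real n) * (5 + 6 * c)" by (simp add: algebra_simps)
    also have "\<dots> \<le> (145 * Q) * (5 + 6 * c)" using sn c by (intro mult_right_mono) auto
    finally show ?thesis by (simp add: algebra_simps)
  qed
  have two: "real (s * (3 * n)) \<le> 435 * Q" using sn by (simp add: mult.commute)
  have three: "real (n * (2 * k)) \<le> 2 * Q"
  proof -
    have "real n * real k \<le> real n * P" using kP by (intro mult_left_mono) auto
    then show ?thesis using PQ by simp
  qed
  have prep: "real (prep_ops M n) \<le> c * Q"
    using ch(1)[OF n] mult_left_mono[OF nQ c] by simp
  have tP: "real t \<le> 7 * P" using t k\<epsilon> by simp
  have draws: "real (t * sample_ops M n) \<le> 7 * c * Q"
  proof -
    have "real t * real (sample_ops M n) \<le> (7 * P) * c" using tP ch(2)[OF n] P1 by (intro mult_mono) auto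
    also have "\<dots> \<le> (7 * Q) * c" using P_le c by (intro mult_right_mono) auto
    finally show ?thesis by (simp add: mult_ac)
  qed
  have factor: "real (t * (k + 1)) \<le> 14 * Q"
  proof -
    have "real t * real (k + 1) \<le> (7 * P) * (2 * real n)" using tP k P1 by (intro mult_mono) auto
    also have "\<dots> = 14 * (real n * P)" by simp
    finally show ?thesis using PQ unfolding of_nat_mult by linarith
  qed
  have mm: "real (matmul_ops n t k) \<le> (16 * c\<^sub>0 + 8) * Q"
  proof -
    \<comment> \<open>Since \<open>1 \<le> \<omega> - 1\<close> and \<epsilon> < 1, the single
      factor 1/\<epsilon> is at most the power of 1/\<epsilon>^2 that turns k into P.\<close>
    have "real k powr (\<omega> - 1) / \<epsilon> \<le> P powr (\<omega> - 1)"
    proof -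
      have "1 / \<epsilon> \<le> 1 / \<epsilon>\<^sup>2" by (intro divide_left_mono mult_pos_pos \<epsilon>(1) \<epsilon>2) simp
      also have "\<dots> = (1 / \<epsilon>\<^sup>2) powr 1" using \<epsilon> by simp
      also have "\<dots> \<le> (1 / \<epsilon>\<^sup>2) powr (\<omega> - 1)" using \<omega> \<epsilon> \<epsilon>2 by (intro powr_mono) (auto simp: le_divide_eq)
      finally have "real k powr (\<omega> - 1) * (1 / \<epsilon>) \<le> real k powr (\<omega> - 1) * (1 / \<epsilon>\<^sup>2) powr (\<omega> - 1)"
        by (intro mult_left_mono) auto
      also have "\<dots> = (real k * (1 / \<epsilon>\<^sup>2)) powr (\<omega> - 1)" using \<epsilon> by (subst powr_mult) auto
      finally show ?thesis unfolding P_def by simp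
    qed
    then have "16 * c\<^sub>0 * real n * (real k powr (\<omega> - 1) / \<epsilon>) \<le> 16 * c\<^sub>0 * real n * P powr (\<omega> - 1)"
      using c\<^sub>0' by (intro mult_left_mono) auto
    moreover have "8 * real n * (real k / \<epsilon>) \<le> 8 * real n * P" using k\<epsilon> by (intro mult_left_mono) auto
    moreover have "real (matmul_ops n t k) \<le> 16 * c\<^sub>0 * real n * real k powr (\<omega> - 1) / \<epsilon> + 8 * real n * real k / \<epsilon>"
      by (rule matmul_ops_rectangle[OF c\<^sub>0 k \<epsilon> t])
    moreover have "16 * c\<^sub>0 * real n * P powr (\<omega> - 1) = 16 * c\<^sub>0 * Q" unfolding Q_def by simp
    ultimately have "real (matmul_ops n t k) \<le> 16 * c\<^sub>0 * Q + 8 * (real n * P)" by simp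
    then show ?thesis using PQ by (simp add: distrib_right)
  qed
  \<comment> \<open>The coefficients add up as 1184 = 725 + 435 + 2 + 14 + 8 and 878 = 870 + 1 +
    7.\<close>
  have "real (s * (n * (2 + trial_ops M n) + prep_ops M n) +
      (s * (3 * n) + svd_ops M n s + (n * (2 * k) + prep_ops M n) +
      (t * sample_ops M n + (t * (k + 1) + matmul_ops n t k))))
    \<le> (725 + 870 * c) * Q + (435 * Q + c * 145 powr (\<omega> - 1) * Q + (2 * Q + c * Q) +
      (7 * c * Q + (14 * Q + (16 * c\<^sub>0 + 8) * Q)))"
    using one two svd three prep draws factor mm by (simp only: of_nat_add)
  also have "\<dots> = (1184 + 878 * c + c * 145 powr (\<omega> - 1) + 16 * c\<^sub>0) * Q" by (simp add: algebra_simps)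
  finally show ?thesis unfolding Q_def P_def .
qed

theorem theorem12:
  "\<exists>C>0. \<exists>C'>0. \<exists>K::real. \<forall>\<omega> c. matmul_exponent \<omega> \<longrightarrow> (\<exists>K'::real.
     \<forall>(M :: cost_model) svd (n :: nat) (A :: real mat) (k :: nat) (\<epsilon> :: real).
       charges c \<omega> M \<and> svd_routine svd \<and>
       psd_mat n A \<and> A \<noteq> 0\<^sub>m n n \<and> 1 \<le> k \<and> k \<le> n \<and> 0 < \<epsilon> \<and> \<epsilon> < 1 \<longrightarrow>
       (let R = low_rank_approx C C' M svd A k \<epsilon> in
          lossless_spmf R \<and>
          (\<forall>A\<^sub>k. best_rank_approx k A A\<^sub>k \<longrightarrow>
             2 / 3 \<le> measure (measure_spmf R) {r. \<exists>X Y. outcome r = (X, Y) \<and>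
                X \<in> carrier_mat n k \<and> Y \<in> carrier_mat n k \<and>
                (frob_norm (A - X * transpose_mat Y))\<^sup>2
                  \<le> (frob_norm (A - A\<^sub>k))\<^sup>2 + \<epsilon> * (frob_norm A)\<^sup>2}) \<and>
          (\<integral>\<^sup>+ r. ennreal (real (queries r)) \<partial>measure_spmf R)
            \<le> ennreal (K * (real n * real k / \<epsilon>\<^sup>2)) \<and>
          (\<integral>\<^sup>+ r. ennreal (real (ops r)) \<partial>measure_spmf R)
            \<le> ennreal (K' * (real n * (real k / \<epsilon>\<^sup>2) powr (\<omega> - 1)))))"
proof (rule exI[of _ 144], rule conjI, simp, rule exI[of _ 6], rule conjI, simp, rule exI[of _ 442], intro allI impI)
  fix \<omega> c :: real
  assume "matmul_exponent \<omega>"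
  then have \<omega>: "2 \<le> \<omega>" by (rule matmul_exponent_ge_2)
  obtain c\<^sub>0 where c\<^sub>0: "\<And>m. 1 \<le> m \<Longrightarrow> real (matmul_ops m m m) \<le> c\<^sub>0 * real m powr \<omega>"
    using \<open>matmul_exponent \<omega>\<close> unfolding matmul_exponent_def by blast
  show "\<exists>K'::real.
     \<forall>(M :: cost_model) svd (n :: nat) (A :: real mat) (k :: nat) (\<epsilon> :: real).
       charges c \<omega> M \<and> svd_routine svd \<and>
       psd_mat n A \<and> A \<noteq> 0\<^sub>m n n \<and> 1 \<le> k \<and> k \<le> n \<and> 0 < \<epsilon> \<and> \<epsilon> < 1 \<longrightarrow>
       (let R = low_rank_approx 144 6 M svd A k \<epsilon> in
          lossless_spmf R \<and>
          (\<forall>A\<^sub>k. best_rank_approx k A A\<^sub>k \<longrightarrow>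
             2 / 3 \<le> measure (measure_spmf R) {r. \<exists>X Y. outcome r = (X, Y) \<and>
                X \<in> carrier_mat n k \<and> Y \<in> carrier_mat n k \<and>
                (frob_norm (A - X * transpose_mat Y))\<^sup>2
                  \<le> (frob_norm (A - A\<^sub>k))\<^sup>2 + \<epsilon> * (frob_norm A)\<^sup>2}) \<and>
          (\<integral>\<^sup>+ r. ennreal (real (queries r)) \<partial>measure_spmf R)
            \<le> ennreal (442 * (real n * real k / \<epsilon>\<^sup>2)) \<and>
          (\<integral>\<^sup>+ r. ennreal (real (ops r)) \<partial>measure_spmf R)
            \<le> ennreal (K' * (real n * (real k / \<epsilon>\<^sup>2) powr (\<omega> - 1))))"
  proof (rule exI[of _ "1184 + 878 * c + c * 145 powr (\<omega> - 1) + 16 * c\<^sub>0"], intro allI impI, elim conjE, unfold Let_def)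
    fix M :: cost_model and svd and n :: nat and A :: "real mat" and k :: nat and \<epsilon> :: real
    assume M: "charges c \<omega> M" and svd: "svd_routine svd" and psd: "psd_mat n A" and nonzero: "A \<noteq> 0\<^sub>m n n"
      and k: "1 \<le> k" "k \<le> n" and \<epsilon>: "0 < \<epsilon>" "\<epsilon> < 1"
    let ?R = "low_rank_approx 144 6 M svd A k \<epsilon>"
    define s where "s = nat \<lceil>144 * real k / \<epsilon>\<^sup>2\<rceil>"
    define t where "t = nat \<lceil>6 * real k / \<epsilon>\<rceil>"
    have A: "A \<in> carrier_mat n n" using psd unfolding psd_mat_def by auto
    have \<epsilon>2: "\<epsilon>\<^sup>2 \<le> \<epsilon>" "0 < \<epsilon>\<^sup>2" using \<epsilon> by (auto simp: power2_eq_square mult_left_le)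
    have k\<epsilon>: "1 \<le> real k / \<epsilon>" "1 \<le> real k / \<epsilon>\<^sup>2" "real k / \<epsilon> \<le> real k / \<epsilon>\<^sup>2"
    proof -
      show 1: "1 \<le> real k / \<epsilon>" using k \<epsilon> by (simp add: le_divide_eq)
      show 2: "real k / \<epsilon> \<le> real k / \<epsilon>\<^sup>2" by (intro divide_left_mono mult_pos_pos \<epsilon>(1) \<epsilon>2) simp
      show "1 \<le> real k / \<epsilon>\<^sup>2" using 1 2 by linarith
    qed
    \<comment> \<open>Rounding up adds at most 1, which is at most k / \<epsilon>^2; hence 145 in
      place of 144, and likewise 7 in place of 6 for \<open>t\<close>.\<close>
    have s: "144 * real k / \<epsilon>\<^sup>2 \<le> real s" "real s \<le> 145 * (real k / \<epsilon>\<^sup>2)" "1 \<le> s"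
    proof -
      have eq: "144 * real k / \<epsilon>\<^sup>2 = 144 * (real k / \<epsilon>\<^sup>2)" by simp
      have "1 \<le> 144 * real k / \<epsilon>\<^sup>2" unfolding eq using k\<epsilon>(2) by linarith
      from nat_ceiling_bounds[OF this, folded s_def]
      show 1: "144 * real k / \<epsilon>\<^sup>2 \<le> real s" and "real s \<le> 145 * (real k / \<epsilon>\<^sup>2)"
        unfolding eq using k\<epsilon>(2) by linarith+
      show "1 \<le> s" using 1 k\<epsilon>(2) unfolding eq by linarith
    qed
    have t: "6 * real k / \<epsilon> \<le> real t" "real t \<le> 7 * real k / \<epsilon>"
    proof -
      have eq: "6 * real k / \<epsilon> = 6 * (real k / \<epsilon>)" "7 * real k / \<epsilon> = 7 * (real k / \<epsilon>)" by simp_all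
      have "1 \<le> 6 * real k / \<epsilon>" unfolding eq using k\<epsilon>(1) by linarith
      from nat_ceiling_bounds[OF this, folded t_def]
      show "6 * real k / \<epsilon> \<le> real t" and "real t \<le> 7 * real k / \<epsilon>"
        unfolding eq using k\<epsilon>(1) by linarith+
    qed
    note out = low_rank_approx_outcome[OF psd nonzero s_def t_def]
    \<comment> \<open>The law of the outcome is a genuine pmf, and forgetting the counts preserves
      total mass. So no missing mass lowers the expected costs below.\<close>
    have "lossless_spmf (map_spmf outcome ?R)" unfolding out by simp
    then have "lossless_spmf ?R" by simp
    moreover have "2 / 3 \<le> measure (measure_spmf ?R) {r. \<exists>X Y. outcome r = (X, Y) \<and>
                X \<in> carrier_mat n k \<and> Y \<in> carrier_mat n k \<and>
                (frob_norm (A - X * transpose_mat Y))\<^sup>2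
                  \<le> (frob_norm (A - A\<^sub>k))\<^sup>2 + \<epsilon> * (frob_norm A)\<^sup>2}" (is "_ \<le> measure _ ?S")
      if "best_rank_approx k A A\<^sub>k" for A\<^sub>k
    proof -
      have B: "A\<^sub>k \<in> carrier_mat n n" "vec_space.rank n A\<^sub>k \<le> k"
        using that A unfolding best_rank_approx_def by auto
      let ?G = "{(X, Y). X \<in> carrier_mat n k \<and> Y \<in> carrier_mat n k \<and>
        (frob_norm (A - X * transpose_mat Y))\<^sup>2 \<le> (frob_norm (A - A\<^sub>k))\<^sup>2 + \<epsilon> * (frob_norm A)\<^sup>2}"
      have "2 / 3 \<le> measure (measure_spmf (map_spmf outcome ?R)) ?G"
        unfolding out measure_spmf_spmf_of_pmf
        by (rule low_rank_approx_accuracy[OF svd psd nonzero k \<epsilon>(1) s(1) t(1) B])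
      also have "\<dots> = measure (measure_spmf ?R) (outcome -` ?G)" by (rule measure_map_spmf)
      also have "outcome -` ?G = ?S" by auto
      finally show ?thesis .
    qed
    moreover have "(\<integral>\<^sup>+ r. ennreal (real (queries r)) \<partial>measure_spmf ?R) \<le> ennreal (442 * (real n * real k / \<epsilon>\<^sup>2))"
    proof -
      have "(\<integral>\<^sup>+ r. ennreal (real (queries r)) \<partial>measure_spmf ?R) = cost 1 0 ?R"
        unfolding cost_def by simp
      also have "\<dots> \<le> ennreal (real (3 * (s * n) + t * n))"
        using low_rank_approx_cost[OF psd nonzero s_def t_def, of 1 0] by (simp add: algebra_simps)
      also have "\<dots> \<le> ennreal (442 * (real n * real k / \<epsilon>\<^sup>2))"
      proof (rule ennreal_leI)
        \<comment> \<open>A column sample takes 2 n queries in expectation and n to read the column;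
          a row takes n. With s at most 145 P, t at most 7 P and P = k / \<epsilon>^2 this gives 442
          = 3 * 145 + 7.\<close>
        have "3 * real s + real t \<le> 442 * (real k / \<epsilon>\<^sup>2)" using s(2) t(2) k\<epsilon>(3) by simp
        then have "(3 * real s + real t) * real n \<le> 442 * (real k / \<epsilon>\<^sup>2) * real n" by (rule mult_right_mono) simp
        then show "real (3 * (s * n) + t * n) \<le> 442 * (real n * real k / \<epsilon>\<^sup>2)" by (simp add: algebra_simps)
      qed
      finally show ?thesis .
    qed
    moreover have "(\<integral>\<^sup>+ r. ennreal (real (ops r)) \<partial>measure_spmf ?R)
      \<le> ennreal ((1184 + 878 * c + c * 145 powr (\<omega> - 1) + 16 * c\<^sub>0) * (real n * (real k / \<epsilon>\<^sup>2) powr (\<omega> - 1)))"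
    proof -
      have "(\<integral>\<^sup>+ r. ennreal (real (ops r)) \<partial>measure_spmf ?R) = cost 0 1 ?R"
        unfolding cost_def by simp
      also have "\<dots> \<le> ennreal (real (s * (n * (2 + trial_ops M n) + prep_ops M n) +
          (s * (3 * n) + svd_ops M n s + (n * (2 * k) + prep_ops M n) +
          (t * sample_ops M n + (t * (k + 1) + matmul_ops n t k)))))"
        using low_rank_approx_cost[OF psd nonzero s_def t_def, of 0 1]
        by (simp only: mult_0 mult_0_right mult_1 add_0)
      also have "\<dots> \<le> ennreal ((1184 + 878 * c + c * 145 powr (\<omega> - 1) + 16 * c\<^sub>0) * (real n * (real k / \<epsilon>\<^sup>2) powr (\<omega> - 1)))"
        by (rule ennreal_leI[OF operation_count[OF \<omega> c\<^sub>0 M k \<epsilon> s(3,2) t(2)]])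
      finally show ?thesis .
    qed
    ultimately show "lossless_spmf ?R \<and>
          (\<forall>A\<^sub>k. best_rank_approx k A A\<^sub>k \<longrightarrow>
             2 / 3 \<le> measure (measure_spmf ?R) {r. \<exists>X Y. outcome r = (X, Y) \<and>
                X \<in> carrier_mat n k \<and> Y \<in> carrier_mat n k \<and>
                (frob_norm (A - X * transpose_mat Y))\<^sup>2
                  \<le> (frob_norm (A - A\<^sub>k))\<^sup>2 + \<epsilon> * (frob_norm A)\<^sup>2}) \<and>
          (\<integral>\<^sup>+ r. ennreal (real (queries r)) \<partial>measure_spmf ?R)
            \<le> ennreal (442 * (real n * real k / \<epsilon>\<^sup>2)) \<and>
          (\<integral>\<^sup>+ r. ennreal (real (ops r)) \<partial>measure_spmf ?R)
            \<le> ennreal ((1184 + 878 * c + c * 145 powr (\<omega> - 1) + 16 * c\<^sub>0) * (real n * (real k / \<epsilon>\<^sup>2) powr (\<omega> - 1)))"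
      by blast
  qed
qed

end
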